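(* Let $M$ be a manifold with a contact structure $\mathcal{H}$, let $X$ be a Hamiltonian contact field with respect to $\mathcal{H}$, and let $\Pi:M\to N$ be a fibration. Suppose that a global contact form $\eta$ defining $\mathcal{H}$ is known, with Reeb vector field $\xi$, such that the Hamiltonian function $H$ of $X$ with respect to $\eta$ satisfies $\xi(H)=0$, and that a complete solution of the $\Pi$-HJE for $X$ that is pseudo-isotropic with respect to $\eta$ is known. Then $X$ is integrable by quadratures.
   Context: All manifolds are finite-dimensional and smooth, all maps smooth. A contact structure on a $(2n+1)$-dimensional manifold $M$ is a distribution $\mathcal{H}$ of rank $2n$ such that around every point there are an open neighborhood $U$ and a local 1-form $\alpha$ on $U$ with $\ker\alpha=\mathcal{H}|_U$ and $(d\alpha)^n\wedge\alpha$ nowhere zero. A global contact form defining $\mathcal{H}$ is a 1-form $\eta$ on $M$ with $\ker\eta=\mathcal{H}$ and $(d\eta)^n\wedge\eta$ nowhere zero. The Reeb vector field $\xi$ of $\eta$ is the unique vector field with $i_\xi d\eta=0$, $i_\xi\eta=1$. For $H\in C^\infty(M)$ the contact field $X_H$ with respect to $\eta$ is the unique vector field with $i_{X_H}d\eta=-dH+\xi(H)\,\eta$ and $i_{X_H}\eta=H$. A vector field $X$ is a Hamiltonian contact field with respect to $\mathcal{H}$ if there is a global contact form $\eta$ defining $\mathcal{H}$ and a function $H$ with $X=X_H$ with respect to $\eta$; $H=i_X\eta$ is then the Hamiltonian function of $X$ with respect to $\eta$. (If $X=X_H$ for $\eta$, then $X=X_{gH}$ for any equivalent contact form $g\eta$,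 $g$ non-vanishing.) A fibration $\Pi:M\to N$ is a surjective submersion. A section $\sigma:N\to M$ of $\Pi$ is a solution of the $\Pi$-Hamilton-Jacobi equation ($\Pi$-HJE) for $X$ if $\sigma_*\circ\Pi_*\circ X\circ\sigma=X\circ\sigma$. A complete solution is a surjective local diffeomorphism $\Sigma:N\times\Lambda\to M$, where $\Lambda$ is a manifold with $\dim\Lambda+\dim N=\dim M$, such that for every $\lambda\in\Lambda$ the map $\sigma_\lambda:=\Sigma(\cdot,\lambda)$ is a section of $\Pi$ solving the $\Pi$-HJE for $X$. It is pseudo-isotropic with respect to $\eta$ if $\sigma_\lambda^*d\eta=0$ for all $\lambda\in\Lambda$. "$X$ is integrable by quadratures" has its usual meaning: starting from the known data, the integral curves of $X$ can be obtained (locally, around each point) by a finite number of operations consisting of algebraic operations, differentiation, solving of algebraic (i.e. finite, non-differential) equations via inversion of known local diffeomorphisms or immersions, and quadratures (computing integrals, i.e. primitives, of known functions or known closed 1-forms). *)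

theory Defs
  imports "HOL-Analysis.Analysis"
begin

text \<open>Model spaces are finite-dimensional normed spaces. Unlike \<^class>\<open>euclidean_space\<close>, this
  admits dimension 0 (the fibration may have a base or a parameter manifold of dimension 0).
  The constant \<^const>\<open>span\<close> cannot be used in the class specification; the lemma below restates
  the assumption with it.\<close>

class finite_dim_normed = real_normed_vector +
  assumes finite_generating_set: "\<exists>B. finite B \<and>
    (\<forall>S. 0 \<in> S \<and> B \<subseteq> S \<and> (\<forall>x\<in>S. \<forall>y\<in>S. x + y \<in> S) \<and> (\<forall>r. \<forall>x\<in>S. r *\<^sub>R x \<in> S) \<longrightarrow> S = UNIV)"

lemma generating_set_iff_span:
  fixes B :: "'a::real_vector set"
  shows "(\<forall>S. 0 \<in> S \<and> B \<subseteq> S \<and> (\<forall>x\<in>S. \<forall>y\<in>S. x + y \<in> S) \<and> (\<forall>r. \<forall>x\<in>S. r *\<^sub>R x \<in> S) \<longrightarrow> S = UNIV)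
    \<longleftrightarrow> span B = UNIV"
proof -
  have "(\<forall>S. subspace S \<and> B \<subseteq> S \<longrightarrow> S = UNIV) \<longleftrightarrow> span B = UNIV"
    by (metis span_minimal span_superset subspace_span top.extremum_unique)
  then show ?thesis
    by (simp add: subspace_def conj_ac)
qed

lemma finite_spanning_set: "\<exists>B :: 'a::finite_dim_normed set. finite B \<and> span B = UNIV"
  using finite_generating_set by (simp only: generating_set_iff_span)

instance euclidean_space \<subseteq> finite_dim_normed
  by standard (unfold generating_set_iff_span, use finite_Basis span_Basis in blast)

abbreviation model_dim :: "'a::real_vector itself \<Rightarrow> nat" where
  "model_dim _ \<equiv> dim (UNIV :: 'a set)"

text \<open>Both notions below are meant for open \<^term>\<open>S\<close> in a finite-dimensional space, where continuity
  of all directional derivatives is continuity of the derivative.\<close>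

primrec Ck_on :: "nat \<Rightarrow> 'a::real_normed_vector set \<Rightarrow> ('a \<Rightarrow> 'b::real_normed_vector) \<Rightarrow> bool" where
  "Ck_on 0 S f \<longleftrightarrow> continuous_on S f"
| "Ck_on (Suc k) S f \<longleftrightarrow>
     (\<exists>f'. (\<forall>x\<in>S. (f has_derivative f' x) (at x)) \<and> (\<forall>v. Ck_on k S (\<lambda>x. f' x v)))"

definition smooth_on :: "'a::real_normed_vector set \<Rightarrow> ('a \<Rightarrow> 'b::real_normed_vector) \<Rightarrow> bool" where
  "smooth_on S f \<longleftrightarrow> (\<forall>k. Ck_on k S f)"

text \<open>A chart is a pair of its domain and its coordinate map, the latter relevant on the domain only.\<close>

type_synonym ('m, 'e) chart = "'m set \<times> ('m \<Rightarrow> 'e)"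

definition chart_inv :: "('m, 'e) chart \<Rightarrow> 'e \<Rightarrow> 'm" where
  "chart_inv c = inv_into (fst c) (snd c)"

definition is_chart :: "('m::topological_space, 'e::real_normed_vector) chart \<Rightarrow> bool" where
  "is_chart c \<longleftrightarrow> open (fst c) \<and> open (snd c ` fst c) \<and>
     homeomorphism (fst c) (snd c ` fst c) (snd c) (chart_inv c)"

text \<open>A manifold is a Hausdorff, second countable type with a (not necessarily maximal) smooth atlas.\<close>

definition smooth_atlas :: "('m::topological_space, 'e::real_normed_vector) chart set \<Rightarrow> bool" where
  "smooth_atlas A \<longleftrightarrow> (\<forall>c\<in>A. is_chart c) \<and> (\<Union>c\<in>A. fst c) = UNIV \<and>
     (\<forall>c\<in>A. \<forall>d\<in>A. smooth_on (snd c ` (fst c \<inter> fst d)) (snd d \<circ> chart_inv c))"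

definition product_atlas :: "('m, 'e) chart set \<Rightarrow> ('n, 'f) chart set \<Rightarrow> ('m \<times> 'n, 'e \<times> 'f) chart set" where
  "product_atlas A B = {(fst c \<times> fst d, \<lambda>(x, y). (snd c x, snd d y)) | c d. c \<in> A \<and> d \<in> B}"

definition smooth_map_on ::
  "('m::topological_space, 'e::real_normed_vector) chart set \<Rightarrow> 'm set \<Rightarrow>
   ('n::topological_space, 'f::real_normed_vector) chart set \<Rightarrow> ('m \<Rightarrow> 'n) \<Rightarrow> bool" where
  "smooth_map_on A U B f \<longleftrightarrow> continuous_on U f \<and>
     (\<forall>c\<in>A. \<forall>d\<in>B. smooth_on (snd c ` (fst c \<inter> U \<inter> f -` fst d)) (snd d \<circ> f \<circ> chart_inv c))"

abbreviation "smooth_map A B f \<equiv> smooth_map_on A UNIV B f"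

definition smooth_function :: "('m::topological_space, 'e::real_normed_vector) chart set \<Rightarrow> ('m \<Rightarrow> real) \<Rightarrow> bool" where
  "smooth_function A f \<longleftrightarrow> (\<forall>c\<in>A. smooth_on (snd c ` fst c) (f \<circ> chart_inv c))"

text \<open>The tangent space at \<open>p\<close> is identified with the model space through a preferred chart
  \<open>chart_at A p\<close> around \<open>p\<close>: a vector \<open>v\<close> of the model space stands for the tangent vector
  at \<open>p\<close> whose components in that chart are \<open>v\<close>. Its components in another chart \<open>c\<close> are
  \<open>to_chart A c p v\<close>; conversely \<open>from_chart A c p w\<close> is the tangent vector at \<open>p\<close> with
  components \<open>w\<close> in \<open>c\<close>.\<close>

definition chart_at :: "('m, 'e) chart set \<Rightarrow> 'm \<Rightarrow> ('m, 'e) chart" where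
  "chart_at A p = (SOME c. c \<in> A \<and> p \<in> fst c)"

definition to_chart :: "('m, 'e::real_normed_vector) chart set \<Rightarrow> ('m, 'e) chart \<Rightarrow> 'm \<Rightarrow> 'e \<Rightarrow> 'e" where
  "to_chart A c p =
     frechet_derivative (snd c \<circ> chart_inv (chart_at A p)) (at (snd (chart_at A p) p))"

definition from_chart :: "('m, 'e::real_normed_vector) chart set \<Rightarrow> ('m, 'e) chart \<Rightarrow> 'm \<Rightarrow> 'e \<Rightarrow> 'e" where
  "from_chart A c p =
     frechet_derivative (snd (chart_at A p) \<circ> chart_inv c) (at (snd c p))"

definition tangent_map ::
  "('m, 'e::real_normed_vector) chart set \<Rightarrow> ('n, 'f::real_normed_vector) chart set \<Rightarrow>
   ('m \<Rightarrow> 'n) \<Rightarrow> 'm \<Rightarrow> 'e \<Rightarrow> 'f" where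
  "tangent_map A B f p =
     frechet_derivative (snd (chart_at B (f p)) \<circ> f \<circ> chart_inv (chart_at A p))
       (at (snd (chart_at A p) p))"

definition vector_field :: "('m, 'e::real_normed_vector) chart set \<Rightarrow> ('m \<Rightarrow> 'e) \<Rightarrow> bool" where
  "vector_field A X \<longleftrightarrow>
     (\<forall>c\<in>A. smooth_on (snd c ` fst c) (\<lambda>x. to_chart A c (chart_inv c x) (X (chart_inv c x))))"

definition one_form_on ::
  "('m, 'e::real_normed_vector) chart set \<Rightarrow> 'm set \<Rightarrow> ('m \<Rightarrow> 'e \<Rightarrow> real) \<Rightarrow> bool" where
  "one_form_on A U \<alpha> \<longleftrightarrow> (\<forall>p\<in>U. linear (\<alpha> p)) \<and>
     (\<forall>c\<in>A. \<forall>w. smooth_on (snd c ` (fst c \<inter> U))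
        (\<lambda>x. \<alpha> (chart_inv c x) (from_chart A c (chart_inv c x) w)))"

definition differential :: "('m, 'e::real_normed_vector) chart set \<Rightarrow> ('m \<Rightarrow> real) \<Rightarrow> 'm \<Rightarrow> 'e \<Rightarrow> real" where
  "differential A f p =
     frechet_derivative (f \<circ> chart_inv (chart_at A p)) (at (snd (chart_at A p) p))"

text \<open>Exterior derivative of a 1-form, without factor 1/2: in a chart,
  \<open>d\<alpha>(u, v) = D\<^sub>u(\<alpha>(v)) - D\<^sub>v(\<alpha>(u))\<close> for constant \<open>u, v\<close>.\<close>

definition ext_deriv ::
  "('m, 'e::real_normed_vector) chart set \<Rightarrow> ('m \<Rightarrow> 'e \<Rightarrow> real) \<Rightarrow> 'm \<Rightarrow> 'e \<Rightarrow> 'e \<Rightarrow> real" where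
  "ext_deriv A \<alpha> p u v =
    (let c = chart_at A p;
         \<alpha>c = (\<lambda>w x. \<alpha> (chart_inv c x) (from_chart A c (chart_inv c x) w))
     in frechet_derivative (\<alpha>c v) (at (snd c p)) u - frechet_derivative (\<alpha>c u) (at (snd c p)) v)"

text \<open>A \<open>k\<close>-form on a vector space is a function of a sequence of vectors that depends only on
  its first \<open>k\<close> entries.\<close>

definition wedge ::
  "nat \<Rightarrow> nat \<Rightarrow> ((nat \<Rightarrow> 'e) \<Rightarrow> real) \<Rightarrow> ((nat \<Rightarrow> 'e) \<Rightarrow> real) \<Rightarrow> (nat \<Rightarrow> 'e) \<Rightarrow> real" where
  "wedge k l \<alpha> \<beta> v =
     (\<Sum>\<tau> | \<tau> permutes {..<k + l}.
        of_int (sign \<tau>) * \<alpha> (\<lambda>i. v (\<tau> i)) * \<beta> (\<lambda>i. v (\<tau> (k + i)))) / (fact k * fact l)"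

primrec wedge_power :: "nat \<Rightarrow> ((nat \<Rightarrow> 'e) \<Rightarrow> real) \<Rightarrow> (nat \<Rightarrow> 'e) \<Rightarrow> real" where
  "wedge_power 0 \<omega> = (\<lambda>v. 1)"
| "wedge_power (Suc n) \<omega> = wedge (2 * n) 2 (wedge_power n \<omega>) \<omega>"

definition contact_nondegenerate ::
  "('m, 'e::real_normed_vector) chart set \<Rightarrow> nat \<Rightarrow> 'm set \<Rightarrow> ('m \<Rightarrow> 'e \<Rightarrow> real) \<Rightarrow> bool" where
  "contact_nondegenerate A n U \<alpha> \<longleftrightarrow>
     (\<forall>p\<in>U. \<exists>v. wedge (2 * n) 1 (wedge_power n (\<lambda>v. ext_deriv A \<alpha> p (v 0) (v 1)))
                   (\<lambda>v. \<alpha> p (v 0)) v \<noteq> 0)"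

text \<open>Smoothness of the distribution follows from the existence of the smooth local forms.\<close>

definition contact_structure ::
  "('m::topological_space, 'e::real_normed_vector) chart set \<Rightarrow> nat \<Rightarrow> ('m \<Rightarrow> 'e set) \<Rightarrow> bool" where
  "contact_structure A n \<H> \<longleftrightarrow> model_dim TYPE('e) = 2 * n + 1 \<and>
     (\<forall>p. subspace (\<H> p) \<and> dim (\<H> p) = 2 * n) \<and>
     (\<forall>p. \<exists>U \<alpha>. open U \<and> p \<in> U \<and> one_form_on A U \<alpha> \<and>
        (\<forall>q\<in>U. {v. \<alpha> q v = 0} = \<H> q) \<and> contact_nondegenerate A n U \<alpha>)"

definition contact_form ::
  "('m::topological_space, 'e::real_normed_vector) chart set \<Rightarrow> nat \<Rightarrow> ('m \<Rightarrow> 'e set) \<Rightarrow>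
   ('m \<Rightarrow> 'e \<Rightarrow> real) \<Rightarrow> bool" where
  "contact_form A n \<H> \<eta> \<longleftrightarrow> one_form_on A UNIV \<eta> \<and> (\<forall>p. {v. \<eta> p v = 0} = \<H> p) \<and>
     contact_nondegenerate A n UNIV \<eta>"

definition reeb_field ::
  "('m, 'e::real_normed_vector) chart set \<Rightarrow> ('m \<Rightarrow> 'e \<Rightarrow> real) \<Rightarrow> ('m \<Rightarrow> 'e) \<Rightarrow> bool" where
  "reeb_field A \<eta> \<xi> \<longleftrightarrow> vector_field A \<xi> \<and>
     (\<forall>p. (\<forall>v. ext_deriv A \<eta> p (\<xi> p) v = 0) \<and> \<eta> p (\<xi> p) = 1)"

definition contact_field ::
  "('m, 'e::real_normed_vector) chart set \<Rightarrow> ('m \<Rightarrow> 'e \<Rightarrow> real) \<Rightarrow> ('m \<Rightarrow> real) \<Rightarrow> ('m \<Rightarrow> 'e) \<Rightarrow> bool" where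
  "contact_field A \<eta> H X \<longleftrightarrow> vector_field A X \<and>
     (\<exists>\<xi>. reeb_field A \<eta> \<xi> \<and>
        (\<forall>p v. ext_deriv A \<eta> p (X p) v
               = - differential A H p v + differential A H p (\<xi> p) * \<eta> p v)) \<and>
     (\<forall>p. \<eta> p (X p) = H p)"

definition hamiltonian_contact_field ::
  "('m::topological_space, 'e::real_normed_vector) chart set \<Rightarrow> nat \<Rightarrow> ('m \<Rightarrow> 'e set) \<Rightarrow> ('m \<Rightarrow> 'e) \<Rightarrow> bool" where
  "hamiltonian_contact_field A n \<H> X \<longleftrightarrow>
     (\<exists>\<eta> H. contact_form A n \<H> \<eta> \<and> smooth_function A H \<and> contact_field A \<eta> H X)"

text \<open>Meant for a Hamiltonian contact field \<open>X\<close> and any global contact form \<open>\<eta>\<close> of the structure: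
  if \<open>X\<close> is the contact field of \<open>H\<close> for \<open>\<eta>\<close>, it is that of \<open>g H\<close> for \<open>g \<eta>\<close>, so
  contracting with the form always gives the function.\<close>

definition hamiltonian_function :: "('m \<Rightarrow> 'e \<Rightarrow> real) \<Rightarrow> ('m \<Rightarrow> 'e) \<Rightarrow> 'm \<Rightarrow> real" where
  "hamiltonian_function \<eta> X p = \<eta> p (X p)"

definition fibration ::
  "('m::topological_space, 'e::real_normed_vector) chart set \<Rightarrow>
   ('n::topological_space, 'f::real_normed_vector) chart set \<Rightarrow> ('m \<Rightarrow> 'n) \<Rightarrow> bool" where
  "fibration A B \<pi> \<longleftrightarrow> smooth_map A B \<pi> \<and> surj \<pi> \<and> (\<forall>p. surj (tangent_map A B \<pi> p))"

definition smooth_section ::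
  "('m::topological_space, 'e::real_normed_vector) chart set \<Rightarrow>
   ('n::topological_space, 'f::real_normed_vector) chart set \<Rightarrow> ('m \<Rightarrow> 'n) \<Rightarrow> ('n \<Rightarrow> 'm) \<Rightarrow> bool" where
  "smooth_section A B \<pi> \<sigma> \<longleftrightarrow> smooth_map B A \<sigma> \<and> (\<forall>x. \<pi> (\<sigma> x) = x)"

definition HJE_solution ::
  "('m::topological_space, 'e::real_normed_vector) chart set \<Rightarrow>
   ('n::topological_space, 'f::real_normed_vector) chart set \<Rightarrow> ('m \<Rightarrow> 'n) \<Rightarrow> ('m \<Rightarrow> 'e) \<Rightarrow>
   ('n \<Rightarrow> 'm) \<Rightarrow> bool" where
  "HJE_solution A B \<pi> X \<sigma> \<longleftrightarrow> smooth_section A B \<pi> \<sigma> \<and>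
     (\<forall>x. tangent_map B A \<sigma> (\<pi> (\<sigma> x)) (tangent_map A B \<pi> (\<sigma> x) (X (\<sigma> x))) = X (\<sigma> x))"

definition local_diffeomorphism ::
  "('m::topological_space, 'e::real_normed_vector) chart set \<Rightarrow>
   ('n::topological_space, 'f::real_normed_vector) chart set \<Rightarrow> ('m \<Rightarrow> 'n) \<Rightarrow> bool" where
  "local_diffeomorphism A B f \<longleftrightarrow>
     (\<forall>p. \<exists>U. open U \<and> p \<in> U \<and> open (f ` U) \<and> inj_on f U \<and>
        smooth_map_on A U B f \<and> smooth_map_on B (f ` U) A (inv_into U f))"

definition complete_solution ::
  "('m::topological_space, 'e::real_normed_vector) chart set \<Rightarrow>
   ('n::topological_space, 'f::real_normed_vector) chart set \<Rightarrow>
   ('l::topological_space, 'g::real_normed_vector) chart set \<Rightarrow>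
   ('m \<Rightarrow> 'n) \<Rightarrow> ('m \<Rightarrow> 'e) \<Rightarrow> ('n \<times> 'l \<Rightarrow> 'm) \<Rightarrow> bool" where
  "complete_solution A B C \<pi> X \<Sigma> \<longleftrightarrow>
     model_dim TYPE('g) + model_dim TYPE('f) = model_dim TYPE('e) \<and>
     surj \<Sigma> \<and> local_diffeomorphism (product_atlas B C) A \<Sigma> \<and>
     (\<forall>l. HJE_solution A B \<pi> X (\<lambda>x. \<Sigma> (x, l)))"

definition pseudo_isotropic ::
  "('m, 'e::real_normed_vector) chart set \<Rightarrow> ('n, 'f::real_normed_vector) chart set \<Rightarrow>
   ('m \<Rightarrow> 'e \<Rightarrow> real) \<Rightarrow> ('n \<times> 'l \<Rightarrow> 'm) \<Rightarrow> bool" where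
  "pseudo_isotropic A B \<eta> \<Sigma> \<longleftrightarrow>
     (\<forall>l x u v. ext_deriv A \<eta> (\<Sigma> (x, l))
                  (tangent_map B A (\<lambda>y. \<Sigma> (y, l)) x u)
                  (tangent_map B A (\<lambda>y. \<Sigma> (y, l)) x v) = 0)"

text \<open>Functions of \<open>k\<close> real variables are functions on subsets of \<^term>\<open>Euclidean_space k\<close>, i.e. of
  sequences that vanish from index \<open>k\<close> on.\<close>

definition tuple :: "nat \<Rightarrow> (nat \<Rightarrow> real) \<Rightarrow> nat \<Rightarrow> real" where
  "tuple k y = (\<lambda>i. if i < k then y i else 0)"

definition has_partial ::
  "((nat \<Rightarrow> real) \<Rightarrow> real) \<Rightarrow> nat \<Rightarrow> ((nat \<Rightarrow> real) \<Rightarrow> real) \<Rightarrow> (nat \<Rightarrow> real) set \<Rightarrow> bool" where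
  "has_partial f i f' U \<longleftrightarrow> (\<forall>x\<in>U. ((\<lambda>s. f (x(i := s))) has_real_derivative f' x) (at (x i)))"

text \<open>\<open>quadratures D k U f\<close>: the function \<open>f\<close> of \<open>k\<close> variables on the open set \<open>U\<close> arises from the
  known functions \<open>D\<close> by finitely many admissible operations. Each operation determines its result,
  up to a real constant at most, so that no unknown function can enter:
  the primitive with respect to one variable (the others being parameters) is normalised to vanish
  where that variable has a fixed value \<open>a\<close>; a primitive of a closed 1-form is taken on a connected
  set; equations \<open>f(r(y)) = g(y)\<close> are solved for continuous \<open>r\<close> where the immersion \<open>f\<close> is
  injective (for \<open>g\<close> the identity, \<open>r\<close> is the inverse of \<open>f\<close>).\<close>

inductive quadratures ::
  "(nat \<times> (nat \<Rightarrow> real) set \<times> ((nat \<Rightarrow> real) \<Rightarrow> real)) set \<Rightarrow>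
   nat \<Rightarrow> (nat \<Rightarrow> real) set \<Rightarrow> ((nat \<Rightarrow> real) \<Rightarrow> real) \<Rightarrow> bool" for D where
  known: "(k, U, f) \<in> D \<Longrightarrow> quadratures D k U f"
| const: "openin (Euclidean_space k) U \<Longrightarrow> quadratures D k U (\<lambda>x. a)"
| variable: "openin (Euclidean_space k) U \<Longrightarrow> i < k \<Longrightarrow> quadratures D k U (\<lambda>x. x i)"
| restrict: "quadratures D k U f \<Longrightarrow> openin (Euclidean_space k) V \<Longrightarrow> V \<subseteq> U \<Longrightarrow>
    (\<And>x. x \<in> V \<Longrightarrow> g x = f x) \<Longrightarrow> quadratures D k V g"
| add: "quadratures D k U f \<Longrightarrow> quadratures D k U g \<Longrightarrow> quadratures D k U (\<lambda>x. f x + g x)"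
| mult: "quadratures D k U f \<Longrightarrow> quadratures D k U g \<Longrightarrow> quadratures D k U (\<lambda>x. f x * g x)"
| divide: "quadratures D k U f \<Longrightarrow> quadratures D k U g \<Longrightarrow> (\<And>x. x \<in> U \<Longrightarrow> g x \<noteq> 0) \<Longrightarrow>
    quadratures D k U (\<lambda>x. f x / g x)"
| compose: "quadratures D l V f \<Longrightarrow> openin (Euclidean_space k) U \<Longrightarrow>
    (\<And>j. j < l \<Longrightarrow> quadratures D k U (g j)) \<Longrightarrow>
    (\<And>x. x \<in> U \<Longrightarrow> tuple l (\<lambda>j. g j x) \<in> V) \<Longrightarrow>
    quadratures D k U (\<lambda>x. f (tuple l (\<lambda>j. g j x)))"
| differentiate: "quadratures D k U f \<Longrightarrow> i < k \<Longrightarrow> has_partial f i f' U \<Longrightarrow> quadratures D k U f'"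
| solve: "openin (Euclidean_space k) U \<Longrightarrow> openin (Euclidean_space h) V \<Longrightarrow>
    (\<And>j. j < l \<Longrightarrow> quadratures D k U (f j)) \<Longrightarrow>
    (\<And>i j. i < k \<Longrightarrow> j < l \<Longrightarrow> has_partial (f j) i (J j i) U) \<Longrightarrow>
    (\<And>x v i. x \<in> U \<Longrightarrow> (\<forall>j<l. (\<Sum>i<k. J j i x * v i) = 0) \<Longrightarrow> i < k \<Longrightarrow> v i = 0) \<Longrightarrow>
    inj_on (\<lambda>x. tuple l (\<lambda>j. f j x)) U \<Longrightarrow>
    (\<And>j. j < l \<Longrightarrow> quadratures D h V (g j)) \<Longrightarrow>
    continuous_map (subtopology (Euclidean_space h) V) (Euclidean_space k) r \<Longrightarrow>
    (\<And>y. y \<in> V \<Longrightarrow> r y \<in> U) \<Longrightarrow>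
    (\<And>y j. y \<in> V \<Longrightarrow> j < l \<Longrightarrow> f j (r y) = g j y) \<Longrightarrow>
    i < k \<Longrightarrow> quadratures D h V (\<lambda>y. r y i)"
| integrate: "quadratures D k U f \<Longrightarrow> i < k \<Longrightarrow>
    (\<And>x s. x \<in> U \<Longrightarrow> s \<in> closed_segment a (x i) \<Longrightarrow> x(i := s) \<in> U) \<Longrightarrow>
    has_partial F i f U \<Longrightarrow> (\<And>x. x \<in> U \<Longrightarrow> x i = a \<Longrightarrow> F x = 0) \<Longrightarrow> quadratures D k U F"
| integrate_closed_form: "openin (Euclidean_space k) U \<Longrightarrow> connectedin (Euclidean_space k) U \<Longrightarrow>
    (\<And>i. i < k \<Longrightarrow> quadratures D k U (f i)) \<Longrightarrow> (\<And>i. i < k \<Longrightarrow> has_partial F i (f i) U) \<Longrightarrow>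
    quadratures D k U F"

text \<open>A fixed linear isomorphism of the model space with \<open>\<real>\<^sup>d\<close> turns a chart into \<open>d\<close> real
  coordinates. Another choice would change coordinate expressions by linear substitutions only.\<close>

definition frame :: "nat \<Rightarrow> 'e::finite_dim_normed" where
  "frame = (SOME b. inj_on b {..<model_dim TYPE('e)} \<and>
     independent (b ` {..<model_dim TYPE('e)}) \<and> span (b ` {..<model_dim TYPE('e)}) = UNIV)"

definition components :: "'e::finite_dim_normed \<Rightarrow> nat \<Rightarrow> real" where
  "components v = tuple (model_dim TYPE('e))
     (\<lambda>i. representation (frame ` {..<model_dim TYPE('e)}) v (frame i))"

definition from_components :: "(nat \<Rightarrow> real) \<Rightarrow> 'e::finite_dim_normed" where
  "from_components x = (\<Sum>i<model_dim TYPE('e). x i *\<^sub>R frame i)"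

definition coords :: "('m, 'e::finite_dim_normed) chart \<Rightarrow> 'm \<Rightarrow> nat \<Rightarrow> real" where
  "coords c p = components (snd c p)"

definition coords_inv :: "('m, 'e::finite_dim_normed) chart \<Rightarrow> (nat \<Rightarrow> real) \<Rightarrow> 'm" where
  "coords_inv c x = chart_inv c (from_components x)"

text \<open>The coordinate expressions of \<open>X\<close>, \<open>\<eta>\<close>, \<open>\<pi>\<close> and \<open>\<Sigma>\<close> in charts \<open>a\<close>, \<open>b\<close>, \<open>c\<close> of
  \<open>M\<close>, \<open>N\<close>, \<open>\<Lambda>\<close>. Only one chart of each manifold is involved: for a maximal atlas, all transition
  maps taken together would contain every local diffeomorphism.\<close>

definition known_data ::
  "('m, 'e::finite_dim_normed) chart set \<Rightarrow> ('m, 'e) chart \<Rightarrow> ('n, 'f::finite_dim_normed) chart \<Rightarrow>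
   ('l, 'g::finite_dim_normed) chart \<Rightarrow> ('m \<Rightarrow> 'e) \<Rightarrow> ('m \<Rightarrow> 'e \<Rightarrow> real) \<Rightarrow> ('m \<Rightarrow> 'n) \<Rightarrow>
   ('n \<times> 'l \<Rightarrow> 'm) \<Rightarrow> (nat \<times> (nat \<Rightarrow> real) set \<times> ((nat \<Rightarrow> real) \<Rightarrow> real)) set" where
  "known_data A a b c X \<eta> \<pi> \<Sigma> =
    (let dM = model_dim TYPE('e); dN = model_dim TYPE('f); dL = model_dim TYPE('g);
         S = (\<lambda>z. \<Sigma> (coords_inv b (tuple dN z), coords_inv c (tuple dL (\<lambda>i. z (dN + i)))))
     in {(dM, coords a ` fst a,
            \<lambda>x. components (to_chart A a (coords_inv a x) (X (coords_inv a x))) i) | i. i < dM}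
      \<union> {(dM, coords a ` fst a,
            \<lambda>x. \<eta> (coords_inv a x) (from_chart A a (coords_inv a x) (frame i))) | i. i < dM}
      \<union> {(dM, coords a ` (fst a \<inter> \<pi> -` fst b),
            \<lambda>x. coords b (\<pi> (coords_inv a x)) i) | i. i < dN}
      \<union> {(dN + dL,
            {z \<in> topspace (Euclidean_space (dN + dL)). tuple dN z \<in> coords b ` fst b \<and>
               tuple dL (\<lambda>i. z (dN + i)) \<in> coords c ` fst c \<and> S z \<in> fst a},
            \<lambda>z. coords a (S z) i) | i. i < dM})"

text \<open>The chart at \<open>\<gamma> t\<close> represents the velocity of \<open>\<gamma>\<close> at \<open>t\<close> as a vector of the tangent space at
  \<open>\<gamma> t\<close>, in which \<open>X (\<gamma> t)\<close> lives.\<close>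

definition integral_curve ::
  "('m::topological_space, 'e::real_normed_vector) chart set \<Rightarrow> ('m \<Rightarrow> 'e) \<Rightarrow> real set \<Rightarrow>
   (real \<Rightarrow> 'm) \<Rightarrow> bool" where
  "integral_curve A X I \<gamma> \<longleftrightarrow> continuous_on I \<gamma> \<and>
     (\<forall>t\<in>I. ((\<lambda>s. snd (chart_at A (\<gamma> t)) (\<gamma> s)) has_vector_derivative X (\<gamma> t)) (at t))"

text \<open>The integral curves starting near \<open>m\<close> exist on a common time interval and, in the chart \<open>a\<close>,
  are obtained by quadratures from \<open>D\<close> as functions of the initial point (variables
  \<open>0, ..., d - 1\<close>) and of time (variable \<open>d\<close>).\<close>

definition flow_by_quadratures ::
  "(nat \<times> (nat \<Rightarrow> real) set \<times> ((nat \<Rightarrow> real) \<Rightarrow> real)) set \<Rightarrow>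
   ('m::topological_space, 'e::finite_dim_normed) chart set \<Rightarrow> ('m, 'e) chart \<Rightarrow> ('m \<Rightarrow> 'e) \<Rightarrow>
   'm \<Rightarrow> bool" where
  "flow_by_quadratures D A a X m \<longleftrightarrow>
    (let d = model_dim TYPE('e) in
     \<exists>V \<epsilon> \<Phi>. open V \<and> m \<in> V \<and> V \<subseteq> fst a \<and> 0 < \<epsilon> \<and>
       (\<forall>p\<in>V. \<Phi> p 0 = p \<and> integral_curve A X {-\<epsilon><..<\<epsilon>} (\<Phi> p) \<and>
          (\<forall>t\<in>{-\<epsilon><..<\<epsilon>}. \<Phi> p t \<in> fst a)) \<and>
       (\<forall>i<d. quadratures D (Suc d) {(coords a p)(d := t) | p t. p \<in> V \<and> t \<in> {-\<epsilon><..<\<epsilon>}}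
                (\<lambda>z. coords a (\<Phi> (coords_inv a (z(d := 0))) (z d)) i)))"

text \<open>Since a complete solution \<open>\<Sigma>\<close> is surjective, the points \<open>\<Sigma> (x, l)\<close> are all points of \<open>M\<close>.\<close>

definition integrable_by_quadratures ::
  "('m::topological_space, 'e::finite_dim_normed) chart set \<Rightarrow>
   ('n, 'f::finite_dim_normed) chart set \<Rightarrow> ('l, 'g::finite_dim_normed) chart set \<Rightarrow> ('m \<Rightarrow> 'e) \<Rightarrow>
   ('m \<Rightarrow> 'e \<Rightarrow> real) \<Rightarrow> ('m \<Rightarrow> 'n) \<Rightarrow> ('n \<times> 'l \<Rightarrow> 'm) \<Rightarrow> bool" where
  "integrable_by_quadratures A B C X \<eta> \<pi> \<Sigma> \<longleftrightarrow>
     (\<forall>x l. \<forall>a\<in>A. \<forall>b\<in>B. \<forall>c\<in>C. \<Sigma> (x, l) \<in> fst a \<longrightarrow> x \<in> fst b \<longrightarrow> l \<in> fst c \<longrightarrow>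
        flow_by_quadratures (known_data A a b c X \<eta> \<pi> \<Sigma>) A a X (\<Sigma> (x, l)))"

end

theory Submission
  imports Defs
begin

text \<open>
  A complete solution \<open>\<Sigma>\<close> provides local coordinates \<open>(x, \<lambda>)\<close> of \<open>M\<close>. By the Hamilton-Jacobi equation the
  field \<open>X\<close> is tangent to the images of the sections, so that \<open>\<lambda>\<close> is constant along integral curves;
  these images are called fibres here. Let \<open>\<theta>\<close> be the pullback of the contact form \<open>\<eta>\<close>. By
  pseudo-isotropy the restriction of \<open>\<theta>\<close> to each fibre is closed, hence has a local primitive \<open>W (x, \<lambda>)\<close>,
  found by one quadrature with \<open>\<lambda>\<close> as a parameter. The difference of \<open>\<theta>\<close> and the differential of \<open>W\<close> has
  no components along the fibres, that is, it is \<open>\<Sum>j. c\<^sub>j d\<lambda>\<^sub>j\<close>, and so the exterior derivative of \<open>\<theta>\<close>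
  is \<open>\<Sum>j. dc\<^sub>j \<and> d\<lambda>\<^sub>j\<close>.

  The assumption \<open>\<xi> H = 0\<close> reduces the equations of the contact field to \<open>i\<^sub>X d\<eta> = - dH\<close> and \<open>\<eta> X = H\<close>. The
  first of them shows that \<open>H\<close> depends on \<open>\<lambda>\<close> only and that \<open>X c\<^sub>j = - \<partial>H/\<partial>\<lambda>\<^sub>j\<close>; the second one shows that
  \<open>X W = H\<close>. So along every integral curve \<open>\<lambda>\<close> is constant while the \<open>c\<^sub>j\<close> and \<open>W\<close> grow linearly with known
  rates. The map \<open>(\<lambda>, c, W)\<close> is an immersion: a vector killed by its derivative is killed by \<open>d\<eta>\<close> and by
  \<open>\<eta>\<close>, hence is zero. A suitable linear projection of this immersion is a local diffeomorphism \<open>G\<close> in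
  which the flow is \<open>G z + t \<kappa> (\<lambda>)\<close>. Inverting \<open>G\<close> gives the integral curves, whose existence thus needs
  no theorem about differential equations.

  The lemmas that carry this argument are \<open>contact_equation\<close> (the reduced contact equation),
  \<open>contact_form_nondegenerate\<close>, \<open>W_derivative\<close> and \<open>c_derivative\<close> (the primitive and its remainder),
  \<open>C_flow\<close>, \<open>W_flow\<close>, \<open>immersion\<close> and \<open>local_flow\<close>. The last one is about a Euclidean space; \<open>flow\<close>
  transports it to the given charts.
\<close>

section \<open>Calculus of finitely often differentiable maps\<close>

abbreviation fderiv :: "('a::real_normed_vector \<Rightarrow> 'b::real_normed_vector) \<Rightarrow> 'a \<Rightarrow> 'a \<Rightarrow> 'b" where
  "fderiv f x \<equiv> frechet_derivative f (at x)"

lemma Ck_on_subset: "Ck_on k S f \<Longrightarrow> T \<subseteq> S \<Longrightarrow> Ck_on k T f"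
proof (induction k arbitrary: f)
  case 0
  then show ?case by (simp add: continuous_on_subset)
next
  case (Suc k)
  then show ?case by (simp, meson subsetD)
qed

lemma Ck_on_cong:
  assumes "open S" "Ck_on k S f" "\<And>x. x \<in> S \<Longrightarrow> f x = g x"
  shows "Ck_on k S g"
proof (cases k)
  case 0
  then show ?thesis using assms by (simp cong: continuous_on_cong_simp)
next
  case (Suc j)
  then show ?thesis
    using assms by (simp, meson has_derivative_transform_within_open)
qed

lemma Ck_on_continuous: "Ck_on k S f \<Longrightarrow> continuous_on S f"
  by (cases k) (auto intro: has_derivative_continuous continuous_at_imp_continuous_on)

lemma Ck_on_Suc_D: "Ck_on (Suc k) S f \<Longrightarrow> Ck_on k S f"
proof (induction k arbitrary: f)
  case 0
  then show ?case using Ck_on_continuous by (metis Ck_on.simps(1))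
next
  case (Suc k)
  then show ?case by (metis Ck_on.simps(2))
qed

lemma Ck_on_mono: "Ck_on k S f \<Longrightarrow> j \<le> k \<Longrightarrow> Ck_on j S f"
  by (induction k) (auto simp: le_Suc_eq simp del: Ck_on.simps dest: Ck_on_Suc_D)

text \<open>For an open set the witness in the recursive clause of \<^const>\<open>Ck_on\<close> can only be the Frechet
derivative; knowing it makes the property local and allows the derivative to be named.\<close>

lemma Ck_on_Suc_frechet:
  assumes "open S"
  shows "Ck_on (Suc k) S f \<longleftrightarrow>
    (\<forall>x\<in>S. f differentiable (at x)) \<and> (\<forall>v. Ck_on k S (\<lambda>x. fderiv f x v))"
  (is "?L \<longleftrightarrow> ?R")
proof
  assume ?L
  then obtain f' where f': "\<And>x. x \<in> S \<Longrightarrow> (f has_derivative f' x) (at x)"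
    "\<And>v. Ck_on k S (\<lambda>x. f' x v)" by auto
  have "f' x v = fderiv f x v" if "x \<in> S" for x v
    using frechet_derivative_at[OF f'(1)[OF that]] by simp
  then show ?R
    using f' Ck_on_cong[OF assms f'(2)] by (auto simp: differentiable_def)
next
  assume ?R
  then show ?L by (auto simp: frechet_derivative_works)
qed

lemma Ck_on_Suc_E:
  assumes "Ck_on (Suc k) S f"
  obtains f' where "\<And>x. x \<in> S \<Longrightarrow> (f has_derivative f' x) (at x)" "\<And>v. Ck_on k S (\<lambda>x. f' x v)"
  using assms by auto

lemma Ck_on_differentiable:
  assumes "Ck_on (Suc k) S f" "x \<in> S"
  shows "(f has_derivative fderiv f x) (at x)"
  using assms frechet_derivative_works differentiable_def by (simp, blast)

lemma Ck_on_local: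
  assumes "open S" "\<And>x. x \<in> S \<Longrightarrow> \<exists>T. open T \<and> x \<in> T \<and> Ck_on k (T \<inter> S) f"
  shows "Ck_on k S f"
  using assms(2)
proof (induction k arbitrary: f)
  case 0
  have "continuous (at x) f" if x: "x \<in> S" for x
  proof -
    obtain T where "open T" "x \<in> T" "continuous_on (T \<inter> S) f" using 0[OF x] by auto
    then show ?thesis
      using assms(1) x continuous_on_eq_continuous_at open_Int by blast
  qed
  then show ?case by (simp add: continuous_at_imp_continuous_on)
next
  case (Suc k)
  have T: "\<exists>T. open T \<and> x \<in> T \<and> f differentiable (at x) \<and> (\<forall>v. Ck_on k (T \<inter> S) (\<lambda>x. fderiv f x v))"
    if x: "x \<in> S" for x
  proof -
    obtain T where "open T" "x \<in> T" "Ck_on (Suc k) (T \<inter> S) f" using Suc.prems[OF x] by auto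
    then show ?thesis
      using Ck_on_Suc_frechet[of "T \<inter> S" k f] assms(1) x open_Int[of T S] by blast
  qed
  show ?case
    unfolding Ck_on_Suc_frechet[OF assms(1)]
  proof (intro conjI ballI allI)
    show "f differentiable (at x)" if "x \<in> S" for x using T[OF that] by blast
    show "Ck_on k S (\<lambda>x. fderiv f x v)" for v
      by (rule Suc.IH) (use T in blast)
  qed
qed

lemma Ck_on_const: "Ck_on k S (\<lambda>x. c)"
proof (induction k arbitrary: c)
  case (Suc k)
  then show ?case by (auto intro!: exI[of _ "\<lambda>x v. 0"] derivative_eq_intros)
qed simp

lemma Ck_on_linear:
  assumes "bounded_linear L"
  shows "Ck_on k S L"
proof (cases k)
  case 0
  then show ?thesis using assms linear_continuous_on by auto
next
  case (Suc k)
  then show ?thesis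
    using assms by (auto intro!: exI[of _ "\<lambda>x. L"] bounded_linear_imp_has_derivative Ck_on_const)
qed

lemma Ck_on_add: "Ck_on k S f \<Longrightarrow> Ck_on k S g \<Longrightarrow> Ck_on k S (\<lambda>x. f x + g x)"
proof (induction k arbitrary: f g)
  case 0
  then show ?case by (simp add: continuous_on_add)
next
  case (Suc k)
  obtain f' where
    f': "\<And>x. x \<in> S \<Longrightarrow> (f has_derivative f' x) (at x)" "\<And>v. Ck_on k S (\<lambda>x. f' x v)"
    using Ck_on_Suc_E[OF Suc.prems(1)] by blast
  obtain g' where
    g': "\<And>x. x \<in> S \<Longrightarrow> (g has_derivative g' x) (at x)" "\<And>v. Ck_on k S (\<lambda>x. g' x v)"
    using Ck_on_Suc_E[OF Suc.prems(2)] by blast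
  show ?case
    using f' g' Suc.IH by (auto intro!: exI[of _ "\<lambda>x v. f' x v + g' x v"] has_derivative_add)
qed

lemma Ck_on_sum: "(\<And>i. i \<in> I \<Longrightarrow> Ck_on k S (f i)) \<Longrightarrow> Ck_on k S (\<lambda>x. \<Sum>i\<in>I. f i x)"
  by (induction I rule: infinite_finite_induct) (auto intro: Ck_on_const Ck_on_add)

lemma Ck_on_bilinear:
  assumes "bounded_bilinear pr"
  shows "Ck_on k S f \<Longrightarrow> Ck_on k S g \<Longrightarrow> Ck_on k S (\<lambda>x. pr (f x) (g x))"
proof (induction k arbitrary: f g)
  case 0
  then show ?case using bounded_bilinear.continuous_on[OF assms] by auto
next
  case (Suc k)
  obtain f' where
    f': "\<And>x. x \<in> S \<Longrightarrow> (f has_derivative f' x) (at x)" "\<And>v. Ck_on k S (\<lambda>x. f' x v)"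
    using Ck_on_Suc_E[OF Suc.prems(1)] by blast
  obtain g' where
    g': "\<And>x. x \<in> S \<Longrightarrow> (g has_derivative g' x) (at x)" "\<And>v. Ck_on k S (\<lambda>x. g' x v)"
    using Ck_on_Suc_E[OF Suc.prems(2)] by blast
  have fg: "Ck_on k S f" "Ck_on k S g"
    using Suc.prems Ck_on_Suc_D by blast+
  show ?case
    using f' g' fg Suc.IH
    by (auto intro!: exI[of _ "\<lambda>x v. pr (f x) (g' x v) + pr (f' x v) (g x)"]
        bounded_bilinear.FDERIV[OF assms] Ck_on_add)
qed

lemmas Ck_on_mult = Ck_on_bilinear[OF bounded_bilinear_mult]
lemmas Ck_on_scaleR = Ck_on_bilinear[OF bounded_bilinear_scaleR]
lemma Ck_on_linear_left:
  assumes "bounded_linear L"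
  shows "Ck_on k S f \<Longrightarrow> Ck_on k S (\<lambda>x. L (f x))"
proof (induction k arbitrary: f)
  case 0
  then show ?case using bounded_linear.continuous_on[OF assms] by auto
next
  case (Suc k)
  obtain f' where
    f': "\<And>x. x \<in> S \<Longrightarrow> (f has_derivative f' x) (at x)" "\<And>v. Ck_on k S (\<lambda>x. f' x v)"
    using Ck_on_Suc_E[OF Suc.prems(1)] by blast
  show ?case
    using f' Suc.IH
    by (auto intro!: exI[of _ "\<lambda>x v. L (f' x v)"] bounded_linear.has_derivative[OF assms])
qed

lemma Ck_on_diff: "Ck_on k S f \<Longrightarrow> Ck_on k S g \<Longrightarrow> Ck_on k S (\<lambda>x. f x - g x)"
  using Ck_on_add[OF _ Ck_on_linear_left[OF bounded_linear_minus[OF bounded_linear_ident]], of k S f g]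
  by simp

lemma Ck_on_linear_right:
  assumes "bounded_linear L"
  shows "Ck_on k S f \<Longrightarrow> L ` T \<subseteq> S \<Longrightarrow> Ck_on k T (\<lambda>x. f (L x))"
proof (induction k arbitrary: f)
  case 0
  then show ?case
    using continuous_on_compose2[OF _ linear_continuous_on[OF assms]] by auto
next
  case (Suc k)
  obtain f' where
    f': "\<And>x. x \<in> S \<Longrightarrow> (f has_derivative f' x) (at x)" "\<And>v. Ck_on k S (\<lambda>x. f' x v)"
    using Ck_on_Suc_E[OF Suc.prems(1)] by blast
  have "((\<lambda>x. f (L x)) has_derivative (\<lambda>v. f' (L x) (L v))) (at x)" if "x \<in> T" for x
    using has_derivative_compose[OF bounded_linear_imp_has_derivative[OF assms], of f "f' (L x)"]
      f'(1) that Suc.prems by auto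
  then show ?case
    using f' Suc.IH Suc.prems by (auto intro!: exI[of _ "\<lambda>x v. f' (L x) (L v)"])
qed

text \<open>The chain rule puts a point-dependent vector into the derivative of the outer map. Expanding
that vector in the basis reduces the claim to directional derivatives in fixed directions, for
which the induction hypothesis holds.\<close>

lemma Ck_on_compose:
  fixes f :: "'a::real_normed_vector \<Rightarrow> 'b::euclidean_space"
  shows "Ck_on k S f \<Longrightarrow> Ck_on k T g \<Longrightarrow> f ` S \<subseteq> T \<Longrightarrow> Ck_on k S (\<lambda>x. g (f x))"
proof (induction k arbitrary: g)
  case 0
  then show ?case using continuous_on_compose2 by auto
next
  case (Suc k)
  obtain f' where
    f': "\<And>x. x \<in> S \<Longrightarrow> (f has_derivative f' x) (at x)" "\<And>v. Ck_on k S (\<lambda>x. f' x v)"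
    using Ck_on_Suc_E[OF Suc.prems(1)] by blast
  obtain g' where
    g': "\<And>x. x \<in> T \<Longrightarrow> (g has_derivative g' x) (at x)" "\<And>v. Ck_on k T (\<lambda>x. g' x v)"
    using Ck_on_Suc_E[OF Suc.prems(2)] by blast
  have f: "Ck_on k S f"
    using Suc.prems Ck_on_Suc_D by blast
  define D where "D x v = (\<Sum>i\<in>Basis. (f' x v \<bullet> i) *\<^sub>R g' (f x) i)" for x v
  have D: "D x v = g' (f x) (f' x v)" if "x \<in> S" for x v
  proof -
    interpret bounded_linear "g' (f x)"
      using that Suc.prems g'(1) has_derivative_bounded_linear by blast
    have "g' (f x) (f' x v) = g' (f x) (\<Sum>i\<in>Basis. (f' x v \<bullet> i) *\<^sub>R i)"
      by (simp add: euclidean_representation)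
    then show ?thesis
      by (simp add: D_def sum scaleR)
  qed
  have "((\<lambda>x. g (f x)) has_derivative D x) (at x)" if "x \<in> S" for x
  proof -
    have "(g has_derivative g' (f x)) (at (f x))" using g'(1) that Suc.prems by auto
    from has_derivative_compose[OF f'(1)[OF that] this] show ?thesis
      using D[OF that] by presburger
  qed
  moreover have "Ck_on k S (\<lambda>x. D x v)" for v
    unfolding D_def
    by (intro Ck_on_sum Ck_on_scaleR Suc.IH f g'(2) Ck_on_linear_left[OF bounded_linear_inner_left] f'(2)
        Suc.prems)
  ultimately show ?case by auto
qed

text \<open>Second derivatives commute because both are limits of the same second difference quotient, which
the mean value theorem, applied once in each variable, turns into a value of a mixed derivative.\<close>

lemma second_difference_mvt:
  fixes g gs :: "real \<Rightarrow> real \<Rightarrow> real"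
  assumes h: "0 < h"
    and gs: "\<And>s t. \<lbrakk>0 \<le> s; s \<le> h; 0 \<le> t; t \<le> h\<rbrakk> \<Longrightarrow> ((\<lambda>s. g s t) has_real_derivative gs s t) (at s)"
    and gst: "\<And>s t. \<lbrakk>0 \<le> s; s \<le> h; 0 \<le> t; t \<le> h\<rbrakk> \<Longrightarrow> ((\<lambda>t. gs s t) has_real_derivative gst s t) (at t)"
  shows "\<exists>s t. 0 \<le> s \<and> s \<le> h \<and> 0 \<le> t \<and> t \<le> h \<and>
    g h h - g h 0 - g 0 h + g 0 0 = h * h * gst s t"
proof -
  have "\<exists>s>0. s < h \<and> (g h h - g h 0) - (g 0 h - g 0 0) = (h - 0) * (gs s h - gs s 0)"
    by (rule MVT2[of 0 h "\<lambda>s. g s h - g s 0" "\<lambda>s. gs s h - gs s 0"])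
      (use h gs in \<open>auto intro!: DERIV_diff\<close>)
  then obtain s where s: "0 < s" "s < h" "(g h h - g h 0) - (g 0 h - g 0 0) = h * (gs s h - gs s 0)"
    by auto
  have "\<exists>t>0. t < h \<and> gs s h - gs s 0 = (h - 0) * gst s t"
    by (rule MVT2[of 0 h "gs s" "gst s"]) (use h s gst in auto)
  then obtain t where t: "0 < t" "t < h" "gs s h - gs s 0 = h * gst s t"
    by auto
  show ?thesis
    by (rule exI[of _ s], rule exI[of _ t]) (use s t in auto)
qed

lemma second_derivative_symmetric:
  fixes f :: "'a::real_normed_vector \<Rightarrow> real"
  assumes S: "open S" and x: "x \<in> S"
    and f': "\<And>y. y \<in> S \<Longrightarrow> (f has_derivative f' y) (at y)"
    and fu: "\<And>y. y \<in> S \<Longrightarrow> ((\<lambda>y. f' y u) has_derivative fu y) (at y)"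
    and fv: "\<And>y. y \<in> S \<Longrightarrow> ((\<lambda>y. f' y v) has_derivative fv y) (at y)"
    and cont: "continuous_on S (\<lambda>y. fu y v)" "continuous_on S (\<lambda>y. fv y u)"
  shows "fu x v = fv x u"
proof -
  obtain r where r: "0 < r" "ball x r \<subseteq> S"
    using S x open_contains_ball by blast
  define M where "M = norm u + norm v + 1"
  have M: "M > 0" by (simp add: M_def add_pos_nonneg add_nonneg_pos)
  have near: "dist x (x + s *\<^sub>R u + t *\<^sub>R v) \<le> h * M"
    if "0 \<le> s" "s \<le> h" "0 \<le> t" "t \<le> h" for s t h
  proof -
    have "dist x (x + s *\<^sub>R u + t *\<^sub>R v) = norm (s *\<^sub>R u + t *\<^sub>R v)"
      by (subst dist_commute) (simp add: dist_norm add.assoc)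
    also have "\<dots> \<le> s * norm u + t * norm v"
      using norm_triangle_ineq[of "s *\<^sub>R u" "t *\<^sub>R v"] that by simp
    also have "\<dots> \<le> h * norm u + h * norm v"
      using that by (intro add_mono mult_right_mono) auto
    also have "\<dots> \<le> h * M"
      using that by (simp add: M_def algebra_simps)
    finally show ?thesis .
  qed
  \<comment> \<open>Evaluating the second difference in both orders gives points near \<open>x\<close> where the mixed
    derivatives agree.\<close>
  have agree: "\<exists>y z. dist x y \<le> e \<and> dist x z \<le> e \<and> fu y v = fv z u" if e: "0 < e" "e < r" for e
  proof -
    define h where "h = e / M"
    have h: "0 < h" "h * M < r" "h * M = e" using e M by (auto simp: h_def)
    have inS: "x + s *\<^sub>R u + t *\<^sub>R v \<in> S" if "0 \<le> s" "s \<le> h" "0 \<le> t" "t \<le> h" for s t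
      using near[OF that] h r by (auto simp: subset_iff)
    have inS': "x + t *\<^sub>R v + s *\<^sub>R u \<in> S" if "0 \<le> s" "s \<le> h" "0 \<le> t" "t \<le> h" for s t
      using inS[OF that] by (simp add: algebra_simps)
    have du: "((\<lambda>s. F (y + s *\<^sub>R w)) has_real_derivative F' (y + s *\<^sub>R w) w) (at s)"
      if "(F has_derivative F' (y + s *\<^sub>R w)) (at (y + s *\<^sub>R w))" for F F' y w s
    proof -
      have "((\<lambda>s. y + s *\<^sub>R w) has_derivative (\<lambda>s. s *\<^sub>R w)) (at s)"
        by (auto intro!: derivative_eq_intros)
      from has_derivative_compose[OF this that]
      have "((\<lambda>s. F (y + s *\<^sub>R w)) has_derivative (\<lambda>k. F' (y + s *\<^sub>R w) (k *\<^sub>R w))) (at s)" .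
      moreover have "F' (y + s *\<^sub>R w) (k *\<^sub>R w) = F' (y + s *\<^sub>R w) w * k" for k
        using has_derivative_bounded_linear[OF that] bounded_linear.linear linear_simps(5)
        by (metis mult.commute real_scaleR_def)
      ultimately show ?thesis by (simp add: has_field_derivative_def)
    qed
    have "\<exists>s t. 0 \<le> s \<and> s \<le> h \<and> 0 \<le> t \<and> t \<le> h \<and>
      f (x + h *\<^sub>R u + h *\<^sub>R v) - f (x + h *\<^sub>R u + 0 *\<^sub>R v) - f (x + 0 *\<^sub>R u + h *\<^sub>R v) + f (x + 0 *\<^sub>R u + 0 *\<^sub>R v)
      = h * h * fu (x + s *\<^sub>R u + t *\<^sub>R v) v"
    proof (rule second_difference_mvt[where gs = "\<lambda>s t. f' (x + s *\<^sub>R u + t *\<^sub>R v) u"])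
      fix s t assume st: "0 \<le> s" "s \<le> h" "0 \<le> t" "t \<le> h"
      show "((\<lambda>s. f (x + s *\<^sub>R u + t *\<^sub>R v)) has_real_derivative f' (x + s *\<^sub>R u + t *\<^sub>R v) u) (at s)"
        using du[of f f' "x + t *\<^sub>R v" s u] f'[OF inS'[OF st]] by (simp add: algebra_simps)
      show "((\<lambda>t. f' (x + s *\<^sub>R u + t *\<^sub>R v) u) has_real_derivative fu (x + s *\<^sub>R u + t *\<^sub>R v) v) (at t)"
        using du[of "\<lambda>y. f' y u" fu "x + s *\<^sub>R u" t v] fu[OF inS[OF st]] by simp
    qed (use h in auto)
    then obtain s t where st: "0 \<le> s" "s \<le> h" "0 \<le> t" "t \<le> h" and
      A: "f (x + h *\<^sub>R u + h *\<^sub>R v) - f (x + h *\<^sub>R u) - f (x + h *\<^sub>R v) + f x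
      = h * h * fu (x + s *\<^sub>R u + t *\<^sub>R v) v" by auto
    have "\<exists>s t. 0 \<le> s \<and> s \<le> h \<and> 0 \<le> t \<and> t \<le> h \<and>
      f (x + h *\<^sub>R v + h *\<^sub>R u) - f (x + h *\<^sub>R v + 0 *\<^sub>R u) - f (x + 0 *\<^sub>R v + h *\<^sub>R u) + f (x + 0 *\<^sub>R v + 0 *\<^sub>R u)
      = h * h * fv (x + s *\<^sub>R v + t *\<^sub>R u) u"
    proof (rule second_difference_mvt[where gs = "\<lambda>s t. f' (x + s *\<^sub>R v + t *\<^sub>R u) v"])
      fix s t assume st: "0 \<le> s" "s \<le> h" "0 \<le> t" "t \<le> h"
      show "((\<lambda>s. f (x + s *\<^sub>R v + t *\<^sub>R u)) has_real_derivative f' (x + s *\<^sub>R v + t *\<^sub>R u) v) (at s)"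
        using du[of f f' "x + t *\<^sub>R u" s v] f'[OF inS[OF st(3,4,1,2)]] by (simp add: algebra_simps)
      show "((\<lambda>t. f' (x + s *\<^sub>R v + t *\<^sub>R u) v) has_real_derivative fv (x + s *\<^sub>R v + t *\<^sub>R u) u) (at t)"
        using du[of "\<lambda>y. f' y v" fv "x + s *\<^sub>R v" t u] fv[OF inS'[OF st(3,4,1,2)]] by simp
    qed (use h in auto)
    then obtain s' t' where st': "0 \<le> s'" "s' \<le> h" "0 \<le> t'" "t' \<le> h" and
      B: "f (x + h *\<^sub>R v + h *\<^sub>R u) - f (x + h *\<^sub>R v) - f (x + h *\<^sub>R u) + f x
      = h * h * fv (x + s' *\<^sub>R v + t' *\<^sub>R u) u" by auto
    have "h * h * fu (x + s *\<^sub>R u + t *\<^sub>R v) v = h * h * fv (x + t' *\<^sub>R u + s' *\<^sub>R v) u"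
      using A B by (simp add: algebra_simps)
    then have "fu (x + s *\<^sub>R u + t *\<^sub>R v) v = fv (x + t' *\<^sub>R u + s' *\<^sub>R v) u"
      using h by simp
    then show ?thesis
      using near[OF st] near[OF st'(3,4,1,2)] h by auto
  qed
  have "\<bar>fu x v - fv x u\<bar> \<le> 0 + e" if "e > 0" for e
  proof -
    have "\<exists>d>0. \<forall>y\<in>S. dist y x < d \<longrightarrow> dist (fu y v) (fu x v) < e/2"
      using cont(1) x that unfolding continuous_on_iff by (meson half_gt_zero)
    then obtain d1 where d1: "d1 > 0" "\<And>y. y \<in> S \<Longrightarrow> dist y x < d1 \<Longrightarrow> dist (fu y v) (fu x v) < e/2"
      by auto
    have "\<exists>d>0. \<forall>y\<in>S. dist y x < d \<longrightarrow> dist (fv y u) (fv x u) < e/2"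
      using cont(2) x that unfolding continuous_on_iff by (meson half_gt_zero)
    then obtain d2 where d2: "d2 > 0" "\<And>y. y \<in> S \<Longrightarrow> dist y x < d2 \<Longrightarrow> dist (fv y u) (fv x u) < e/2"
      by auto
    define d where "d = min r (min d1 d2) / 2"
    have d: "0 < d" "d < r" "d < d1" "d < d2" using r d1 d2 by (auto simp: d_def)
    from agree[OF d(1,2)] obtain y z where yz: "dist x y \<le> d" "dist x z \<le> d" "fu y v = fv z u"
      by auto
    have "y \<in> S" "z \<in> S" using yz d r by (auto simp: subset_iff)
    then have "dist (fu y v) (fu x v) < e/2" "dist (fv z u) (fv x u) < e/2"
      using d1(2)[of y] d2(2)[of z] yz(1,2) d dist_commute[of x] by auto
    then show ?thesis using yz(3) unfolding dist_real_def by linarith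
  qed
  then have "\<bar>fu x v - fv x u\<bar> \<le> 0"
    using field_le_epsilon by blast
  then show ?thesis by simp
qed

lemma Ck2_symmetric:
  fixes f :: "'a::real_normed_vector \<Rightarrow> real"
  assumes "open S" "x \<in> S" "Ck_on 2 S f"
  shows "fderiv (\<lambda>y. fderiv f y u) x v =
    fderiv (\<lambda>y. fderiv f y v) x u"
proof -
  have f: "Ck_on (Suc (Suc 0)) S f" using assms(3) by (simp only: numeral_2_eq_2)
  then have f1: "Ck_on (Suc 0) S (\<lambda>y. fderiv f y w)" for w
    using Ck_on_Suc_frechet[OF assms(1)] by blast
  then have f2: "continuous_on S (\<lambda>x. fderiv (\<lambda>y. fderiv f y w) x w')" for w w'
    using Ck_on_Suc_frechet[OF assms(1), of 0 "\<lambda>y. fderiv f y w"]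
    by (simp del: Ck_on.simps(2))
  show ?thesis
    by (rule second_derivative_symmetric[OF assms(1,2)])
      (use f f1 f2 Ck_on_differentiable in blast)+
qed

text \<open>The open interval \<open>I\<close> around the interval of integration makes differentiability of the integrand
in all its variables meaningful at the end points.\<close>

lemma Ck_on_integral:
  fixes g :: "'v::euclidean_space \<times> real \<Rightarrow> 'w::euclidean_space"
  assumes U: "open U" "convex U" and I: "{0..1} \<subseteq> I" "open I"
  shows "Ck_on k (U \<times> I) g \<Longrightarrow> Ck_on k U (\<lambda>z. integral {0..1} (\<lambda>s. g (z, s)))"
    and "Ck_on (Suc k) (U \<times> I) g \<Longrightarrow> z \<in> U \<Longrightarrow>
      fderiv (\<lambda>z. integral {0..1} (\<lambda>s. g (z, s))) z =
        (\<lambda>u. integral {0..1} (\<lambda>s. fderiv g (z, s) (u, 0)))"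
proof -
  have *: "((\<lambda>z. integral {0..1} (\<lambda>s. g (z, s))) has_derivative
      (\<lambda>u. integral {0..1} (\<lambda>s. fderiv g (z, s) (u, 0)))) (at z)"
    if g: "Ck_on (Suc k) (U \<times> I) g" and z: "z \<in> U" for z k and g :: "'v \<times> real \<Rightarrow> 'w"
  proof -
    define G where "G z s = Blinfun (\<lambda>u. fderiv g (z, s) (u, 0))" for z s
    have op: "open (U \<times> I)" using U I by (simp add: open_Times)
    have bl: "bounded_linear (\<lambda>u. fderiv g (z, s) (u, 0))" if "z \<in> U" "s \<in> I" for z s
    proof -
      have "bounded_linear (fderiv g (z, s))"
        using Ck_on_differentiable[OF g, of "(z,s)"] that has_derivative_bounded_linear by blast
      from bounded_linear_compose[OF this bounded_linear_Pair[OF bounded_linear_ident bounded_linear_zero]]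
      show ?thesis .
    qed
    have app: "blinfun_apply (G z s) u = fderiv g (z, s) (u, 0)" if "z \<in> U" "s \<in> I" for z s u
      using bounded_linear_Blinfun_apply[OF bl[OF that]] by (simp add: G_def)
    have contD: "continuous_on (U \<times> I) (\<lambda>y. fderiv g y v)" for v
      using g Ck_on_Suc_frechet[OF op] Ck_on_continuous by blast
    have contg: "continuous_on (U \<times> I) g" using g Ck_on_continuous by blast
    have sub: "U \<times> {0..1} \<subseteq> U \<times> I" using I by auto
    have contG: "continuous_on (U \<times> {0..1}) (\<lambda>(z, s). G z s)"
    proof (rule continuous_on_blinfun_componentwise)
      fix i :: 'v
      show "continuous_on (U \<times> {0..1}) (\<lambda>x. blinfun_apply (case x of (z, s) \<Rightarrow> G z s) i)"
        by (rule continuous_on_eq[OF continuous_on_subset[OF contD[of "(i, 0)"] sub]])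
          (use I(1) in \<open>auto simp: app subset_iff\<close>)
    qed
    have "((\<lambda>z. integral (cbox 0 1) (\<lambda>s. g (z, s))) has_derivative integral (cbox 0 1) (G z)) (at z within U)"
    proof (rule leibniz_rule)
      fix z s assume zs: "z \<in> U" "s \<in> cbox 0 (1::real)"
      then have s: "s \<in> I" using I by auto
      have "(g has_derivative fderiv g (z, s)) (at (z, s))"
        using Ck_on_differentiable[OF g] zs s by auto
      moreover have "((\<lambda>z. (z, s)) has_derivative (\<lambda>u. (u, 0))) (at z within U)"
        by (auto intro!: derivative_eq_intros)
      ultimately have "((\<lambda>z. g (z, s)) has_derivative (\<lambda>u. fderiv g (z, s) (u, 0))) (at z within U)"
        using has_derivative_compose by blast
      then show "((\<lambda>z. g (z, s)) has_derivative blinfun_apply (G z s)) (at z within U)"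
        using app[OF zs(1) s] by presburger
    next
      fix z assume "z \<in> U"
      then have "continuous_on (cbox 0 1) (\<lambda>s. g (z, s))"
        using I by (intro continuous_on_compose2[OF contg] continuous_intros) auto
      then show "(\<lambda>s. g (z, s)) integrable_on cbox 0 1" by (rule integrable_continuous)
    qed (use U z contG in auto)
    moreover have "blinfun_apply (integral (cbox 0 1) (G z)) u =
      integral {0..1} (\<lambda>s. fderiv g (z, s) (u, 0))" for u
    proof -
      have "continuous_on (cbox 0 1) (\<lambda>s. G z s)"
        using continuous_on_compose2[OF contG continuous_on_Pair[OF continuous_on_const[of _ z] continuous_on_id]]
          z by auto
      then have "G z integrable_on cbox 0 1" by (rule integrable_continuous)
      from integral_linear[OF this blinfun.bounded_linear_left[of u]]
      have "blinfun_apply (integral (cbox 0 1) (G z)) u = integral (cbox 0 1) (\<lambda>s. blinfun_apply (G z s) u)"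
        by (simp add: o_def)
      also have "\<dots> = integral {0..1} (\<lambda>s. fderiv g (z, s) (u, 0))"
        unfolding cbox_interval by (rule integral_cong) (use app z I in auto)
      finally show ?thesis .
    qed
    ultimately show ?thesis
      using z U at_within_open by (metis (no_types, lifting) ext cbox_interval)
  qed
  show "Ck_on (Suc k) (U \<times> I) g \<Longrightarrow> z \<in> U \<Longrightarrow>
      fderiv (\<lambda>z. integral {0..1} (\<lambda>s. g (z, s))) z =
        (\<lambda>u. integral {0..1} (\<lambda>s. fderiv g (z, s) (u, 0)))"
    using frechet_derivative_at[OF *] by metis
  show "Ck_on k (U \<times> I) g \<Longrightarrow> Ck_on k U (\<lambda>z. integral {0..1} (\<lambda>s. g (z, s)))"
  proof (induction k arbitrary: g)
    case 0
    then have "continuous_on (U \<times> cbox 0 1) (\<lambda>(z, s). g (z, s))"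
      using I by (auto intro: continuous_on_subset)
    from integral_continuous_on_param[OF this] show ?case by simp
  next
    case (Suc k)
    have "Ck_on k (U \<times> I) (\<lambda>x. fderiv g x (u, 0))" for u
      using Suc.prems Ck_on_Suc_frechet U I open_Times by blast
    then show ?case
      using *[OF Suc.prems] Suc.IH
      by (auto intro!: exI[of _ "\<lambda>z u. integral {0..1} (\<lambda>s. fderiv g (z, s) (u, 0))"])
  qed
qed

section \<open>Nondegeneracy of contact forms\<close>

text \<open>A form in the sense of \<^const>\<open>wedge\<close> is a function of an infinite sequence of vectors. The three
properties below pass from factors to wedge products because a permutation of the entries moves
each entry into exactly one factor.\<close>

definition slot_linear :: "nat \<Rightarrow> ((nat \<Rightarrow> 'e::real_vector) \<Rightarrow> real) \<Rightarrow> bool" where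
  "slot_linear k \<alpha> \<longleftrightarrow> (\<forall>v. \<forall>j<k. linear (\<lambda>x. \<alpha> (v(j := x))))"

definition slot_bounded :: "nat \<Rightarrow> ((nat \<Rightarrow> 'e) \<Rightarrow> real) \<Rightarrow> bool" where
  "slot_bounded k \<alpha> \<longleftrightarrow> (\<forall>v. \<forall>j\<ge>k. \<forall>x. \<alpha> (v(j := x)) = \<alpha> v)"

definition annihilates :: "nat \<Rightarrow> 'e \<Rightarrow> ((nat \<Rightarrow> 'e) \<Rightarrow> real) \<Rightarrow> bool" where
  "annihilates k u \<alpha> \<longleftrightarrow> (\<forall>v. \<forall>j<k. v j = u \<longrightarrow> \<alpha> v = 0)"

lemma linear_real_sum:
  "(\<And>i. i \<in> I \<Longrightarrow> linear (f i)) \<Longrightarrow> linear (\<lambda>x. \<Sum>i\<in>I. f i x :: real)"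
  by (rule linear_compose_sum) auto

lemma wedge_slot_bounded:
  assumes "slot_bounded k \<alpha>" "slot_bounded l \<beta>"
  shows "slot_bounded (k + l) (wedge k l \<alpha> \<beta>)"
  unfolding slot_bounded_def
proof (intro allI impI)
  fix v :: "nat \<Rightarrow> 'a" and j x assume j: "k + l \<le> j"
  have "\<alpha> (\<lambda>i. (v(j := x)) (\<tau> i)) = \<alpha> (\<lambda>i. v (\<tau> i)) \<and>
    \<beta> (\<lambda>i. (v(j := x)) (\<tau> (k + i))) = \<beta> (\<lambda>i. v (\<tau> (k + i)))"
    if \<tau>: "\<tau> permutes {..<k + l}" for \<tau>
  proof -
    have fix_j: "\<tau> i = j \<longleftrightarrow> i = j" for i
      using j \<tau> permutes_inj[OF \<tau>] permutes_not_in[OF \<tau>, of j] by (metis injD lessThan_iff not_le)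
    have 1: "(\<lambda>i. (v(j := x)) (\<tau> i)) = (\<lambda>i. v (\<tau> i))(j := x)"
      using fix_j by (auto simp: fun_eq_iff)
    have 2: "(\<lambda>i. (v(j := x)) (\<tau> (k + i))) = (\<lambda>i. v (\<tau> (k + i)))(j - k := x)"
      using fix_j j by (auto simp: fun_eq_iff)
    show ?thesis
      using assms j unfolding 1 2 slot_bounded_def by auto
  qed
  then show "wedge k l \<alpha> \<beta> (v(j := x)) = wedge k l \<alpha> \<beta> v"
    unfolding wedge_def by (intro arg_cong2[of _ _ _ _ "(/)"] sum.cong) auto
qed

lemma wedge_slot_linear:
  assumes "slot_linear k \<alpha>" "slot_linear l \<beta>" "slot_bounded k \<alpha>" "slot_bounded l \<beta>"
  shows "slot_linear (k + l) (wedge k l \<alpha> \<beta>)"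
  unfolding slot_linear_def
proof (intro allI impI)
  fix v :: "nat \<Rightarrow> 'a" and j assume j: "j < k + l"
  have "linear (\<lambda>x. of_int (sign \<tau>) * \<alpha> (\<lambda>i. (v(j := x)) (\<tau> i)) * \<beta> (\<lambda>i. (v(j := x)) (\<tau> (k + i))))"
    if \<tau>: "\<tau> permutes {..<k + l}" for \<tau>
  proof -
    obtain i where i: "\<tau> i = j" using permutes_surj[OF \<tau>] by (metis surjD)
    then have il: "i < k + l" using j \<tau> by (metis lessThan_iff permutes_in_image)
    have inj: "\<tau> m = j \<longleftrightarrow> m = i" for m
      using permutes_inj[OF \<tau>] i by (auto simp: inj_eq)
    have 1: "(\<lambda>m. (v(j := x)) (\<tau> m)) = (\<lambda>m. v (\<tau> m))(i := x)" for x
      using inj by (auto simp: fun_eq_iff)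
    show ?thesis
    proof (cases "i < k")
      case True
      then have 2: "(\<lambda>m. (v(j := x)) (\<tau> (k + m))) = (\<lambda>m. v (\<tau> (k + m)))" for x
        using inj by (auto simp: fun_eq_iff)
      have "linear (\<lambda>x. \<alpha> ((\<lambda>m. v (\<tau> m))(i := x)))"
        using assms(1) True by (auto simp: slot_linear_def)
      then show ?thesis
        unfolding 1 2 by (auto simp: linear_iff algebra_simps)
    next
      case False
      then have 2: "(\<lambda>m. (v(j := x)) (\<tau> (k + m))) = (\<lambda>m. v (\<tau> (k + m)))(i - k := x)" for x
        using inj by (auto simp: fun_eq_iff)
      have "linear (\<lambda>x. \<beta> ((\<lambda>m. v (\<tau> (k + m)))(i - k := x)))"
        using assms(2) False il by (auto simp: slot_linear_def)
      moreover have 3: "\<alpha> ((\<lambda>m. v (\<tau> m))(i := x)) = \<alpha> (\<lambda>m. v (\<tau> m))" for x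
        using assms(3) False by (auto simp: slot_bounded_def)
      ultimately show ?thesis
        unfolding 1 2 3 by (auto simp: linear_iff algebra_simps)
    qed
  qed
  then have "linear (\<lambda>x. \<Sum>\<tau> | \<tau> permutes {..<k + l}.
      of_int (sign \<tau>) * \<alpha> (\<lambda>i. (v(j := x)) (\<tau> i)) * \<beta> (\<lambda>i. (v(j := x)) (\<tau> (k + i))))"
    by (intro linear_real_sum) auto
  then show "linear (\<lambda>x. wedge k l \<alpha> \<beta> (v(j := x)))"
    unfolding wedge_def divide_inverse mult.commute[of _ "inverse _"]
    by (rule linear_compose_scale_right[where f = "f :: _ \<Rightarrow> real" for f, unfolded real_scaleR_def])
qed

lemma wedge_annihilates:
  assumes "annihilates k u \<alpha>" "annihilates l u \<beta>"
  shows "annihilates (k + l) u (wedge k l \<alpha> \<beta>)"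
  unfolding annihilates_def
proof (intro allI impI)
  fix v :: "nat \<Rightarrow> 'a" and j assume j: "j < k + l" and u: "v j = u"
  have "\<alpha> (\<lambda>i. v (\<tau> i)) * \<beta> (\<lambda>i. v (\<tau> (k + i))) = 0"
    if \<tau>: "\<tau> permutes {..<k + l}" for \<tau>
  proof -
    obtain i where i: "\<tau> i = j" using permutes_surj[OF \<tau>] by (metis surjD)
    then have il: "i < k + l" using j \<tau> by (metis lessThan_iff permutes_in_image)
    show ?thesis
    proof (cases "i < k")
      case True
      then have "\<alpha> (\<lambda>i. v (\<tau> i)) = 0"
        using assms(1)[unfolded annihilates_def, rule_format, of i "\<lambda>i. v (\<tau> i)"] i u by simp
      then show ?thesis by simp
    next
      case False
      then have "i - k < l" "v (\<tau> (k + (i - k))) = u"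
        using i u il by auto
      then have "\<beta> (\<lambda>i. v (\<tau> (k + i))) = 0"
        using assms(2)[unfolded annihilates_def, rule_format, of "i - k" "\<lambda>i. v (\<tau> (k + i))"] by simp
      then show ?thesis by simp
    qed
  qed
  then show "wedge k l \<alpha> \<beta> v = 0"
    unfolding wedge_def mult.assoc by (subst sum.neutral) (auto simp del: mult_eq_0_iff)
qed

text \<open>The product is antisymmetrised over all permutations: composing them with the transposition of
the two equal entries changes the sign of each summand and permutes the summands.\<close>

lemma wedge_alternating:
  assumes i: "i < k + l" and j: "j < k + l" and "i \<noteq> j" and v: "v i = v j"
  shows "wedge k l \<alpha> \<beta> v = 0"
proof -
  let ?P = "{\<tau>. \<tau> permutes {..<k + l}}"
  let ?t = "Transposition.transpose i j"
  let ?f = "\<lambda>\<tau>. of_int (sign \<tau>) * \<alpha> (\<lambda>i. v (\<tau> i)) * \<beta> (\<lambda>i. v (\<tau> (k + i)))"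
  have t: "?t permutes {..<k + l}"
    using i j by (intro permutes_swap_id) auto
  have vt: "v (?t m) = v m" for m
    using v by (auto simp: Transposition.transpose_def)
  have tt: "?t \<circ> (?t \<circ> \<tau>) = \<tau>" for \<tau> :: "nat \<Rightarrow> nat"
    by (simp add: fun_eq_iff)
  have "sum ?f ?P = (\<Sum>\<tau>\<in>?P. - ?f \<tau>)"
  proof (rule sum.reindex_bij_witness[of _ "\<lambda>\<tau>. ?t \<circ> \<tau>" "\<lambda>\<tau>. ?t \<circ> \<tau>"])
    fix \<tau> assume "\<tau> \<in> ?P"
    then have \<tau>: "\<tau> permutes {..<k + l}" by simp
    have "sign (?t \<circ> \<tau>) = - sign \<tau>"
      using sign_compose[OF permutes_imp_permutation[OF _ t] permutes_imp_permutation[OF _ \<tau>]] \<open>i \<noteq> j\<close>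
      by (simp add: sign_swap_id)
    then show "- ?f (?t \<circ> \<tau>) = ?f \<tau>"
      by (simp add: vt)
  qed (use tt permutes_compose[OF _ t] in auto)
  then have "sum ?f ?P = 0"
    by (simp add: sum_negf)
  then show ?thesis
    by (simp add: wedge_def)
qed

lemma wedge_power_slots:
  assumes "\<And>x. linear (\<omega> x)" "\<And>y. linear (\<lambda>x. \<omega> x y)"
  shows "slot_linear (2 * n) (wedge_power n (\<lambda>v. \<omega> (v 0) (v 1)))"
    and "slot_bounded (2 * n) (wedge_power n (\<lambda>v. \<omega> (v 0) (v 1)))"
proof (induction n)
  have 0: "slot_linear 2 (\<lambda>v. \<omega> (v 0) (v 1))"
    using assms by (auto simp: slot_linear_def less_2_cases_iff)
  have 1: "slot_bounded 2 (\<lambda>v. \<omega> (v 0) (v 1))"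
    by (auto simp: slot_bounded_def)
  case (Suc n)
  show "slot_linear (2 * Suc n) (wedge_power (Suc n) (\<lambda>v. \<omega> (v 0) (v 1)))"
    using wedge_slot_linear[OF Suc(1) 0 Suc(2) 1] by (simp add: add.commute)
  show "slot_bounded (2 * Suc n) (wedge_power (Suc n) (\<lambda>v. \<omega> (v 0) (v 1)))"
    using wedge_slot_bounded[OF Suc(2) 1] by (simp add: add.commute)
qed (auto simp: slot_linear_def slot_bounded_def)

lemma wedge_power_annihilates:
  assumes "\<And>x. \<omega> u x = 0" "\<And>x. \<omega> x u = 0"
  shows "annihilates (2 * n) u (wedge_power n (\<lambda>v. \<omega> (v 0) (v 1)))"
proof (induction n)
  case (Suc n)
  have "annihilates 2 u (\<lambda>v. \<omega> (v 0) (v 1))"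
    using assms by (auto simp: annihilates_def less_2_cases_iff)
  from wedge_annihilates[OF Suc this] show ?case by (simp add: add.commute)
qed (auto simp: annihilates_def)

lemma independent_card_le_dim:
  fixes S :: "'e::finite_dim_normed set"
  assumes "independent S"
  shows "finite S \<and> card S \<le> model_dim TYPE('e)"
proof -
  obtain B :: "'e set" where B: "finite B" "span B = UNIV" using finite_spanning_set by blast
  then obtain C where C: "C \<subseteq> B" "independent C" "span C = UNIV"
    using maximal_independent_subset[of B] span_minimal[OF _ subspace_span, of B] by (metis top.extremum_uniqueI)
  then have "finite C" using B finite_subset by blast
  have "card C = model_dim TYPE('e)" using dim_eq_card[of C UNIV] C by simp
  then show ?thesis
    using independent_span_bound[OF \<open>finite C\<close> assms] C by auto
qed

lemma independent_card_eq_dim_spans: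
  fixes S :: "'e::finite_dim_normed set"
  assumes "independent S" "card S = model_dim TYPE('e)"
  shows "span S = UNIV"
proof (rule ccontr)
  assume "span S \<noteq> UNIV"
  then obtain u where u: "u \<notin> span S" by blast
  then have "independent (insert u S)" using assms(1) by (simp add: independent_insertI)
  from independent_card_le_dim[OF this] show False
    using u assms span_base by (metis card_insert_disjoint finite_insert not_less_eq_eq order_refl)
qed

text \<open>Let \<open>u\<close> be annihilated by both forms. The volume form then vanishes on every family that contains
  \<open>u\<close>. If \<open>u\<close> were not \<open>0\<close>, it would vanish on every family \<open>v\<close> of \<open>2n + 1\<close> vectors: either \<open>v\<close> is
  dependent, or it is a basis, and exchanging a suitable vector of \<open>v\<close> for \<open>u\<close> multiplies the value by
  a nonzero coefficient of \<open>u\<close>.\<close>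

lemma contact_volume_nondegenerate:
  fixes \<omega> :: "'e::finite_dim_normed \<Rightarrow> 'e \<Rightarrow> real"
  assumes dim: "model_dim TYPE('e) = 2 * n + 1"
    and lin: "\<And>x. linear (\<omega> x)" "\<And>y. linear (\<lambda>x. \<omega> x y)" "linear \<theta>"
    and nz: "wedge (2 * n) 1 (wedge_power n (\<lambda>v. \<omega> (v 0) (v 1))) (\<lambda>v. \<theta> (v 0)) v \<noteq> 0"
    and u: "\<And>x. \<omega> u x = 0" "\<And>x. \<omega> x u = 0" "\<theta> u = 0"
  shows "u = 0"
proof (rule ccontr)
  assume "u \<noteq> 0"
  define N where "N = 2 * n + 1"
  define \<Omega> where "\<Omega> = wedge (2 * n) 1 (wedge_power n (\<lambda>v. \<omega> (v 0) (v 1))) (\<lambda>v. \<theta> (v 0))"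
  have lin\<Omega>: "slot_linear N \<Omega>"
    unfolding \<Omega>_def N_def using lin(3)
    by (intro wedge_slot_linear wedge_power_slots lin) (auto simp: slot_linear_def slot_bounded_def)
  have ann: "annihilates N u \<Omega>"
    unfolding \<Omega>_def N_def using u(3)
    by (intro wedge_annihilates wedge_power_annihilates u) (auto simp: annihilates_def)
  have alt: "w i \<noteq> w j" if "\<Omega> w \<noteq> 0" "i < N" "j < N" "i \<noteq> j" for w i j
    using wedge_alternating[of i "2 * n" 1 j w] that unfolding \<Omega>_def N_def by auto
  have nz': "\<Omega> v \<noteq> 0" using nz unfolding \<Omega>_def .
  have inj: "inj_on v {..<N}" using alt[OF nz'] by (auto simp: inj_on_def)
  \<comment> \<open>Both cases give a combination of the vectors with a nonzero coefficient that replaces one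
    of them by a vector, \<open>0\<close> or \<open>u\<close>, on which the form vanishes.\<close>
  have "\<exists>c k. k < N \<and> c k \<noteq> 0 \<and> (\<Sum>i<N. c i *\<^sub>R v i) \<in> {0, u}"
  proof (cases "independent (v ` {..<N})")
    case True
    then have "span (v ` {..<N}) = UNIV"
      using dim inj by (intro independent_card_eq_dim_spans) (auto simp: card_image N_def)
    then have "u \<in> span (v ` {..<N})" by simp
    then obtain r where "u = (\<Sum>x\<in>v ` {..<N}. r x *\<^sub>R x)"
      by (auto simp: span_finite)
    then have "u = (\<Sum>i<N. r (v i) *\<^sub>R v i)"
      using inj by (simp add: sum.reindex)
    moreover from this \<open>u \<noteq> 0\<close> obtain k where "k < N" "r (v k) \<noteq> 0"
      by (metis (no_types, lifting) lessThan_iff scaleR_eq_0_iff sum.neutral)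
    ultimately show ?thesis
      by (intro exI[of _ "\<lambda>i. r (v i)"] exI[of _ k]) auto
  next
    case False
    then obtain r x where "x \<in> v ` {..<N}" "r x \<noteq> 0" "(\<Sum>x\<in>v ` {..<N}. r x *\<^sub>R x) = 0"
      by (auto simp: dependent_finite)
    then obtain k where "k < N" "r (v k) \<noteq> 0" "(\<Sum>i<N. r (v i) *\<^sub>R v i) = 0"
      using inj by (auto simp: sum.reindex)
    then show ?thesis
      by (intro exI[of _ "\<lambda>i. r (v i)"] exI[of _ k]) auto
  qed
  then obtain c k where k: "k < N" "c k \<noteq> 0" and c: "(\<Sum>i<N. c i *\<^sub>R v i) \<in> {0, u}" by blast
  interpret L: linear "\<lambda>x. \<Omega> (v(k := x))"
    using lin\<Omega> k by (auto simp: slot_linear_def)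
  have "\<Omega> (v(k := u)) = 0"
    using ann k unfolding annihilates_def by (metis fun_upd_same)
  then have "0 = \<Omega> (v(k := \<Sum>i<N. c i *\<^sub>R v i))"
    using c L.zero by auto
  also have "\<dots> = (\<Sum>i<N. c i * \<Omega> (v(k := v i)))"
    by (simp add: L.sum L.scale)
  also have "\<dots> = (\<Sum>i<N. if i = k then c k * \<Omega> v else 0)"
  proof (rule sum.cong)
    fix i assume "i \<in> {..<N}"
    then show "c i * \<Omega> (v(k := v i)) = (if i = k then c k * \<Omega> v else 0)"
      using alt[of "v(k := v i)" i k] k by auto
  qed simp
  also have "\<dots> = c k * \<Omega> v" using k by simp
  finally show False using k nz' by simp
qed

section \<open>Quadratures in coordinates of a Euclidean space\<close>

text \<open>The relation \<^const>\<open>quadratures\<close> is about functions of real sequences with finitely many nonzero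
entries. Calculus is done on a Euclidean space instead: an enumeration \<open>e\<close> of its basis translates
between vectors and sequences, and each rule of \<^const>\<open>quadratures\<close> becomes a rule for \<open>quad\<close> in
which partial derivatives are values of Frechet derivatives.\<close>

definition basis_enum :: "(nat \<Rightarrow> 'v::euclidean_space) \<Rightarrow> bool" where
  "basis_enum e \<longleftrightarrow> bij_betw e {..<DIM('v)} Basis"

definition tup :: "(nat \<Rightarrow> 'v::euclidean_space) \<Rightarrow> 'v \<Rightarrow> nat \<Rightarrow> real" where
  "tup e v = tuple DIM('v) (\<lambda>i. v \<bullet> e i)"

definition untup :: "(nat \<Rightarrow> 'v::euclidean_space) \<Rightarrow> (nat \<Rightarrow> real) \<Rightarrow> 'v" where
  "untup e x = (\<Sum>i<DIM('v). x i *\<^sub>R e i)"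

lemma basis_enum_in: "basis_enum e \<Longrightarrow> i < DIM('v) \<Longrightarrow> e i \<in> (Basis :: 'v::euclidean_space set)"
  by (auto simp: basis_enum_def bij_betw_def)

lemma basis_enum_inner:
  "basis_enum e \<Longrightarrow> i < DIM('v) \<Longrightarrow> j < DIM('v) \<Longrightarrow>
    e i \<bullet> e j = (if i = j then 1 else 0)" for e :: "nat \<Rightarrow> 'v::euclidean_space"
  using basis_enum_in[of e] by (auto simp: inner_Basis basis_enum_def bij_betw_def inj_on_def)

lemma basis_enum_sum:
  "basis_enum e \<Longrightarrow> (\<Sum>i<DIM('v). f (e i)) = (\<Sum>b\<in>Basis. f b)" for e :: "nat \<Rightarrow> 'v::euclidean_space"
  unfolding basis_enum_def by (rule sum.reindex_bij_betw)

lemma tup_nth: "i < DIM('v) \<Longrightarrow> tup e v i = v \<bullet> e i" for v :: "'v::euclidean_space"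
  by (simp add: tup_def tuple_def)

lemma untup_tup [simp]: "basis_enum e \<Longrightarrow> untup e (tup e v) = v"
  by (simp add: untup_def tup_nth basis_enum_sum[of e "\<lambda>b. (v \<bullet> b) *\<^sub>R b"] euclidean_representation)

lemma inner_untup:
  fixes e :: "nat \<Rightarrow> 'v::euclidean_space"
  assumes "basis_enum e" "i < DIM('v)"
  shows "untup e x \<bullet> e i = x i"
proof -
  have "untup e x \<bullet> e i = (\<Sum>j<DIM('v). if j = i then x i else 0)"
    unfolding untup_def inner_sum_left
    by (rule sum.cong) (auto simp: basis_enum_inner[OF assms(1) _ assms(2)])
  then show ?thesis using assms by simp
qed

lemma tup_untup: "basis_enum e \<Longrightarrow> tup e (untup e x) = tuple DIM('v) x"
  for e :: "nat \<Rightarrow> 'v::euclidean_space"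
  by (auto simp: tup_def tuple_def inner_untup)

lemma tup_untup_id [simp]:
  "basis_enum e \<Longrightarrow> x \<in> topspace (Euclidean_space DIM('v)) \<Longrightarrow> tup e (untup e x) = x"
  for e :: "nat \<Rightarrow> 'v::euclidean_space"
  by (auto simp: tup_untup tuple_def topspace_Euclidean_space)

lemma tup_in_topspace [simp]: "tup e v \<in> topspace (Euclidean_space DIM('v))"
  for v :: "'v::euclidean_space"
  by (auto simp: tup_def tuple_def topspace_Euclidean_space)

lemma tup_image:
  "basis_enum e \<Longrightarrow> tup e ` S = {x \<in> topspace (Euclidean_space DIM('v)). untup e x \<in> S}"
  for e :: "nat \<Rightarrow> 'v::euclidean_space"
  by (force simp: image_iff)

lemma continuous_on_untup: "continuous_on S (untup e)"
  unfolding untup_def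
  by (intro continuous_intros continuous_on_subset[OF continuous_on_product_coordinates]) auto

lemma openin_tup_image:
  fixes e :: "nat \<Rightarrow> 'v::euclidean_space"
  assumes "basis_enum e" "open S"
  shows "openin (Euclidean_space DIM('v)) (tup e ` S)"
proof -
  have E: "Euclidean_space DIM('v) = top_of_set (topspace (Euclidean_space DIM('v)))"
    by (simp add: Euclidean_space_def euclidean_product_topology topspace_Euclidean_space)
  have "openin (top_of_set (topspace (Euclidean_space DIM('v))))
      (topspace (Euclidean_space DIM('v)) \<inter> untup e -` S)"
    by (rule continuous_openin_preimage_gen[OF continuous_on_untup assms(2)])
  moreover have "tup e ` S = topspace (Euclidean_space DIM('v)) \<inter> untup e -` S"
    using tup_image[OF assms(1), of S] by auto
  ultimately show ?thesis
    by (simp only: arg_cong[OF E, of openin])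
qed

lemma tup_update:
  fixes z :: "'v::euclidean_space"
  assumes "basis_enum e" "i < DIM('v)"
  shows "(tup e z)(i := s) = tup e (z + (s - z \<bullet> e i) *\<^sub>R e i)"
  using basis_enum_inner[OF assms(1)] assms(2)
  by (auto simp: tup_def tuple_def fun_eq_iff algebra_simps)

definition quad ::
  "(nat \<times> (nat \<Rightarrow> real) set \<times> ((nat \<Rightarrow> real) \<Rightarrow> real)) set \<Rightarrow> (nat \<Rightarrow> 'v::euclidean_space) \<Rightarrow>
   'v set \<Rightarrow> ('v \<Rightarrow> real) \<Rightarrow> bool" where
  "quad D e S f \<longleftrightarrow> quadratures D DIM('v) (tup e ` S) (\<lambda>x. f (untup e x))"

lemma quad_restrict:
  assumes "basis_enum e" "quad D e S f" "open T" "T \<subseteq> S" "\<And>z. z \<in> T \<Longrightarrow> g z = f z"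
  shows "quad D e T g"
  unfolding quad_def
  by (rule quadratures.restrict[OF assms(2)[unfolded quad_def]])
    (use assms in \<open>auto intro!: openin_tup_image\<close>)

lemma quad_from_quadratures:
  fixes e :: "nat \<Rightarrow> 'v::euclidean_space"
  assumes "basis_enum e" "quadratures D DIM('v) (tup e ` S) f" "open T" "T \<subseteq> S"
    "\<And>z. z \<in> T \<Longrightarrow> g z = f (tup e z)"
  shows "quad D e T g"
  unfolding quad_def
  by (rule quadratures.restrict[OF assms(2)])
    (use assms in \<open>auto intro!: openin_tup_image\<close>)

lemma quad_to_quadratures:
  fixes e :: "nat \<Rightarrow> 'v::euclidean_space"
  assumes "basis_enum e" "quad D e S f" "open S" "\<And>z. z \<in> S \<Longrightarrow> g (tup e z) = f z"
  shows "quadratures D DIM('v) (tup e ` S) g"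
  by (rule quadratures.restrict[OF assms(2)[unfolded quad_def]])
    (use assms in \<open>auto intro!: openin_tup_image\<close>)

lemma quad_const: "basis_enum e \<Longrightarrow> open S \<Longrightarrow> quad D e S (\<lambda>z. c)"
  unfolding quad_def by (intro quadratures.const openin_tup_image)

lemma quad_inner:
  fixes e :: "nat \<Rightarrow> 'v::euclidean_space"
  assumes "basis_enum e" "open S" "i < DIM('v)"
  shows "quad D e S (\<lambda>z. z \<bullet> e i)"
  by (rule quad_from_quadratures[OF assms(1) quadratures.variable[OF openin_tup_image[OF assms(1,2)] assms(3)] assms(2)])
    (use assms in \<open>auto simp: tup_nth\<close>)

lemma quad_add: "quad D e S f \<Longrightarrow> quad D e S g \<Longrightarrow> quad D e S (\<lambda>z. f z + g z)"
  unfolding quad_def by (rule quadratures.add)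

lemma quad_mult: "quad D e S f \<Longrightarrow> quad D e S g \<Longrightarrow> quad D e S (\<lambda>z. f z * g z)"
  unfolding quad_def by (rule quadratures.mult)

lemma quad_diff:
  assumes "basis_enum e" "open S" "quad D e S f" "quad D e S g"
  shows "quad D e S (\<lambda>z. f z - g z)"
  using quad_add[OF assms(3) quad_mult[OF quad_const[OF assms(1,2), of D "-1"] assms(4)]] by simp

lemma quad_sum:
  assumes "basis_enum e" "open S" "\<And>i. i \<in> I \<Longrightarrow> quad D e S (f i)"
  shows "quad D e S (\<lambda>z. \<Sum>i\<in>I. f i z)"
  using assms(3)
  by (induction I rule: infinite_finite_induct) (auto intro: quad_const quad_add assms(1,2))

text \<open>A linear functional is a combination of the components with constant coefficients, and every
constant is admitted as known.\<close>

lemma quad_linear: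
  fixes e' :: "nat \<Rightarrow> 'w::euclidean_space"
  assumes e: "basis_enum e" "open S" and L: "linear L" "\<And>j. j < DIM('w) \<Longrightarrow> quad D e S (\<lambda>z. g z \<bullet> e' j)"
    and e': "basis_enum e'"
  shows "quad D e S (\<lambda>z. L (g z) :: real)"
proof -
  interpret linear L by fact
  have Lv: "L v = (\<Sum>j<DIM('w). L (e' j) * (v \<bullet> e' j))" for v
  proof -
    have "L v = L (untup e' (tup e' v))" using e' by simp
    then show ?thesis
      by (simp add: untup_def sum scale tup_nth mult.commute)
  qed
  have "quad D e S (\<lambda>z. \<Sum>j<DIM('w). L (e' j) * (g z \<bullet> e' j))"
    by (intro quad_sum e quad_mult quad_const L(2)) simp
  then show ?thesis by (simp only: Lv[symmetric])
qed

lemma quad_compose: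
  fixes e :: "nat \<Rightarrow> 'v::euclidean_space" and e' :: "nat \<Rightarrow> 'w::euclidean_space"
  assumes "basis_enum e" "basis_enum e'" "quad D e' T f" "open S"
    "\<And>j. j < DIM('w) \<Longrightarrow> quad D e S (\<lambda>z. g z \<bullet> e' j)" "g ` S \<subseteq> T"
  shows "quad D e S (\<lambda>z. f (g z))"
proof -
  have "quadratures D DIM('v) (tup e ` S)
      (\<lambda>x. f (untup e' (tuple DIM('w) (\<lambda>j. g (untup e x) \<bullet> e' j))))"
    by (rule quadratures.compose[OF assms(3)[unfolded quad_def]])
      (use assms in \<open>auto simp: quad_def tup_def[symmetric] intro!: openin_tup_image\<close>)
  then show ?thesis
    using assms(2) by (simp add: quad_def tup_def[symmetric])
qed

lemma has_partial_from_derivative: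
  fixes e :: "nat \<Rightarrow> 'v::euclidean_space"
  assumes "basis_enum e" "i < DIM('v)" "\<And>z. z \<in> S \<Longrightarrow> (f has_derivative f' z) (at z)"
  shows "has_partial (\<lambda>x. f (untup e x)) i (\<lambda>x. f' (untup e x) (e i)) (tup e ` S)"
  unfolding has_partial_def
proof
  fix x assume "x \<in> tup e ` S"
  then obtain z where z: "z \<in> S" and x: "x = tup e z" by auto
  interpret bounded_linear "f' z" using assms(3)[OF z] has_derivative_bounded_linear by blast
  have "((\<lambda>s. z + (s - z \<bullet> e i) *\<^sub>R e i) has_derivative (\<lambda>k. k *\<^sub>R e i)) (at (z \<bullet> e i))"
    by (auto intro!: derivative_eq_intros)
  moreover have "(f has_derivative f' z) (at (z + (z \<bullet> e i - z \<bullet> e i) *\<^sub>R e i))"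
    using assms(3)[OF z] by simp
  ultimately have "((\<lambda>s. f (z + (s - z \<bullet> e i) *\<^sub>R e i)) has_derivative (\<lambda>k. f' z (k *\<^sub>R e i))) (at (z \<bullet> e i))"
    by (rule has_derivative_compose)
  then have "((\<lambda>s. f (z + (s - z \<bullet> e i) *\<^sub>R e i)) has_real_derivative f' z (e i)) (at (z \<bullet> e i))"
    by (simp add: has_field_derivative_def scaleR mult_commute_abs)
  then show "((\<lambda>s. f (untup e (x(i := s)))) has_real_derivative f' (untup e x) (e i)) (at (x i))"
    using assms(1,2) by (simp add: x tup_update tup_nth)
qed

lemma quad_derivative:
  fixes e :: "nat \<Rightarrow> 'v::euclidean_space"
  assumes "basis_enum e" "i < DIM('v)" "quad D e S f" "\<And>z. z \<in> S \<Longrightarrow> (f has_derivative f' z) (at z)"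
  shows "quad D e S (\<lambda>z. f' z (e i))"
  unfolding quad_def
  by (rule quadratures.differentiate[OF assms(3)[unfolded quad_def] assms(2)
      has_partial_from_derivative[OF assms(1,2,4)]])

text \<open>Solving \<open>f (r y) = g y\<close> for an equal number of equations and unknowns; an injective derivative
says that the immersion condition on the matrix of partial derivatives holds.\<close>

lemma quad_solve:
  fixes e :: "nat \<Rightarrow> 'v::euclidean_space" and e' :: "nat \<Rightarrow> 'w::euclidean_space"
  assumes e: "basis_enum e" "basis_enum e'" and U: "open U" and T: "open T"
    and f: "\<And>j. j < DIM('v) \<Longrightarrow> quad D e U (\<lambda>z. f z \<bullet> e j)"
    and f': "\<And>z. z \<in> U \<Longrightarrow> (f has_derivative f' z) (at z)" "\<And>z. z \<in> U \<Longrightarrow> inj (f' z)"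
    and inj: "inj_on f U"
    and g: "\<And>j. j < DIM('v) \<Longrightarrow> quad D e' T (\<lambda>y. g y \<bullet> e j)"
    and r: "continuous_on T r" "r ` T \<subseteq> U" "\<And>y. y \<in> T \<Longrightarrow> f (r y) = g y"
    and i: "i < DIM('v)"
  shows "quad D e' T (\<lambda>y. r y \<bullet> e i)"
proof -
  let ?k = "DIM('v)" and ?h = "DIM('w)"
  have "quadratures D ?h (tup e' ` T) (\<lambda>y. (\<lambda>y. tup e (r (untup e' y))) y i)"
  proof (rule quadratures.solve[where k = ?k and l = ?k and U = "tup e ` U"
        and f = "\<lambda>j x. f (untup e x) \<bullet> e j" and J = "\<lambda>j i x. f' (untup e x) (e i) \<bullet> e j"
        and g = "\<lambda>j y. g (untup e' y) \<bullet> e j"])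
    show "openin (Euclidean_space ?k) (tup e ` U)" "openin (Euclidean_space ?h) (tup e' ` T)"
      using openin_tup_image e U T by blast+
    show "quadratures D ?k (tup e ` U) (\<lambda>x. f (untup e x) \<bullet> e j)" if "j < ?k" for j
      using f[OF that] by (simp add: quad_def)
    show "quadratures D ?h (tup e' ` T) (\<lambda>y. g (untup e' y) \<bullet> e j)" if "j < ?k" for j
      using g[OF that] by (simp add: quad_def)
    show "has_partial (\<lambda>x. f (untup e x) \<bullet> e j) i (\<lambda>x. f' (untup e x) (e i) \<bullet> e j) (tup e ` U)"
      if "i < ?k" for i j
      by (rule has_partial_from_derivative[OF e(1) that, where f = "\<lambda>z. f z \<bullet> e j"])
        (use f'(1) in \<open>auto intro: has_derivative_inner_left\<close>)
    show "v i = 0"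
      if x: "x \<in> tup e ` U" and v: "\<forall>j<?k. (\<Sum>i<?k. f' (untup e x) (e i) \<bullet> e j * v i) = 0" and i: "i < ?k"
      for x v i
    proof -
      obtain z where z: "z \<in> U" "x = tup e z" using x by auto
      interpret bounded_linear "f' z" using f'(1)[OF z(1)] has_derivative_bounded_linear by blast
      have "f' z (untup e v) \<bullet> e j = 0" if "j < ?k" for j
      proof -
        have "f' z (untup e v) = (\<Sum>i<?k. v i *\<^sub>R f' z (e i))"
          by (simp add: untup_def sum scaleR)
        then show ?thesis using v that z e by (simp add: inner_sum_left mult.commute)
      qed
      then have "tup e (f' z (untup e v)) = (\<lambda>i. 0)" by (auto simp: tup_def tuple_def)
      then have "f' z (untup e v) = f' z 0"
        using untup_tup[OF e(1), of "f' z (untup e v)"] by (simp add: untup_def zero)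
      then have "untup e v = 0" using injD[OF f'(2)[OF z(1)]] by blast
      then show ?thesis using inner_untup[OF e(1) i, of v] by simp
    qed
    have "inj_on (\<lambda>x. tup e (f (untup e x))) (tup e ` U)"
    proof (rule inj_onI)
      fix x y assume "x \<in> tup e ` U" "y \<in> tup e ` U" and eq: "tup e (f (untup e x)) = tup e (f (untup e y))"
      then obtain z w where zw: "z \<in> U" "x = tup e z" "w \<in> U" "y = tup e w" by blast
      then have "f z = f w"
        using arg_cong[OF eq, of "untup e"] e(1) by simp
      then show "x = y" using inj zw by (auto simp: inj_on_def)
    qed
    then show "inj_on (\<lambda>x. tuple ?k (\<lambda>j. f (untup e x) \<bullet> e j)) (tup e ` U)"
      by (simp add: tup_def)
    have "continuous_on (tup e' ` T) (\<lambda>y. r (untup e' y))"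
      by (rule continuous_on_compose2[OF r(1) continuous_on_untup]) (use e in auto)
    then show "continuous_map (subtopology (Euclidean_space ?h) (tup e' ` T)) (Euclidean_space ?k)
        (\<lambda>y. tup e (r (untup e' y)))"
      unfolding cm_Euclidean_space_iff_continuous_on
    proof (intro conjI)
      assume c: "continuous_on (tup e' ` T) (\<lambda>y. r (untup e' y))"
      have "continuous_on (tup e' ` T) (\<lambda>y. tup e (r (untup e' y)))"
      proof (rule continuous_on_coordinatewise_then_product)
        fix i show "continuous_on (tup e' ` T) (\<lambda>y. tup e (r (untup e' y)) i)"
        proof (cases "i < ?k")
          case True
          then show ?thesis using continuous_on_inner[OF c continuous_on_const[of _ "e i"]]
            by (simp add: tup_nth)
        qed (simp add: tup_def tuple_def)
      qed
      then show "continuous_on (topspace (subtopology (Euclidean_space ?h) (tup e' ` T)))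
          (\<lambda>y. tup e (r (untup e' y)))"
        by (rule continuous_on_subset) auto
    qed (simp add: Pi_def del: topspace_subtopology)
    show "tup e (r (untup e' y)) \<in> tup e ` U" if "y \<in> tup e' ` T" for y
      using that r e by auto
    show "f (untup e (tup e (r (untup e' y)))) \<bullet> e j = g (untup e' y) \<bullet> e j" if "y \<in> tup e' ` T" for y j
      using that r e by auto
  qed (use i in auto)
  then show ?thesis using i by (simp add: quad_def tup_nth)
qed

text \<open>In \<open>'v \<times> real\<close> the additional variable comes last, as time does in \<^const>\<open>flow_by_quadratures\<close>.
It also serves as the variable of integration.\<close>

definition ext_enum :: "(nat \<Rightarrow> 'v::euclidean_space) \<Rightarrow> nat \<Rightarrow> 'v \<times> real" where
  "ext_enum e i = (if i < DIM('v) then (e i, 0) else (0, 1))"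

lemma basis_enum_ext:
  fixes e :: "nat \<Rightarrow> 'v::euclidean_space"
  assumes "basis_enum e"
  shows "basis_enum (ext_enum e)"
proof -
  have "bij_betw (\<lambda>i. (e i, 0::real)) {..<DIM('v)} ((\<lambda>b. (b, 0)) ` Basis)"
    using assms unfolding basis_enum_def
    by (auto simp: bij_betw_def inj_on_def)
  then have "bij_betw (ext_enum e) {..<DIM('v)} ((\<lambda>b. (b, 0)) ` Basis)"
    by (rule bij_betw_cong[THEN iffD1, rotated]) (simp add: ext_enum_def)
  moreover have "bij_betw (ext_enum e) {DIM('v)} {(0, 1)}"
    by (simp add: ext_enum_def bij_betw_def)
  ultimately have "bij_betw (ext_enum e) ({..<DIM('v)} \<union> {DIM('v)}) ((\<lambda>b. (b, 0)) ` Basis \<union> {(0, 1)})"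
    by (rule bij_betw_combine) auto
  moreover have "{..<DIM('v)} \<union> {DIM('v)} = {..<DIM('v \<times> real)}" by auto
  ultimately show ?thesis
    by (simp add: basis_enum_def Basis_prod_def)
qed

lemma inner_ext_enum:
  "z \<bullet> ext_enum e i = (if i < DIM('v) then fst z \<bullet> e i else snd z)" for z :: "'v::euclidean_space \<times> real"
  by (simp add: ext_enum_def inner_prod_def)

lemma tup_ext: "tup (ext_enum e) (v, t) = (tup e v)(DIM('v) := t)" for v :: "'v::euclidean_space"
  by (auto simp: tup_def tuple_def fun_eq_iff inner_ext_enum less_Suc_eq)

lemma quad_fst:
  fixes e :: "nat \<Rightarrow> 'v::euclidean_space"
  assumes "basis_enum e" "open S" "i < DIM('v)"
  shows "quad D (ext_enum e) S (\<lambda>p. fst p \<bullet> e i)"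
  using quad_inner[OF basis_enum_ext[OF assms(1)] assms(2), of i D] assms(3)
  by (simp add: inner_ext_enum)

lemma quad_snd:
  fixes e :: "nat \<Rightarrow> 'v::euclidean_space"
  assumes "basis_enum e" "open S"
  shows "quad D (ext_enum e) S snd"
  using quad_inner[OF basis_enum_ext[OF assms(1)] assms(2), of "DIM('v)" D]
  by (simp add: inner_ext_enum)

lemma quad_Pair:
  fixes e' :: "nat \<Rightarrow> 'v::euclidean_space"
  assumes "\<And>i. i < DIM('v) \<Longrightarrow> quad D e S (\<lambda>z. f z \<bullet> e' i)" "quad D e S g"
  shows "quad D e S (\<lambda>z. (f z, g z) \<bullet> ext_enum e' j)"
  using assms by (cases "j < DIM('v)") (simp_all add: inner_ext_enum)

lemma quad_integrate:
  fixes e :: "nat \<Rightarrow> 'v::euclidean_space"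
  assumes e: "basis_enum e" and I: "convex I" "0 \<in> I"
    and f: "quad D (ext_enum e) (U \<times> I) f"
    and F: "\<And>z s. z \<in> U \<Longrightarrow> s \<in> I \<Longrightarrow> ((\<lambda>s. F (z, s)) has_real_derivative f (z, s)) (at s)"
      "\<And>z. z \<in> U \<Longrightarrow> F (z, 0) = 0"
  shows "quad D (ext_enum e) (U \<times> I) F"
proof -
  let ?d = "DIM('v)"
  note ee = basis_enum_ext[OF e]
  have upd: "(tup (ext_enum e) (z, t))(?d := s) = tup (ext_enum e) (z, s)" for z t s
    by (simp add: tup_ext)
  show ?thesis
    unfolding quad_def
  proof (rule quadratures.integrate[where a = 0 and i = ?d, OF f[unfolded quad_def]])
    show "x(?d := s) \<in> tup (ext_enum e) ` (U \<times> I)"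
      if x: "x \<in> tup (ext_enum e) ` (U \<times> I)" and s: "s \<in> closed_segment 0 (x ?d)" for x s
    proof -
      obtain z t where zt: "z \<in> U" "t \<in> I" "x = tup (ext_enum e) (z, t)"
        using x by blast
      have "s \<in> closed_segment 0 t" using s zt(3) by (simp add: tup_ext)
      then have "s \<in> I" using closed_segment_subset[OF I(2) zt(2) I(1)] by blast
      then show ?thesis using zt(1,3) upd by auto
    qed
    show "has_partial (\<lambda>x. F (untup (ext_enum e) x)) ?d (\<lambda>x. f (untup (ext_enum e) x)) (tup (ext_enum e) ` (U \<times> I))"
      unfolding has_partial_def
    proof
      fix x assume "x \<in> tup (ext_enum e) ` (U \<times> I)"
      then obtain z t where "z \<in> U" "t \<in> I" "x = tup (ext_enum e) (z, t)"
        by blast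
      then show "((\<lambda>s. F (untup (ext_enum e) (x(?d := s)))) has_real_derivative
          f (untup (ext_enum e) x)) (at (x ?d))"
        using F(1)[of z t] ee by (simp only: upd untup_tup) (simp add: tup_ext)
    qed
    show "F (untup (ext_enum e) x) = 0" if x: "x \<in> tup (ext_enum e) ` (U \<times> I)" and x0: "x ?d = 0" for x
    proof -
      obtain z t where "z \<in> U" "t \<in> I" "x = tup (ext_enum e) (z, t)"
        using x by blast
      then show ?thesis using F(2)[of z] x0 ee by (simp add: tup_ext[of e z t, THEN fun_cong])
    qed
  qed simp
qed

section \<open>Differential forms of degree one on Euclidean spaces\<close>

lemma frechet_derivative_eq:
  "(f has_derivative f') (at x) \<Longrightarrow> fderiv f x v = f' v"
  using frechet_derivative_at[of f f' x] by simp

text \<open>The exterior derivative in coordinates, with the sign and without the factor 1/2 as in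
\<^const>\<open>ext_deriv\<close>.\<close>

definition form_d :: "('v::euclidean_space \<Rightarrow> 'v \<Rightarrow> real) \<Rightarrow> 'v \<Rightarrow> 'v \<Rightarrow> 'v \<Rightarrow> real" where
  "form_d \<theta> z u v =
    fderiv (\<lambda>z. \<theta> z v) z u - fderiv (\<lambda>z. \<theta> z u) z v"

lemma linear_as_basis_sum:
  fixes f :: "'v::euclidean_space \<Rightarrow> real"
  assumes "linear f"
  shows "f v = (\<Sum>b\<in>Basis. (v \<bullet> b) * f b)"
proof -
  interpret linear f by fact
  have "f v = f (\<Sum>b\<in>Basis. (v \<bullet> b) *\<^sub>R b)" by (simp add: euclidean_representation)
  then show ?thesis by (simp add: sum scale)
qed

text \<open>The product rule for the evaluation of a form on a vector, both depending on a parameter;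
linearity in the vector reduces it to finitely many products of real functions.\<close>

lemma form_eval_derivative:
  fixes \<theta> :: "'v::euclidean_space \<Rightarrow> 'v \<Rightarrow> real"
  assumes U: "open U" "m x \<in> U"
    and lin: "\<And>z. z \<in> U \<Longrightarrow> linear (\<theta> z)"
    and diff: "\<And>w. (\<lambda>z. \<theta> z w) differentiable (at (m x))"
    and m: "(m has_derivative m') (at x)" and \<zeta>: "(\<zeta> has_derivative \<zeta>') (at x)"
  shows "((\<lambda>y. \<theta> (m y) (\<zeta> y)) has_derivative
    (\<lambda>k. fderiv (\<lambda>z. \<theta> z (\<zeta> x)) (m x) (m' k) + \<theta> (m x) (\<zeta>' k))) (at x)"
proof -
  let ?D = "\<lambda>w. fderiv (\<lambda>z. \<theta> z w) (m x)"
  have D: "((\<lambda>z. \<theta> z w) has_derivative ?D w) (at (m x))" for w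
    using diff[of w] frechet_derivative_works by blast
  have "isCont m x" using m has_derivative_continuous by blast
  then have "\<exists>V. open V \<and> x \<in> V \<and> (\<forall>y\<in>V. m y \<in> U)"
    using U unfolding continuous_at_open by simp
  then obtain V where V: "open V" "x \<in> V" "\<And>y. y \<in> V \<Longrightarrow> m y \<in> U"
    by metis
  have Dsum: "?D (\<zeta> x) h = (\<Sum>b\<in>Basis. (\<zeta> x \<bullet> b) * ?D b h)" for h
  proof -
    have "((\<lambda>z. \<Sum>b\<in>Basis. (\<zeta> x \<bullet> b) * \<theta> z b) has_derivative (\<lambda>h. \<Sum>b\<in>Basis. (\<zeta> x \<bullet> b) * ?D b h)) (at (m x))"
      by (intro has_derivative_sum has_derivative_mult_right D)
    then have "((\<lambda>z. \<theta> z (\<zeta> x)) has_derivative (\<lambda>h. \<Sum>b\<in>Basis. (\<zeta> x \<bullet> b) * ?D b h)) (at (m x))"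
      by (rule has_derivative_transform_within_open[OF _ U]) (rule linear_as_basis_sum[OF lin, symmetric])
    then show ?thesis by (rule frechet_derivative_eq)
  qed
  have Db: "((\<lambda>y. \<theta> (m y) b) has_derivative (\<lambda>k. ?D b (m' k))) (at x)" for b
    using has_derivative_compose[OF m D] .
  have "((\<lambda>y. \<Sum>b\<in>Basis. (\<zeta> y \<bullet> b) * \<theta> (m y) b) has_derivative
      (\<lambda>k. \<Sum>b\<in>Basis. (\<zeta> x \<bullet> b) * ?D b (m' k) + (\<zeta>' k \<bullet> b) * \<theta> (m x) b)) (at x)"
    by (intro has_derivative_sum has_derivative_mult has_derivative_inner_left \<zeta> Db)
  then have "((\<lambda>y. \<Sum>b\<in>Basis. (\<zeta> y \<bullet> b) * \<theta> (m y) b) has_derivative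
      (\<lambda>k. ?D (\<zeta> x) (m' k) + \<theta> (m x) (\<zeta>' k))) (at x)"
    by (simp add: sum.distrib Dsum linear_as_basis_sum[OF lin[OF U(2)], symmetric])
  then show ?thesis
    by (rule has_derivative_transform_within_open[OF _ V(1,2)]) (rule linear_as_basis_sum[OF lin[OF V(3)], symmetric])
qed

text \<open>The exterior derivative commutes with pullback: the product rule yields second derivatives of
  the map as additional terms, and these cancel by symmetry.\<close>

lemma form_d_pullback:
  fixes \<theta> :: "'v::euclidean_space \<Rightarrow> 'v \<Rightarrow> real" and \<phi> :: "'w::euclidean_space \<Rightarrow> 'v"
  assumes S: "open S" "x \<in> S" and \<phi>: "Ck_on 2 S \<phi>"
    and U: "open U" "\<phi> ` S \<subseteq> U"
    and lin: "\<And>z. z \<in> U \<Longrightarrow> linear (\<theta> z)"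
    and diff: "\<And>w z. z \<in> U \<Longrightarrow> (\<lambda>z. \<theta> z w) differentiable (at z)"
    and \<psi>: "\<And>y w. y \<in> S \<Longrightarrow> \<psi> y w = \<theta> (\<phi> y) (fderiv \<phi> y w)"
  shows "form_d \<psi> x u v = form_d \<theta> (\<phi> x) (fderiv \<phi> x u) (fderiv \<phi> x v)"
proof -
  let ?D = "\<lambda>y. fderiv \<phi> y"
  have \<phi>2: "Ck_on (Suc (Suc 0)) S \<phi>" using \<phi> by (simp only: numeral_2_eq_2)
  have d\<phi>: "(\<phi> has_derivative ?D y) (at y)" if "y \<in> S" for y
    using Ck_on_differentiable[OF \<phi>2 that] .
  have D1: "Ck_on (Suc 0) S (\<lambda>y. ?D y w)" for w
    using \<phi>2 Ck_on_Suc_frechet[OF S(1)] by blast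
  let ?D2 = "\<lambda>w. fderiv (\<lambda>y. ?D y w) x"
  have D2: "((\<lambda>y. ?D y w) has_derivative ?D2 w) (at x)" for w
    using Ck_on_differentiable[OF D1 S(2)] .
  have D2i: "?D2 w w' \<bullet> b = fderiv (\<lambda>y. fderiv (\<lambda>y. \<phi> y \<bullet> b) y w) x w'" for w w' b
  proof -
    have "fderiv (\<lambda>y. \<phi> y \<bullet> b) y w = ?D y w \<bullet> b" if "y \<in> S" for y
      by (rule frechet_derivative_eq[OF has_derivative_inner_left[OF d\<phi>[OF that]]])
    then have "((\<lambda>y. fderiv (\<lambda>y. \<phi> y \<bullet> b) y w) has_derivative (\<lambda>w'. ?D2 w w' \<bullet> b)) (at x)"
      by (intro has_derivative_transform_within_open[OF has_derivative_inner_left[OF D2] S]) simp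
    then show ?thesis by (rule frechet_derivative_eq[symmetric])
  qed
  have sym: "?D2 u v = ?D2 v u"
    unfolding euclidean_eq_iff[of "?D2 u v"] D2i
    using Ck2_symmetric[OF S] Ck_on_linear_left[OF bounded_linear_inner_left \<phi>] by blast
  have "fderiv (\<lambda>y. \<psi> y w) x w' =
      fderiv (\<lambda>z. \<theta> z (?D x w)) (\<phi> x) (?D x w') + \<theta> (\<phi> x) (?D2 w w')" for w w'
  proof -
    have "((\<lambda>y. \<theta> (\<phi> y) (?D y w)) has_derivative
        (\<lambda>k. fderiv (\<lambda>z. \<theta> z (?D x w)) (\<phi> x) (?D x k) + \<theta> (\<phi> x) (?D2 w k))) (at x)"
      by (rule form_eval_derivative[OF U(1) _ lin _ d\<phi>[OF S(2)] D2]) (use S U diff in auto)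
    then have "((\<lambda>y. \<psi> y w) has_derivative
        (\<lambda>k. fderiv (\<lambda>z. \<theta> z (?D x w)) (\<phi> x) (?D x k) + \<theta> (\<phi> x) (?D2 w k))) (at x)"
      by (rule has_derivative_transform_within_open[OF _ S]) (simp add: \<psi>)
    then show ?thesis by (rule frechet_derivative_eq)
  qed
  then show ?thesis
    by (simp add: form_d_def sym)
qed

section \<open>Contact fields tangent to isotropic fibres\<close>

text \<open>The geometric situation in coordinates: the fibres are the translates of the range of the
projection \<open>P\<close>, and the restriction of the 1-form \<open>\<theta>\<close> to each fibre is closed. The bound on \<open>P\<close> keeps
the homotopy below inside the ball.\<close>

locale isotropic_form =
  fixes P :: "'v::euclidean_space \<Rightarrow> 'v" and \<theta> :: "'v \<Rightarrow> 'v \<Rightarrow> real" and z0 :: 'v and r :: real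
  assumes P_linear: "linear P" and P_idem: "P (P v) = P v" and P_norm: "norm (P v) \<le> norm v"
    and r: "0 < r"
    and \<theta>_linear: "z \<in> ball z0 r \<Longrightarrow> linear (\<theta> z)"
    and \<theta>_Ck: "Ck_on 2 (ball z0 r) (\<lambda>z. \<theta> z w)"
    and isotropic: "z \<in> ball z0 r \<Longrightarrow> form_d \<theta> z (P u) (P v) = 0"
begin

sublocale P: bounded_linear P
  using P_linear linear_conv_bounded_linear by blast

abbreviation "\<rho> \<equiv> r / 4"

text \<open>The contraction of a fibre to its point closest to \<open>z0\<close>: at time 1 it is the identity, and from
time 0 to time 1 it moves towards \<open>z\<close> with constant velocity \<open>P (z - z0)\<close>.\<close>

definition slide :: "'v \<times> real \<Rightarrow> 'v" where
  "slide p = fst p + (snd p - 1) *\<^sub>R P (fst p - z0)"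

definition integrand :: "'v \<times> real \<Rightarrow> real" where
  "integrand p = \<theta> (slide p) (P (fst p - z0))"

text \<open>The Poincare primitive of \<open>\<theta>\<close> along the fibres.\<close>

definition W :: "'v \<Rightarrow> real" where
  "W z = integral {0..1} (\<lambda>s. integrand (z, s))"

text \<open>What remains of \<open>\<theta>\<close> when the differential of the primitive is subtracted. It vanishes along the
fibres by \<open>W_derivative\<close> below, so that its nonzero components are the momenta conjugate to the
coordinates that number the fibres. The vector \<open>C\<close> collects them.\<close>

definition c :: "'v \<Rightarrow> 'v \<Rightarrow> real" where
  "c z w = \<theta> z w - fderiv W z w"

definition C :: "'v \<Rightarrow> 'v" where
  "C z = (\<Sum>b\<in>Basis. c z b *\<^sub>R b)"

text \<open>Times slightly outside the unit interval are admitted, since integration by quadrature takes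
place on an open set; for them a point may move away from \<open>z0\<close> by a factor of at most 4.\<close>

lemma slide_in:
  assumes "z \<in> ball z0 \<rho>" "s \<in> {-2<..<2}"
  shows "slide (z, s) \<in> ball z0 r"
proof -
  have "norm (slide (z, s) - z0) \<le> norm (z - z0) + norm ((s - 1) *\<^sub>R P (z - z0))"
    unfolding slide_def fst_conv snd_conv by (metis add_diff_eq diff_add_eq norm_triangle_ineq)
  also have "\<dots> \<le> norm (z - z0) + 3 * norm (z - z0)"
    using assms(2) by (auto intro!: mult_mono P_norm)
  also have "\<dots> < r" using assms(1) by (simp add: dist_norm norm_minus_commute)
  finally show ?thesis by (simp add: dist_norm norm_minus_commute)
qed

lemma small_ball: "ball z0 \<rho> \<subseteq> ball z0 r"
  using r by (intro subset_ball) simp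

lemma slide_Ck: "Ck_on k S slide"
  unfolding slide_def
  by (intro Ck_on_add Ck_on_scaleR Ck_on_diff Ck_on_const Ck_on_linear_left[OF P.bounded_linear_axioms]
      Ck_on_linear bounded_linear_fst bounded_linear_snd)

lemma integrand_Ck: "Ck_on 2 (ball z0 \<rho> \<times> {-2<..<2}) integrand"
proof -
  have op: "open (ball z0 \<rho> \<times> {-2<..<2::real})" by (intro open_Times) auto
  have "Ck_on 2 (ball z0 \<rho> \<times> {-2<..<2}) (\<lambda>p. \<Sum>b\<in>Basis. (P (fst p - z0) \<bullet> b) * \<theta> (slide p) b)"
    by (intro Ck_on_sum Ck_on_mult Ck_on_compose[OF slide_Ck \<theta>_Ck]
        Ck_on_linear_left[OF bounded_linear_inner_left] Ck_on_linear_left[OF P.bounded_linear_axioms]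
        Ck_on_diff Ck_on_const Ck_on_linear bounded_linear_fst)
      (use slide_in in auto)
  then show ?thesis
    by (rule Ck_on_cong[OF op])
      (use slide_in linear_as_basis_sum[OF \<theta>_linear] in \<open>auto simp: integrand_def\<close>)
qed

lemma W_Ck: "Ck_on 2 (ball z0 \<rho>) W"
  unfolding W_def by (rule Ck_on_integral(1)[OF _ _ _ _ integrand_Ck]) auto

text \<open>Along the fibres the form is closed, so that the derivative of the integrand in the direction of
  a fibre is the derivative of \<open>s * \<theta> (slide (z, s)) (P u)\<close> with respect to \<open>s\<close>.\<close>

lemma W_derivative:
  assumes z: "z \<in> ball z0 \<rho>"
  shows "fderiv W z (P u) = \<theta> z (P u)"
proof -
  let ?\<zeta> = "P (z - z0)"
  have Ck: "Ck_on (Suc 1) (ball z0 \<rho> \<times> {-2<..<2}) integrand"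
    using integrand_Ck by (simp only: numeral_2_eq_2 One_nat_def)
  have \<theta>d: "(\<lambda>z. \<theta> z w) differentiable (at y)" if "y \<in> ball z0 r" for w y
    using Ck_on_differentiable[of 1, OF _ that] \<theta>_Ck[of w]
    by (metis Suc_1 differentiable_def)
  have slide_d: "(slide has_derivative (\<lambda>k. fst k + ((snd p - 1) *\<^sub>R P (fst k) + snd k *\<^sub>R P (fst p - z0)))) (at p)" for p
    unfolding slide_def
    by (auto intro!: derivative_eq_intros P.has_derivative)
  have eq: "fderiv integrand (z, s) (P u, 0) =
      s * fderiv (\<lambda>z. \<theta> z (P u)) (slide (z, s)) ?\<zeta> + \<theta> (slide (z, s)) (P u)"
    if s: "s \<in> {-2<..<2}" for s
  proof -
    let ?m = "slide (z, s)"
    note m = slide_in[OF z s]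
    have d2: "((\<lambda>p. P (fst p - z0)) has_derivative (\<lambda>k. P (fst k))) (at (z, s))"
      by (auto intro!: derivative_eq_intros P.has_derivative)
    have "(integrand has_derivative
      (\<lambda>k. fderiv (\<lambda>y. \<theta> y (P (fst (z, s) - z0))) ?m (fst k + ((snd (z, s) - 1) *\<^sub>R P (fst k) + snd k *\<^sub>R P (fst (z, s) - z0)))
        + \<theta> ?m (P (fst k)))) (at (z, s))"
      unfolding integrand_def
      by (rule form_eval_derivative[OF open_ball m _ \<theta>d[OF m] slide_d d2]) (rule \<theta>_linear)
    from frechet_derivative_eq[OF this, of "(P u, 0)"]
    have "fderiv integrand (z, s) (P u, 0) =
       fderiv (\<lambda>z. \<theta> z ?\<zeta>) ?m (P u + (s - 1) *\<^sub>R P u) + \<theta> ?m (P u)"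
      by (simp add: P_idem)
    moreover have "P u + (s - 1) *\<^sub>R P u = s *\<^sub>R P u" by (simp add: algebra_simps)
    moreover have "fderiv (\<lambda>z. \<theta> z ?\<zeta>) ?m (s *\<^sub>R P u) = s * fderiv (\<lambda>z. \<theta> z ?\<zeta>) ?m (P u)"
      using linear_frechet_derivative[OF \<theta>d[OF m]] by (simp add: linear_scale)
    moreover have "fderiv (\<lambda>z. \<theta> z ?\<zeta>) ?m (P u) = fderiv (\<lambda>z. \<theta> z (P u)) ?m ?\<zeta>"
      using isotropic[OF m, of u "z - z0"] by (simp add: form_d_def)
    ultimately show ?thesis by simp
  qed
  have deriv: "((\<lambda>s. s * \<theta> (slide (z, s)) (P u)) has_vector_derivative
      s * fderiv (\<lambda>z. \<theta> z (P u)) (slide (z, s)) ?\<zeta> + \<theta> (slide (z, s)) (P u)) (at s within {0..1})"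
    if s: "s \<in> {-2<..<2}" for s
  proof -
    let ?m = "slide (z, s)"
    note m = slide_in[OF z s]
    have "((\<lambda>s. slide (z, s)) has_derivative (\<lambda>k. k *\<^sub>R ?\<zeta>)) (at s)"
      unfolding slide_def by (auto intro!: derivative_eq_intros)
    from has_derivative_compose[OF this, of "\<lambda>z. \<theta> z (P u)"] \<theta>d[OF m]
    have "((\<lambda>s. \<theta> (slide (z, s)) (P u)) has_derivative
      (\<lambda>k. fderiv (\<lambda>z. \<theta> z (P u)) ?m (k *\<^sub>R ?\<zeta>))) (at s)"
      by (simp add: frechet_derivative_works)
    then have "((\<lambda>s. \<theta> (slide (z, s)) (P u)) has_real_derivative
        fderiv (\<lambda>z. \<theta> z (P u)) ?m ?\<zeta>) (at s)"
      using linear_frechet_derivative[OF \<theta>d[OF m]]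
      by (simp add: linear_scale has_field_derivative_def mult_commute_abs)
    from DERIV_mult[OF DERIV_ident this]
    have "((\<lambda>s. s * \<theta> (slide (z, s)) (P u)) has_real_derivative
      s * fderiv (\<lambda>z. \<theta> z (P u)) ?m ?\<zeta> + \<theta> ?m (P u)) (at s)"
      by (simp add: add.commute mult.commute)
    then show ?thesis
      by (simp add: has_real_derivative_iff_has_vector_derivative has_vector_derivative_at_within)
  qed
  have "((\<lambda>s. fderiv integrand (z, s) (P u, 0)) has_integral
     (1 * \<theta> (slide (z, 1)) (P u) - 0 * \<theta> (slide (z, 0)) (P u))) {0..1}"
  proof (rule has_integral_eq[OF _ fundamental_theorem_of_calculus])
    show "((\<lambda>s. s * \<theta> (slide (z, s)) (P u)) has_vector_derivative
      s * fderiv (\<lambda>z. \<theta> z (P u)) (slide (z, s)) ?\<zeta> + \<theta> (slide (z, s)) (P u)) (at s within {0..1})"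
      if "s \<in> {0..1}" for s by (rule deriv) (use that in auto)
  qed (use eq in auto)
  then have "integral {0..1} (\<lambda>s. fderiv integrand (z, s) (P u, 0)) = \<theta> z (P u)"
    by (simp add: integral_unique slide_def)
  moreover have "fderiv W z = (\<lambda>u. integral {0..1} (\<lambda>s. fderiv integrand (z, s) (u, 0)))"
    unfolding W_def by (rule Ck_on_integral(2)[OF _ _ _ _ Ck z]) auto
  ultimately show ?thesis by simp
qed

lemma W_frechet_Ck: "Ck_on 1 (ball z0 \<rho>) (\<lambda>z. fderiv W z w)"
  using W_Ck Ck_on_Suc_frechet[OF open_ball, of 1 z0 \<rho> W] unfolding Suc_1 by blast

lemma W_has_derivative: "z \<in> ball z0 \<rho> \<Longrightarrow> (W has_derivative fderiv W z) (at z)"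
  by (metis W_Ck Suc_1 Ck_on_differentiable)

lemma c_Ck: "Ck_on 1 (ball z0 \<rho>) (\<lambda>z. c z w)"
  unfolding c_def
  by (intro Ck_on_diff W_frechet_Ck Ck_on_subset[OF _ small_ball] Ck_on_mono[OF \<theta>_Ck]) simp

lemma c_linear: "z \<in> ball z0 \<rho> \<Longrightarrow> linear (c z)"
  unfolding c_def
  using small_ball W_has_derivative
  by (intro linear_compose_sub \<theta>_linear) (auto intro: has_derivative_linear)

lemma C_inner: "z \<in> ball z0 \<rho> \<Longrightarrow> C z \<bullet> w = c z w"
  using linear_as_basis_sum[OF c_linear, of z w]
  by (simp add: C_def inner_sum_left inner_commute[of w] mult.commute)

lemma C_Ck: "Ck_on 1 (ball z0 \<rho>) C"
  unfolding C_def by (intro Ck_on_sum Ck_on_scaleR c_Ck Ck_on_const)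

text \<open>Subtracting a differential does not change the exterior derivative; since \<open>c\<close> has no components
  along the fibres, only one of the two terms of its exterior derivative is left.\<close>

lemma c_derivative:
  assumes z: "z \<in> ball z0 \<rho>"
  shows "fderiv (\<lambda>z. c z w) z (P u) = form_d \<theta> z (P u) w"
proof -
  let ?W = "\<lambda>z. fderiv W z"
  have \<theta>d: "((\<lambda>z. \<theta> z w) has_derivative fderiv (\<lambda>z. \<theta> z w) z) (at z)" for w
    using \<theta>_Ck[of w] small_ball z by (metis Suc_1 Ck_on_differentiable subsetD)
  have Wd: "((\<lambda>z. ?W z w) has_derivative fderiv (\<lambda>z. ?W z w) z) (at z)" for w
    using W_frechet_Ck z by (metis One_nat_def Ck_on_differentiable)
  have "fderiv (\<lambda>z. c z w) z (P u) =
    fderiv (\<lambda>z. \<theta> z w) z (P u) - fderiv (\<lambda>z. ?W z w) z (P u)"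
    unfolding c_def by (rule frechet_derivative_eq[OF has_derivative_diff[OF \<theta>d[of w] Wd[of w]]])
  also have "fderiv (\<lambda>z. ?W z w) z (P u) = fderiv (\<lambda>z. ?W z (P u)) z w"
    using Ck2_symmetric[OF open_ball z W_Ck] .
  also have "fderiv (\<lambda>z. ?W z (P u)) z w = fderiv (\<lambda>z. \<theta> z (P u)) z w"
  proof -
    have "((\<lambda>z. ?W z (P u)) has_derivative fderiv (\<lambda>z. \<theta> z (P u)) z) (at z)"
      by (rule has_derivative_transform_within_open[OF \<theta>d open_ball z]) (simp add: W_derivative)
    then show ?thesis by (rule frechet_derivative_eq)
  qed
  finally show ?thesis by (simp add: form_d_def)
qed

lemma quad_P_inner:
  fixes e :: "nat \<Rightarrow> 'v" and e' :: "nat \<Rightarrow> 'w::euclidean_space"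
  assumes "basis_enum e" "basis_enum e'" "open S" "\<And>j. j < DIM('v) \<Longrightarrow> quad D e' S (\<lambda>z. g z \<bullet> e j)"
  shows "quad D e' S (\<lambda>z. P (g z) \<bullet> b)"
proof -
  have "linear (\<lambda>v. P v \<bullet> b)"
    by (simp add: linear_iff P.add P.scaleR inner_add_left)
  from quad_linear[OF assms(2,3) this assms(4,1)] show ?thesis .
qed

text \<open>The integral is computed by one quadrature in the homotopy parameter and then evaluated at 1.\<close>

lemma quad_W:
  assumes e: "basis_enum e" and \<theta>: "\<And>i. i < DIM('v) \<Longrightarrow> quad D e (ball z0 r) (\<lambda>z. \<theta> z (e i))"
  shows "quad D e (ball z0 \<rho>) W"
proof -
  let ?B = "ball z0 \<rho>" and ?I = "{-1<..<2::real}" and ?e = "ext_enum e"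
  note ee = basis_enum_ext[OF e]
  have op: "open (?B \<times> ?I)" by (intro open_Times) auto
  have diff: "quad D ?e (?B \<times> ?I) (\<lambda>p. (fst p - z0) \<bullet> e i)" if "i < DIM('v)" for i
    using quad_diff[OF ee op quad_fst[OF e op that] quad_const[OF ee op, of D "z0 \<bullet> e i"]]
    by (simp add: inner_diff_left)
  have Pd: "quad D ?e (?B \<times> ?I) (\<lambda>p. P (fst p - z0) \<bullet> b)" for b
    by (rule quad_P_inner[OF e ee op diff])
  have slide: "quad D ?e (?B \<times> ?I) (\<lambda>p. slide p \<bullet> e i)" if i: "i < DIM('v)" for i
    using quad_add[OF quad_fst[OF e op i] quad_mult[OF quad_diff[OF ee op quad_snd[OF e op] quad_const[OF ee op, of D 1]] Pd[of "e i"]]]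
    by (simp add: slide_def inner_add_left)
  have "quad D ?e (?B \<times> ?I) (\<lambda>p. \<Sum>i<DIM('v). (P (fst p - z0) \<bullet> e i) * \<theta> (slide p) (e i))"
    by (intro quad_sum[OF ee op] quad_mult Pd quad_compose[OF ee e \<theta> op slide])
      (use slide_in in auto)
  then have q: "quad D ?e (?B \<times> ?I) integrand"
  proof (rule quad_restrict[OF ee _ op order_refl])
    fix p assume "p \<in> ?B \<times> ?I"
    then have "linear (\<theta> (slide p))"
      by (cases p) (use \<theta>_linear slide_in in auto)
    from linear_as_basis_sum[OF this, of "P (fst p - z0)"]
    show "integrand p = (\<Sum>i<DIM('v). (P (fst p - z0) \<bullet> e i) * \<theta> (slide p) (e i))"
      using basis_enum_sum[OF e, of "\<lambda>b. (P (fst p - z0) \<bullet> b) * \<theta> (slide p) b"]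
      by (simp add: integrand_def)
  qed
  \<comment> \<open>The lower bound \<open>-1\<close> makes a single formula valid for parameters of either sign; subtracting
    the second integral normalises the primitive at 0.\<close>
  define F where "F p = integral {-1..snd p} (\<lambda>s. integrand (fst p, s)) - integral {-1..0} (\<lambda>s. integrand (fst p, s))" for p
  have cont: "continuous_on {-2<..<2} (\<lambda>s. integrand (z, s))" if "z \<in> ?B" for z
    using that by (intro continuous_on_compose2[OF Ck_on_continuous[OF integrand_Ck]] continuous_intros) auto
  have "quad D ?e (?B \<times> ?I) F"
  proof (rule quad_integrate[OF e _ _ q])
    fix z s assume z: "z \<in> ?B" and s: "s \<in> ?I"
    have "((\<lambda>s. integral {-1..s} (\<lambda>s. integrand (z, s))) has_real_derivative integrand (z, s)) (at s within {-1..(s+2)/2})"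
      by (rule integral_has_real_derivative) (use s in \<open>auto intro!: continuous_on_subset[OF cont[OF z]]\<close>)
    then have "((\<lambda>s. integral {-1..s} (\<lambda>s. integrand (z, s))) has_real_derivative integrand (z, s)) (at s)"
      using s at_within_Icc_at[of "-1" s "(s+2)/2"] by auto
    from DERIV_diff[OF this DERIV_const]
    show "((\<lambda>s. F (z, s)) has_real_derivative integrand (z, s)) (at s)"
      by (simp add: F_def)
  qed (auto simp: F_def)
  then have "quad D e ?B (\<lambda>z. F (z, 1))"
  proof (rule quad_compose[OF e ee _ open_ball])
    show "quad D e ?B (\<lambda>z. (z, 1) \<bullet> ?e j)" for j
      by (intro quad_Pair quad_inner quad_const e open_ball)
  qed auto
  then show ?thesis
  proof (rule quad_restrict[OF e _ open_ball order_refl])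
    fix z assume z: "z \<in> ?B"
    have "(\<lambda>s. integrand (z, s)) integrable_on {-1..1}"
      by (intro integrable_continuous_interval continuous_on_subset[OF cont[OF z]]) auto
    from Henstock_Kurzweil_Integration.integral_combine[OF _ _ this, of 0]
    show "W z = F (z, 1)" by (simp add: F_def W_def)
  qed
qed

lemma quad_C:
  assumes e: "basis_enum e" and \<theta>: "\<And>i. i < DIM('v) \<Longrightarrow> quad D e (ball z0 r) (\<lambda>z. \<theta> z (e i))"
    and i: "i < DIM('v)"
  shows "quad D e (ball z0 \<rho>) (\<lambda>z. C z \<bullet> e i)"
proof -
  have "quad D e (ball z0 \<rho>) (\<lambda>z. c z (e i))"
    unfolding c_def
    by (intro quad_diff[OF e open_ball] quad_restrict[OF e \<theta>[OF i] open_ball small_ball]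
        quad_derivative[OF e i quad_W[OF e \<theta>]] W_has_derivative) auto
  then show ?thesis
    by (rule quad_restrict[OF e _ open_ball order_refl]) (simp add: C_inner)
qed

end

text \<open>In addition, \<open>Y\<close> is tangent to the fibres and satisfies the equations of the contact field of \<open>h\<close>
  for a Hamiltonian that is constant along the Reeb field, and \<open>\<theta>\<close> is nondegenerate like a contact
  form.\<close>

locale isotropic_contact_form = isotropic_form +
  fixes h :: "'a::euclidean_space \<Rightarrow> real" and Y :: "'a \<Rightarrow> 'a"
  assumes h_Ck: "Ck_on 2 (ball z0 r) h"
    and Y_tangent: "z \<in> ball z0 r \<Longrightarrow> P (Y z) = Y z"
    and contact: "z \<in> ball z0 r \<Longrightarrow> form_d \<theta> z (Y z) v = - fderiv h z v"
    and \<theta>_Y: "z \<in> ball z0 r \<Longrightarrow> \<theta> z (Y z) = h z"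
    and nondegenerate: "\<lbrakk>z \<in> ball z0 r; \<And>v. form_d \<theta> z u v = 0; \<theta> z u = 0\<rbrakk> \<Longrightarrow> u = 0"
begin

definition grad :: "'a \<Rightarrow> 'a" where
  "grad z = (\<Sum>b\<in>Basis. fderiv h z b *\<^sub>R b)"

lemma h_has_derivative: "z \<in> ball z0 r \<Longrightarrow> (h has_derivative fderiv h z) (at z)"
  by (metis h_Ck Suc_1 Ck_on_differentiable)

lemma grad_inner: "z \<in> ball z0 r \<Longrightarrow> grad z \<bullet> w = fderiv h z w"
  using linear_as_basis_sum[OF has_derivative_linear[OF h_has_derivative], of z w]
  by (simp add: grad_def inner_sum_left inner_commute[of w] mult.commute)

text \<open>The derivative of \<open>h\<close> in a fibre direction is minus the exterior derivative of \<open>\<theta>\<close> on that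
direction and \<open>Y\<close>, both of which are tangent to an isotropic fibre. Hence \<open>h\<close> and its gradient
are functions of the fibre.\<close>

lemma h_fibre_derivative:
  assumes z: "z \<in> ball z0 r"
  shows "fderiv h z (P u) = 0"
  using contact[OF z, of "P u"] isotropic[OF z, of "Y z" u] Y_tangent[OF z] by simp

lemma h_fibre:
  assumes z: "z \<in> ball z0 r" "z' \<in> ball z0 r" and d: "z' - z = P d"
  shows "h z' = h z"
proof -
  have in_ball: "z + s *\<^sub>R P d \<in> ball z0 r" if "0 \<le> s" "s \<le> 1" for s
  proof -
    have "(1 - s) *\<^sub>R z + s *\<^sub>R z' \<in> ball z0 r"
      using convexD_alt[OF convex_ball] z that by blast
    moreover have "(1 - s) *\<^sub>R z + s *\<^sub>R z' = z + s *\<^sub>R P d"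
      unfolding d[symmetric] by (simp add: algebra_simps)
    ultimately show ?thesis by simp
  qed
  have "\<exists>s>0::real. s < 1 \<and> h (z + 1 *\<^sub>R P d) - h (z + 0 *\<^sub>R P d) = (1 - 0) * 0"
  proof (rule MVT2[where f = "\<lambda>s. h (z + s *\<^sub>R P d)" and f' = "\<lambda>s. 0"])
    fix s :: real assume s: "0 \<le> s" "s \<le> 1"
    have "((\<lambda>s. z + s *\<^sub>R P d) has_derivative (\<lambda>k. k *\<^sub>R P d)) (at s)"
      by (auto intro!: derivative_eq_intros)
    from has_derivative_compose[OF this h_has_derivative[OF in_ball[OF s]]]
    have "((\<lambda>s. h (z + s *\<^sub>R P d)) has_derivative (\<lambda>k. fderiv h (z + s *\<^sub>R P d) (k *\<^sub>R P d))) (at s)" .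
    then show "((\<lambda>s. h (z + s *\<^sub>R P d)) has_real_derivative 0) (at s)"
      using h_fibre_derivative[OF in_ball[OF s]]
      by (simp add: has_field_derivative_def P.scaleR[symmetric] lambda_zero)
  qed simp
  moreover have "z + P d = z'" using d by (simp add: algebra_simps)
  ultimately show ?thesis by auto
qed

text \<open>On the same fibre \<open>h\<close> is not only constant at the two points: translation along the fibre carries
\<open>h\<close> near one point to \<open>h\<close> near the other, so that all derivatives agree.\<close>

lemma grad_fibre:
  assumes z: "z \<in> ball z0 r" "z' \<in> ball z0 r" and d: "z' - z = P d"
  shows "grad z' = grad z"
proof -
  define V where "V = (\<lambda>w. w + P d) -` ball z0 r \<inter> ball z0 r"
  have "open V" unfolding V_def by (intro open_Int open_vimage continuous_intros) auto
  have zd: "z + P d = z'" using d by (simp add: algebra_simps)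
  then have "z \<in> V" using z by (simp add: V_def)
  have "((\<lambda>w. w + P d) has_derivative (\<lambda>k. k)) (at z)"
    by (auto intro!: derivative_eq_intros)
  from has_derivative_compose[OF this, of h "fderiv h z'"] h_has_derivative[OF z(2)] zd
  have "((\<lambda>w. h (w + P d)) has_derivative fderiv h z') (at z)" by simp
  then have "(h has_derivative fderiv h z') (at z)"
    by (rule has_derivative_transform_within_open[OF _ \<open>open V\<close> \<open>z \<in> V\<close>])
      (auto simp: V_def intro!: h_fibre[where d = d])
  from frechet_derivative_eq[OF this] show ?thesis by (simp add: grad_def)
qed

lemma grad_Ck: "Ck_on 1 (ball z0 r) grad"
  unfolding grad_def
  using h_Ck Ck_on_Suc_frechet[OF open_ball, of 1 z0 r h] unfolding Suc_1
  by (intro Ck_on_sum Ck_on_scaleR Ck_on_const) blast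

lemma C_has_derivative: "z \<in> ball z0 \<rho> \<Longrightarrow> (C has_derivative fderiv C z) (at z)"
  by (metis C_Ck One_nat_def Ck_on_differentiable)

lemma C_fibre_derivative:
  assumes z: "z \<in> ball z0 \<rho>"
  shows "fderiv C z (P u) \<bullet> w = form_d \<theta> z (P u) w"
proof -
  have "((\<lambda>z. c z w) has_derivative (\<lambda>v. fderiv C z v \<bullet> w)) (at z)"
    by (rule has_derivative_transform_within_open[OF has_derivative_inner_left[OF C_has_derivative[OF z]] open_ball z])
      (rule C_inner)
  from frechet_derivative_eq[OF this, of "P u"] c_derivative[OF z] show ?thesis by simp
qed

text \<open>The flow changes \<open>C\<close> and \<open>W\<close> at a rate that depends on the fibre only.\<close>

lemma C_flow:
  assumes z: "z \<in> ball z0 \<rho>"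
  shows "fderiv C z (Y z) = - grad z"
proof -
  have z': "z \<in> ball z0 r" using z small_ball by blast
  have "fderiv C z (Y z) \<bullet> w = - grad z \<bullet> w" for w
    using C_fibre_derivative[OF z, of "Y z" w] contact[OF z', of w] Y_tangent[OF z'] grad_inner[OF z']
    by simp
  then show ?thesis by (metis euclidean_eqI)
qed

lemma W_flow:
  assumes z: "z \<in> ball z0 \<rho>"
  shows "fderiv W z (Y z) = h z"
proof -
  have z': "z \<in> ball z0 r" using z small_ball by blast
  show ?thesis using W_derivative[OF z, of "Y z"] Y_tangent[OF z'] \<theta>_Y[OF z'] by simp
qed

text \<open>A vector killed by all three differentials is tangent to a fibre, is in the kernel of the
exterior derivative of \<open>\<theta>\<close> because the differential of \<open>C\<close> on fibre directions is that exterior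
derivative, and is in the kernel of \<open>\<theta>\<close> because \<open>W\<close> is a primitive. The momenta \<open>C\<close> alone would not
suffice when the Reeb field is tangent to the fibre.\<close>

lemma immersion:
  assumes z: "z \<in> ball z0 \<rho>"
    and v: "v - P v = 0" "fderiv C z v = 0" "fderiv W z v = 0"
  shows "v = 0"
proof (rule nondegenerate)
  show "z \<in> ball z0 r" using z small_ball by blast
  have Pv: "P v = v" using v(1) by simp
  show "form_d \<theta> z v w = 0" for w using C_fibre_derivative[OF z, of v w] Pv v(2) by simp
  show "\<theta> z v = 0" using W_derivative[OF z, of v] Pv v(3) by simp
qed

text \<open>The immersion \<open>(z - P z, C z, W z)\<close> has more components than there are variables. Composing it
  with a linear left inverse of its derivative at \<open>z0\<close>, modified so as to keep the first component,
  gives a map with invertible derivative.\<close>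

lemma straightening:
  obtains B where "linear B" "inj (\<lambda>v. v - P v + P (B (fderiv C z0 v, fderiv W z0 v)))"
proof -
  have z0: "z0 \<in> ball z0 \<rho>" using r by simp
  let ?A = "\<lambda>v. (v - P v, (fderiv C z0 v, fderiv W z0 v))"
  have lC: "linear (fderiv C z0)"
    using C_has_derivative[OF z0] has_derivative_linear by blast
  have lW: "linear (fderiv W z0)"
    using W_has_derivative[OF z0] has_derivative_linear by blast
  have lA: "linear ?A"
    using lC lW by (simp add: linear_iff P.add P.scaleR algebra_simps)
  have "inj ?A"
    unfolding linear_injective_0[OF lA] using immersion[OF z0] by (simp add: zero_prod_def)
  with lA obtain B' where B': "linear B'" "B' \<circ> ?A = id"
    using linear_injective_left_inverse by blast
  let ?B = "\<lambda>p. B' (0, p)"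
  have lB: "linear ?B"
    using B'(1) unfolding linear_iff
    by (metis (no_types, lifting) add_Pair add_0 scaleR_Pair scaleR_zero_right)
  let ?G = "\<lambda>v. v - P v + P (?B (fderiv C z0 v, fderiv W z0 v))"
  have lG: "linear ?G"
  proof -
    have "linear (\<lambda>v. (fderiv C z0 v, fderiv W z0 v))"
      using lC lW by (simp add: linear_iff)
    from linear_compose[OF linear_compose[OF this lB] P_linear] show ?thesis
      by (intro linear_compose_add linear_compose_sub linear_ident P_linear) (simp add: o_def)
  qed
  have "v = 0" if v: "?G v = 0" for v
  proof -
    have "P (?G v) = P (?B (fderiv C z0 v, fderiv W z0 v))"
      by (simp add: P.add P.diff P_idem)
    then have 1: "P (?B (fderiv C z0 v, fderiv W z0 v)) = 0"
      using v by (simp add: P.zero)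
    then have 2: "v - P v = 0" using v by simp
    have "B' (?A v) = v" using fun_cong[OF B'(2), of v] by (simp only: o_apply id_apply)
    then have "?B (fderiv C z0 v, fderiv W z0 v) = v"
      by (simp only: 2)
    then show ?thesis using 1 2 by simp
  qed
  then have "inj ?G" using linear_injective_0[OF lG] by blast
  then show ?thesis using that[OF lB] by blast
qed

text \<open>In the coordinates \<open>G\<close> the flow is translation by \<open>t\<close> times a vector \<open>\<kappa>\<close> that depends on the fibre
only. So the integral curves are \<open>t \<mapsto> G\<^sup>-\<^sup>1 (G z + t \<kappa>)\<close>. This shows that they exist on a
common time interval, and it presents them as the solution of known equations.\<close>

lemma local_flow:
  assumes e: "basis_enum e" and \<theta>q: "\<And>i. i < DIM('a) \<Longrightarrow> quad D e (ball z0 r) (\<lambda>z. \<theta> z (e i))"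
    and hq: "quad D e (ball z0 r) h"
  obtains Q \<epsilon> \<gamma> where "open Q" "z0 \<in> Q" "Q \<subseteq> ball z0 r" "0 < \<epsilon>"
    "continuous_on (Q \<times> {-\<epsilon><..<\<epsilon>}) \<gamma>" "\<gamma> ` (Q \<times> {-\<epsilon><..<\<epsilon>}) \<subseteq> ball z0 r"
    "\<And>z. z \<in> Q \<Longrightarrow> \<gamma> (z, 0) = z"
    "\<And>z t. z \<in> Q \<Longrightarrow> t \<in> {-\<epsilon><..<\<epsilon>} \<Longrightarrow>
      ((\<lambda>t. \<gamma> (z, t)) has_vector_derivative Y (\<gamma> (z, t))) (at t)"
    "\<And>i. i < DIM('a) \<Longrightarrow> quad D (ext_enum e) (Q \<times> {-\<epsilon><..<\<epsilon>}) (\<lambda>p. \<gamma> p \<bullet> e i)"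
proof -
  obtain B where B: "linear B"
    "inj (\<lambda>v. v - P v + P (B (fderiv C z0 v, fderiv W z0 v)))"
    by (rule straightening)
  interpret B: bounded_linear B using B(1) linear_conv_bounded_linear by blast
  define G where "G z = z - P z + P (B (C z, W z))" for z
  define G' where "G' z v = v - P v + P (B (fderiv C z v, fderiv W z v))" for z v
  define \<kappa> where "\<kappa> z = P (B (- grad z, h z))" for z
  let ?U = "ball z0 \<rho>"
  have z0: "z0 \<in> ?U" using r by simp
  have G_der: "(G has_derivative G' z) (at z)" if "z \<in> ?U" for z
    unfolding G_def G'_def
    by (intro has_derivative_add has_derivative_diff has_derivative_ident P.has_derivative B.has_derivative
        has_derivative_Pair C_has_derivative W_has_derivative that)
  have bl: "bounded_linear (G' z)" if "z \<in> ?U" for z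
    using G_der[OF that] has_derivative_bounded_linear by blast
  define G'' where "G'' z = Blinfun (G' z)" for z
  have G'': "blinfun_apply (G'' z) = G' z" if "z \<in> ?U" for z
    using bounded_linear_Blinfun_apply[OF bl[OF that]] by (simp add: G''_def)
  have cont: "continuous_on ?U (\<lambda>z. G' z v)" for v
  proof -
    have "continuous_on ?U (\<lambda>z. fderiv C z v)"
      using C_Ck Ck_on_Suc_frechet[OF open_ball, of 0 z0 \<rho> C] by (simp del: Ck_on.simps(2))
    moreover have "continuous_on ?U (\<lambda>z. fderiv W z v)"
      using W_frechet_Ck Ck_on_continuous by blast
    ultimately show ?thesis
      unfolding G'_def by (intro continuous_intros P.continuous_on B.continuous_on)
  qed
  have inj0: "inj (G' z0)" using B(2) unfolding G'_def .
  have "linear (G' z0)" using bl[OF z0] bounded_linear.linear by blast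
  from linear_injective_left_inverse[OF this inj0] obtain g0 where g0: "linear g0" "g0 \<circ> G' z0 = id" by blast
  have inv0: "Blinfun g0 o\<^sub>L G'' z0 = id_blinfun"
    using g0 G''[OF z0] linear_conv_bounded_linear[of g0]
    by (intro blinfun_eqI) (simp add: bounded_linear_Blinfun_apply fun_eq_iff)
  have contG'': "continuous_on ?U G''"
    by (rule continuous_on_blinfun_componentwise) (rule continuous_on_eq[OF cont], simp add: G'')
  have derG'': "\<And>x. x \<in> ?U \<Longrightarrow> (G has_derivative blinfun_apply (G'' x)) (at x)"
    using G_der G'' by simp
  obtain U' V g g' where inv: "open U'" "U' \<subseteq> ?U" "z0 \<in> U'" "open V" "G z0 \<in> V" "homeomorphism U' V G g"
    "\<And>y. y \<in> V \<Longrightarrow> (g has_derivative (g' y)) (at y)"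
    "\<And>y. y \<in> V \<Longrightarrow> g' y = inv (blinfun_apply (G'' (g y)))"
    "\<And>y. y \<in> V \<Longrightarrow> bij (blinfun_apply (G'' (g y)))"
    using inverse_function_theorem[OF open_ball derG'' contG'' z0 inv0] by metis
  have gV: "g y \<in> U'" "G (g y) = y" if "y \<in> V" for y
    using inv(6) that unfolding homeomorphism_def by auto
  have Gg: "g (G z) = z" "G z \<in> V" if "z \<in> U'" for z
    using inv(6) that unfolding homeomorphism_def by auto
  have G'_bij: "bij (G' z)" if "z \<in> U'" for z
    using inv(9)[OF Gg(2)[OF that]] Gg(1)[OF that] G'' inv(2) that by auto
  \<comment> \<open>In the coordinates \<open>G\<close> the field is constant along each of its integral curves.\<close>
  have GY: "G' z (Y z) = \<kappa> z" if "z \<in> ?U" for z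
  proof -
    have "Y z - P (Y z) = 0" using Y_tangent[of z] that small_ball by auto
    then show ?thesis using C_flow[OF that] W_flow[OF that] by (simp add: G'_def \<kappa>_def)
  qed
  have \<kappa>_fibre: "\<kappa> z' = \<kappa> z" if "z \<in> ball z0 r" "z' \<in> ball z0 r" "z - P z = z' - P z'" for z z'
  proof -
    have "z' - z = P (z' - z)" using that(3) by (simp add: P.diff algebra_simps)
    then show ?thesis using h_fibre[of z z'] grad_fibre[of z z'] that(1,2) unfolding \<kappa>_def by metis
  qed
  have \<kappa>_cont: "continuous_on (ball z0 r) \<kappa>"
    unfolding \<kappa>_def
    by (intro P.continuous_on B.continuous_on continuous_intros Ck_on_continuous[OF grad_Ck] Ck_on_continuous[OF h_Ck])
  have G_cont: "continuous_on ?U G"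
    using G_der has_derivative_continuous continuous_at_imp_continuous_on by blast
  define k where "k p = G (fst p) + snd p *\<^sub>R \<kappa> (fst p)" for p
  have k_cont: "continuous_on (U' \<times> UNIV) k"
    unfolding k_def using inv(2) small_ball
    by (intro continuous_intros continuous_on_compose2[OF G_cont] continuous_on_compose2[OF \<kappa>_cont]) auto
  have "open (U' \<times> (UNIV :: real set))" using inv(1) by (intro open_Times) auto
  with k_cont inv(4) have opk: "open (k -` V \<inter> U' \<times> UNIV)"
    by (simp add: continuous_on_open_vimage)
  have "(z0, 0) \<in> k -` V \<inter> U' \<times> UNIV"
    using inv(3,5) by (simp add: k_def)
  from open_prod_elim[OF opk this]
  obtain Q T where QT: "open Q" "open T" "z0 \<in> Q" "0 \<in> T" "Q \<times> T \<subseteq> k -` V \<inter> U' \<times> UNIV"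
    by (metis mem_Sigma_iff)
  obtain \<epsilon> where \<epsilon>: "0 < \<epsilon>" "ball 0 \<epsilon> \<subseteq> T" using QT open_contains_ball by blast
  let ?I = "{-\<epsilon><..<\<epsilon>}"
  have I: "?I \<subseteq> T" using \<epsilon>(2) by (auto simp: subset_iff dist_real_def)
  have QI: "z \<in> U'" "k (z, t) \<in> V" if "z \<in> Q" "t \<in> ?I" for z t
  proof -
    have "(z, t) \<in> k -` V \<inter> U' \<times> UNIV" using QT(5) I that by blast
    then show "z \<in> U'" "k (z, t) \<in> V" by auto
  qed
  have QU: "Q \<subseteq> U'" using QI(1) \<epsilon>(1) by (metis greaterThanLessThan_iff neg_less_0_iff_less subsetI)
  have op: "open (Q \<times> ?I)" using QT by (intro open_Times) auto
  define \<gamma> where "\<gamma> p = g (k p)" for p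
  have \<gamma>U: "\<gamma> (z, t) \<in> U'" "G (\<gamma> (z, t)) = k (z, t)" if "z \<in> Q" "t \<in> ?I" for z t
    using gV[OF QI(2)[OF that]] by (auto simp: \<gamma>_def)
  have \<gamma>_cont: "continuous_on (Q \<times> ?I) \<gamma>"
  proof -
    have "continuous_on V g" using inv(6) by (simp add: homeomorphism_def)
    then show ?thesis
      unfolding \<gamma>_def
      by (rule continuous_on_compose2) (use QI QU in \<open>auto intro!: continuous_on_subset[OF k_cont]\<close>)
  qed
  show ?thesis
  proof (rule that[OF QT(1,3) _ \<epsilon>(1) \<gamma>_cont])
    show "Q \<subseteq> ball z0 r" using QU inv(2) small_ball by blast
    show "\<gamma> ` (Q \<times> ?I) \<subseteq> ball z0 r"
    proof
      fix y assume "y \<in> \<gamma> ` (Q \<times> ?I)"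
      then have "y \<in> U'" using \<gamma>U(1) by blast
      then show "y \<in> ball z0 r" using inv(2) small_ball by blast
    qed
    show "\<gamma> (z, 0) = z" if "z \<in> Q" for z
      using Gg(1) QU that by (auto simp: \<gamma>_def k_def)
    show "((\<lambda>t. \<gamma> (z, t)) has_vector_derivative Y (\<gamma> (z, t))) (at t)" if zt: "z \<in> Q" "t \<in> ?I" for z t
    proof -
      let ?y = "\<gamma> (z, t)"
      have y: "?y \<in> U'" "G ?y = k (z, t)" using \<gamma>U[OF zt] by auto
      have yU: "?y \<in> ?U" "z \<in> ?U" using y inv(2) QU zt by auto
      \<comment> \<open>The curve stays in its fibre, so that \<open>\<kappa>\<close> has the same value all along it.\<close>
      have Pk: "P (\<kappa> z) = \<kappa> z" by (simp add: \<kappa>_def P_idem)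
      have PG: "G x - P (G x) = x - P x" for x
        by (simp add: G_def P.add P.diff P_idem)
      have "?y - P ?y = k (z, t) - P (k (z, t))" using PG[of ?y] y(2) by simp
      also have "\<dots> = G z - P (G z)" by (simp add: k_def P.add P.scaleR Pk)
      finally have "z - P z = ?y - P ?y" using PG[of z] by simp
      then have \<kappa>: "\<kappa> ?y = \<kappa> z" using \<kappa>_fibre[of z ?y] yU small_ball by blast
      have "((\<lambda>t. k (z, t)) has_derivative (\<lambda>s. s *\<^sub>R \<kappa> z)) (at t)"
        unfolding k_def by (auto intro!: derivative_eq_intros)
      from has_derivative_compose[OF this inv(7)[OF QI(2)[OF zt]]]
      have "((\<lambda>t. \<gamma> (z, t)) has_derivative (\<lambda>s. g' (k (z, t)) (s *\<^sub>R \<kappa> z))) (at t)"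
        unfolding \<gamma>_def .
      moreover have "g' (k (z, t)) (s *\<^sub>R \<kappa> z) = s *\<^sub>R Y ?y" for s
      proof -
        have "g' (k (z, t)) = inv (G' ?y)"
          using inv(8)[OF QI(2)[OF zt]] G''[OF yU(1)] by (simp add: \<gamma>_def)
        moreover have "s *\<^sub>R \<kappa> z = G' ?y (s *\<^sub>R Y ?y)"
          using GY[OF yU(1)] \<kappa> linear_scale[OF bounded_linear.linear[OF bl[OF yU(1)]]] by simp
        ultimately show ?thesis
          using G'_bij[OF y(1)] by (simp add: bij_is_inj)
      qed
      ultimately show ?thesis by (simp add: has_vector_derivative_def)
    qed
    show "quad D (ext_enum e) (Q \<times> ?I) (\<lambda>p. \<gamma> p \<bullet> e i)" if i: "i < DIM('a)" for i
    proof -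
      note ee = basis_enum_ext[OF e]
      have lin: "quad D e S (\<lambda>z. P (B (f1 z, f2 z)) \<bullet> e i)"
        if "open S" "\<And>i. i < DIM('a) \<Longrightarrow> quad D e S (\<lambda>z. f1 z \<bullet> e i)" "quad D e S f2" for S f1 f2 i
      proof -
        have "linear (\<lambda>p. P (B p) \<bullet> e i)"
          by (simp add: linear_iff P.add P.scaleR B.add B.scaleR inner_add_left)
        from quad_linear[OF e that(1) this quad_Pair[OF that(2,3)] ee]
        show ?thesis .
      qed
      have qG: "quad D e ?U (\<lambda>z. G z \<bullet> e i)" if "i < DIM('a)" for i
        using quad_add[OF quad_diff[OF e open_ball quad_inner[OF e open_ball that]
              quad_P_inner[OF e e open_ball quad_inner[OF e open_ball]]]
            lin[OF open_ball quad_C[OF e \<theta>q] quad_W[OF e \<theta>q]]]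
        by (simp add: G_def inner_add_left inner_diff_left)
      have q\<kappa>: "quad D e (ball z0 r) (\<lambda>z. \<kappa> z \<bullet> e i)" for i
        unfolding \<kappa>_def
      proof (rule lin[OF open_ball _ hq])
        fix i assume i: "i < DIM('a)"
        have "quad D e (ball z0 r) (\<lambda>z. 0 - fderiv h z (e i))"
          by (intro quad_diff[OF e open_ball] quad_const[OF e open_ball] quad_derivative[OF e i hq] h_has_derivative)
        then show "quad D e (ball z0 r) (\<lambda>z. - grad z \<bullet> e i)"
          by (rule quad_restrict[OF e _ open_ball order_refl]) (simp add: grad_inner)
      qed
      have fst: "quad D (ext_enum e) (Q \<times> ?I) (\<lambda>p. fst p \<bullet> e j)" if "j < DIM('a)" for j
        by (rule quad_fst[OF e op that])
      have qk: "quad D (ext_enum e) (Q \<times> ?I) (\<lambda>p. k p \<bullet> e j)" if j: "j < DIM('a)" for j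
      proof -
        have "quad D (ext_enum e) (Q \<times> ?I) (\<lambda>p. G (fst p) \<bullet> e j + snd p * (\<kappa> (fst p) \<bullet> e j))"
          by (intro quad_add quad_mult quad_snd[OF e op] quad_compose[OF ee e qG[OF j] op fst]
              quad_compose[OF ee e q\<kappa> op fst]) (use QU inv(2) small_ball in auto)
        then show ?thesis by (simp add: k_def inner_add_left)
      qed
      show ?thesis
      proof (rule quad_solve[OF e ee inv(1) op _ _ _ _ qk \<gamma>_cont _ _ i])
        show "quad D e U' (\<lambda>z. G z \<bullet> e j)" if "j < DIM('a)" for j
          by (rule quad_restrict[OF e qG[OF that] inv(1,2)]) simp
        show "(G has_derivative G' z) (at z)" "inj (G' z)" if "z \<in> U'" for z
          using G_der inv(2) that G'_bij by (auto simp: bij_is_inj)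
        show "inj_on G U'" using Gg(1) by (rule inj_on_inverseI)
        show "\<gamma> ` (Q \<times> ?I) \<subseteq> U'" using \<gamma>U(1) by auto
        show "G (\<gamma> y) = k y" if "y \<in> Q \<times> ?I" for y using \<gamma>U(2) that by (cases y) auto
      qed
    qed
  qed
qed

end

section \<open>Linear coordinates on the model spaces\<close>

text \<open>A finite-dimensional normed space of positive dimension is linearly homeomorphic to a space of
real vectors, with the vectors of \<^const>\<open>frame\<close> as basis. This makes the inverse function theorem and
invariance of domain available, and it is compatible with the components used for coordinates.\<close>

lemma frame_basis:
  "inj_on (frame :: nat \<Rightarrow> 'e::finite_dim_normed) {..<model_dim TYPE('e)} \<and>
    independent ((frame :: nat \<Rightarrow> 'e) ` {..<model_dim TYPE('e)}) \<and>
    span ((frame :: nat \<Rightarrow> 'e) ` {..<model_dim TYPE('e)}) = UNIV"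
proof -
  obtain B :: "'e set" where B: "independent B" "span B = UNIV"
    using maximal_independent_subset[of UNIV] by (metis top.extremum_uniqueI)
  have fin: "finite B" using independent_card_le_dim[OF B(1)] by blast
  have "card B = model_dim TYPE('e)" using dim_eq_card[of B UNIV] B by simp
  then obtain b where b: "bij_betw b {..<model_dim TYPE('e)} B"
    using ex_bij_betw_nat_finite[OF fin] by (metis atLeast0LessThan)
  have "\<exists>b :: nat \<Rightarrow> 'e. inj_on b {..<model_dim TYPE('e)} \<and>
     independent (b ` {..<model_dim TYPE('e)}) \<and> span (b ` {..<model_dim TYPE('e)}) = UNIV"
    using b B unfolding bij_betw_def by metis
  from someI_ex[OF this] show ?thesis unfolding frame_def .
qed

lemma from_components_components [simp]: "from_components (components v) = (v :: 'e::finite_dim_normed)"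
proof -
  let ?I = "{..<model_dim TYPE('e)}" and ?F = "(frame :: nat \<Rightarrow> 'e)"
  note f = frame_basis[where 'e = 'e]
  have "from_components (components v) = (\<Sum>i\<in>?I. representation (?F ` ?I) v (?F i) *\<^sub>R ?F i)"
    by (auto simp: from_components_def components_def tuple_def intro!: sum.cong)
  also have "\<dots> = (\<Sum>b\<in>?F ` ?I. representation (?F ` ?I) v b *\<^sub>R b)"
    using f by (simp add: sum.reindex)
  also have "\<dots> = v"
    using f by (intro sum_representation_eq) auto
  finally show ?thesis .
qed

lemma from_components_linear: "linear (\<lambda>x. from_components (f x) :: 'e::finite_dim_normed)"
  if "\<And>i. linear (\<lambda>x. f x i)"
proof -
  have "linear (\<lambda>x. f x i *\<^sub>R (frame i :: 'e))" for i
    using that[of i] by (auto simp: linear_iff scaleR_left.add)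
  then show ?thesis unfolding from_components_def by (intro linear_compose_sum) auto
qed

lemma components_linear: "linear (\<lambda>v :: 'e::finite_dim_normed. components v i)"
proof (cases "i < model_dim TYPE('e)")
  case True
  note f = frame_basis[where 'e = 'e]
  show ?thesis
    using f True
    by (auto simp: components_def tuple_def linear_iff real_vector.representation_add real_vector.representation_scale)
qed (simp add: components_def tuple_def linear_iff)

lemma components_from_components [simp]:
  "components (from_components x :: 'e::finite_dim_normed) = tuple (model_dim TYPE('e)) x"
proof -
  note f = frame_basis[where 'e = 'e]
  let ?I = "{..<model_dim TYPE('e)}" and ?F = "(frame :: nat \<Rightarrow> 'e)"
  have c: "components (?F j) i = (if i = j then 1 else 0)" if "i < model_dim TYPE('e)" "j < model_dim TYPE('e)" for i j
    using f that by (auto simp: components_def tuple_def real_vector.representation_basis inj_on_def)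
  have "components (from_components x :: 'e) i = x i" if i: "i < model_dim TYPE('e)" for i
  proof -
    interpret linear "\<lambda>v :: 'e. components v i" by (rule components_linear)
    have "components (from_components x :: 'e) i = (\<Sum>j\<in>?I. x j * components (?F j) i)"
      by (simp add: from_components_def sum scale)
    also have "\<dots> = (\<Sum>j\<in>?I. if j = i then x i else 0)"
      using c[OF i] by (intro sum.cong) auto
    finally show ?thesis using i by simp
  qed
  then show ?thesis by (auto simp: components_def tuple_def)
qed

lemma components_beyond: "model_dim TYPE('e) \<le> i \<Longrightarrow> components (v :: 'e::finite_dim_normed) i = 0"
  by (simp add: components_def tuple_def)

text \<open>The bound is the minimum of the norm of the image on the unit sphere, which is compact.\<close>

lemma linear_inj_bounded_below:
  fixes f :: "'v::euclidean_space \<Rightarrow> 'w::real_normed_vector"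
  assumes "linear f" "inj f"
  shows "\<exists>B>0. \<forall>x. B * norm x \<le> norm (f x)"
proof -
  interpret linear f by fact
  have "continuous_on (sphere 0 1) (\<lambda>x. norm (f x))"
    using assms(1) by (intro continuous_on_norm linear_continuous_on) (simp add: linear_linear)
  then obtain x0 where x0: "x0 \<in> sphere 0 1" "\<And>x. x \<in> sphere 0 1 \<Longrightarrow> norm (f x0) \<le> norm (f x)"
    using continuous_attains_inf[of "sphere 0 1" "\<lambda>x. norm (f x)"] by auto
  have "f x0 \<noteq> 0" using x0(1) assms(2) zero by (metis dist_self injD mem_sphere zero_neq_one)
  moreover have "norm (f x0) * norm x \<le> norm (f x)" for x
  proof (cases "x = 0")
    case False
    then have "norm (f x0) \<le> norm (f ((1 / norm x) *\<^sub>R x))" by (intro x0(2)) simp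
    then show ?thesis using False by (simp add: scale field_simps)
  qed (simp add: zero)
  ultimately show ?thesis by (intro exI[of _ "norm (f x0)"]) simp
qed

text \<open>The model space of positive dimension \<open>d\<close> as a space of real vectors: the index type has \<open>d\<close>
  elements, and one element for \<open>d = 0\<close> since types are nonempty.\<close>

typedef (overloaded) ('e::finite_dim_normed) model_index = "{i::nat. i < model_dim TYPE('e) \<or> i = 0}"
  by auto

instance model_index :: (finite_dim_normed) finite
proof
  have "(UNIV :: 'a model_index set) = Abs_model_index ` {i. i < model_dim TYPE('a) \<or> i = 0}"
    by (rule type_definition.univ[OF type_definition_model_index])
  moreover have "finite {i. i < model_dim TYPE('a) \<or> i = 0}" by simp
  ultimately show "finite (UNIV :: 'a model_index set)" by (metis finite_imageI)
qed

type_synonym 'e model = "real ^ 'e model_index"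

definition model_basis :: "nat \<Rightarrow> 'e::finite_dim_normed model" where
  "model_basis i = axis (Abs_model_index i) 1"

lemma model_index_bij:
  assumes "0 < model_dim TYPE('e)"
  shows "bij_betw (Abs_model_index :: nat \<Rightarrow> 'e::finite_dim_normed model_index) {..<model_dim TYPE('e)} UNIV"
proof -
  have eq: "{i. i < model_dim TYPE('e) \<or> i = 0} = {..<model_dim TYPE('e)}" using assms by auto
  have "inj_on (Abs_model_index :: nat \<Rightarrow> 'e model_index) {..<model_dim TYPE('e)}"
    by (rule inj_onI) (simp add: Abs_model_index_inject)
  moreover have "(UNIV :: 'e model_index set) = Abs_model_index ` {i. i < model_dim TYPE('e) \<or> i = 0}"
    by (rule type_definition.univ[OF type_definition_model_index])
  ultimately show ?thesis by (simp add: bij_betw_def eq)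
qed

lemma DIM_model:
  assumes "0 < model_dim TYPE('e)"
  shows "DIM('e::finite_dim_normed model) = model_dim TYPE('e)"
  using bij_betw_same_card[OF model_index_bij[OF assms]] by simp

lemma basis_enum_model:
  assumes "0 < model_dim TYPE('e)"
  shows "basis_enum (model_basis :: nat \<Rightarrow> 'e::finite_dim_normed model)"
proof -
  have "bij_betw (\<lambda>i. axis i 1 :: 'e model) UNIV Basis"
    by (auto simp: bij_betw_def inj_on_def axis_eq_axis Basis_vec_def)
  from bij_betw_trans[OF model_index_bij[OF assms] this]
  show ?thesis
    unfolding basis_enum_def DIM_model[OF assms] by (simp add: model_basis_def[abs_def] o_def)
qed

definition to_model :: "'e::finite_dim_normed \<Rightarrow> 'e model" where
  "to_model v = untup model_basis (components v)"

definition of_model :: "'e::finite_dim_normed model \<Rightarrow> 'e" where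
  "of_model x = from_components (tup model_basis x)"

lemma tup_to_model:
  assumes "0 < model_dim TYPE('e)"
  shows "tup model_basis (to_model v) = components (v :: 'e::finite_dim_normed)"
proof -
  have "components v \<in> topspace (Euclidean_space (model_dim TYPE('e)))"
    by (simp add: topspace_Euclidean_space components_beyond)
  then show ?thesis
    using assms by (simp add: to_model_def basis_enum_model DIM_model del: DIM_cart)
qed

lemma of_to_model:
  "0 < model_dim TYPE('e) \<Longrightarrow> of_model (to_model v) = (v :: 'e::finite_dim_normed)"
  by (simp add: of_model_def tup_to_model)

lemma to_of_model:
  assumes "0 < model_dim TYPE('e::finite_dim_normed)"
  shows "to_model (of_model x :: 'e) = x"
proof -
  have "tuple (model_dim TYPE('e)) (tup model_basis x) = tup model_basis x"
    unfolding DIM_model[OF assms, symmetric] by (auto simp: tup_def tuple_def)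
  then show ?thesis
    using assms by (simp add: to_model_def of_model_def basis_enum_model)
qed

lemma of_model_basis:
  assumes "i < model_dim TYPE('e)"
  shows "of_model (model_basis i) = (frame i :: 'e::finite_dim_normed)"
proof -
  have p: "0 < model_dim TYPE('e)" using assms by simp
  have "tup model_basis (model_basis i :: 'e model) j = (if j = i then 1 else 0)" if "j < model_dim TYPE('e)" for j
    using that assms basis_enum_inner[OF basis_enum_model[OF p], of i j]
    by (simp add: tup_nth DIM_model[OF p] del: DIM_cart)
  then have "of_model (model_basis i) = (\<Sum>j<model_dim TYPE('e). if j = i then (frame i :: 'e) else 0)"
    unfolding of_model_def from_components_def by (intro sum.cong) auto
  then show ?thesis using assms by simp
qed

lemma tup_linear: "linear (\<lambda>v. tup e v i)"
  by (auto simp: tup_def tuple_def linear_iff inner_add_left)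

lemma of_model_bounded_linear: "bounded_linear (of_model :: 'e::finite_dim_normed model \<Rightarrow> 'e)"
  using from_components_linear[OF tup_linear] unfolding of_model_def[abs_def] linear_linear .

lemma untup_linear: "linear (\<lambda>x. untup e (f x))" if "\<And>i. linear (\<lambda>x. f x i)"
proof -
  have "linear (\<lambda>x. f x i *\<^sub>R e i)" for i
    using that[of i] by (auto simp: linear_iff scaleR_left.add)
  then show ?thesis unfolding untup_def by (intro linear_compose_sum) auto
qed

lemma to_model_bounded_linear:
  assumes p: "0 < model_dim TYPE('e)"
  shows "bounded_linear (to_model :: 'e::finite_dim_normed \<Rightarrow> 'e model)"
proof -
  have lin: "linear (to_model :: 'e \<Rightarrow> 'e model)"
    unfolding to_model_def[abs_def] by (rule untup_linear[OF components_linear])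
  have "inj (of_model :: 'e model \<Rightarrow> 'e)"
    using to_of_model[OF p] by (metis injI)
  then obtain B where B: "B > 0" "\<And>x :: 'e model. B * norm x \<le> norm (of_model x :: 'e)"
    using linear_inj_bounded_below[of "of_model :: 'e model \<Rightarrow> 'e"]
      of_model_bounded_linear bounded_linear.linear by blast
  have "norm (to_model v) \<le> norm v * (1 / B)" for v :: 'e
    using B(2)[of "to_model v"] B(1) of_to_model[OF p, of v] by (simp add: field_simps)
  then show ?thesis
    using linear_add[OF lin] linear_scale[OF lin] by (intro bounded_linear_intro)
qed

lemma components_bounded_linear: "bounded_linear (\<lambda>v :: 'e::finite_dim_normed. components v i)"
proof (cases "i < model_dim TYPE('e)")
  case True
  then have p: "0 < model_dim TYPE('e)" by simp
  have "components v i = to_model v \<bullet> model_basis i" for v :: 'e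
    using tup_to_model[OF p, of v] True by (metis tup_nth DIM_model[OF p])
  then show ?thesis
    using bounded_linear_compose[OF bounded_linear_inner_left to_model_bounded_linear[OF p]] by simp
qed (simp add: components_beyond)

text \<open>The first coordinates are those of \<open>N\<close> and the remaining ones those of \<open>\<Lambda>\<close>. Both manifolds may
have dimension 0, so their model spaces are not replaced by vector spaces of their own.\<close>

definition split_model :: "'e::finite_dim_normed model \<Rightarrow>
    'f::finite_dim_normed \<times> 'g::finite_dim_normed" where
  "split_model v = (from_components (tuple (model_dim TYPE('f)) (tup model_basis v)),
     from_components (tuple (model_dim TYPE('g)) (\<lambda>i. tup model_basis v (model_dim TYPE('f) + i))))"

definition join_model :: "'f::finite_dim_normed \<times> 'g::finite_dim_normed \<Rightarrow>
    'e::finite_dim_normed model" where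
  "join_model p = untup model_basis (\<lambda>i. if i < model_dim TYPE('f) then components (fst p) i
     else components (snd p) (i - model_dim TYPE('f)))"

text \<open>The projection along the coordinates of \<open>\<Lambda>\<close>. Its type does not determine the two model spaces,
which are therefore arguments.\<close>

definition fibre_part :: "'f::finite_dim_normed itself \<Rightarrow> 'g::finite_dim_normed itself \<Rightarrow>
    'e::finite_dim_normed model \<Rightarrow> 'e model" where
  "fibre_part _ _ v = join_model (fst (split_model v :: 'f \<times> 'g), 0 :: 'g)"

context
  fixes TE :: "'e::finite_dim_normed itself" and TF :: "'f::finite_dim_normed itself"
    and TG :: "'g::finite_dim_normed itself"
  assumes pos: "0 < model_dim TYPE('e)"
    and dims: "model_dim TYPE('g) + model_dim TYPE('f) = model_dim TYPE('e)"
begin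

lemma split_join: "split_model (join_model p :: 'e model) = (p :: 'f \<times> 'g)"
proof -
  let ?x = "\<lambda>i. if i < model_dim TYPE('f) then components (fst p) i
     else components (snd p) (i - model_dim TYPE('f))"
  have t: "tup model_basis (join_model p :: 'e model) i = ?x i" if "i < model_dim TYPE('e)" for i
    using that inner_untup[OF basis_enum_model[OF pos]] DIM_model[OF pos]
    by (simp add: join_model_def tup_nth del: DIM_cart)
  have 1: "tuple (model_dim TYPE('f)) (tup model_basis (join_model p :: 'e model)) = components (fst p)"
    using dims by (auto simp: tuple_def t components_beyond)
  have 2: "tuple (model_dim TYPE('g)) (\<lambda>i. tup model_basis (join_model p :: 'e model) (model_dim TYPE('f) + i)) = components (snd p)"
    using dims by (auto simp: tuple_def t components_beyond)
  show ?thesis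
    unfolding split_model_def 1 2 by simp
qed

lemma join_split: "join_model (split_model v :: 'f \<times> 'g) = (v :: 'e model)"
proof -
  let ?p = "split_model v :: 'f \<times> 'g"
  have "untup model_basis (\<lambda>i. if i < model_dim TYPE('f) then components (fst ?p) i
     else components (snd ?p) (i - model_dim TYPE('f))) = (untup model_basis (tup model_basis v) :: 'e model)"
    unfolding untup_def DIM_model[OF pos] using dims
    by (intro sum.cong) (auto simp: split_model_def tuple_def)
  then show ?thesis
    using basis_enum_model[OF pos] by (simp add: join_model_def)
qed

lemma split_bounded_linear: "bounded_linear (split_model :: 'e model \<Rightarrow> 'f \<times> 'g)"
proof -
  have "linear (\<lambda>v. tuple k (\<lambda>i. tup model_basis v (j + i)) l)" for j k l
    using tup_linear by (auto simp: tuple_def linear_iff)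
  from from_components_linear[OF this[of _ 0]] from_components_linear[OF this]
  have "linear (\<lambda>v. from_components (tuple (model_dim TYPE('f)) (tup model_basis v)) :: 'f)"
    "linear (\<lambda>v. from_components (tuple (model_dim TYPE('g)) (\<lambda>i. tup model_basis v (model_dim TYPE('f) + i))) :: 'g)"
    by simp_all
  from this[unfolded linear_conv_bounded_linear] show ?thesis
    unfolding split_model_def[abs_def] by (rule bounded_linear_Pair)
qed

lemma join_bounded_linear: "bounded_linear (join_model :: 'f \<times> 'g \<Rightarrow> 'e model)"
proof -
  have "bounded_linear (\<lambda>p. (if i < model_dim TYPE('f) then components (fst p :: 'f) i
     else components (snd p :: 'g) (i - model_dim TYPE('f))) *\<^sub>R (model_basis i :: 'e model))" for i
    by (cases "i < model_dim TYPE('f)")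
      (simp_all, (intro bounded_linear_scaleR_const bounded_linear_compose[OF components_bounded_linear]
        bounded_linear_fst bounded_linear_snd)+)
  then show ?thesis
    unfolding join_model_def untup_def by (intro bounded_linear_sum)
qed

lemma fibre_part_linear:
  "linear (fibre_part TYPE('f) TYPE('g) :: 'e model \<Rightarrow> 'e model)"
proof -
  have "bounded_linear (\<lambda>v :: 'e model. (fst (split_model v :: 'f \<times> 'g), 0 :: 'g))"
    using bounded_linear_Pair[OF bounded_linear_compose[OF bounded_linear_fst split_bounded_linear] bounded_linear_zero] .
  from bounded_linear_compose[OF join_bounded_linear this] show ?thesis
    unfolding fibre_part_def[abs_def] linear_linear .
qed

lemma fibre_part_idem:
  "fibre_part TYPE('f) TYPE('g) (fibre_part TYPE('f) TYPE('g) v) =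
    fibre_part TYPE('f) TYPE('g) (v :: 'e model)"
  by (simp add: fibre_part_def split_join)

lemma fibre_part_norm: "norm (fibre_part TYPE('f) TYPE('g) v) \<le> norm (v :: 'e model)"
proof -
  have c: "fibre_part TYPE('f) TYPE('g) v \<bullet> model_basis i = (if i < model_dim TYPE('f) then v \<bullet> model_basis i else 0)"
    if i: "i < model_dim TYPE('e)" for i
  proof -
    have "components (0 :: 'g) j = 0" for j using linear_0[OF components_linear] by blast
    then show ?thesis
      using inner_untup[OF basis_enum_model[OF pos]] DIM_model[OF pos] dims that
      by (simp add: fibre_part_def join_model_def split_model_def tuple_def tup_nth del: DIM_cart)
  qed
  have "(norm w)\<^sup>2 = (\<Sum>i<model_dim TYPE('e). (w \<bullet> model_basis i)\<^sup>2)" for w :: "'e model"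
  proof -
    have "(norm w)\<^sup>2 = (\<Sum>b\<in>Basis. (w \<bullet> b)\<^sup>2)"
      unfolding power2_norm_eq_inner by (subst euclidean_inner) (simp add: power2_eq_square)
    then show ?thesis
      using basis_enum_sum[OF basis_enum_model[OF pos], of "\<lambda>b. (w \<bullet> b)\<^sup>2"] DIM_model[OF pos]
      by (simp del: DIM_cart)
  qed
  then have "(norm (fibre_part TYPE('f) TYPE('g) v))\<^sup>2 \<le> (norm v)\<^sup>2"
    by (simp add: c) (intro sum_mono, simp add: c)
  then show ?thesis by (simp add: power_mono_iff)
qed

end

section \<open>Charts\<close>

lemma smooth_on_Ck: "smooth_on S f \<Longrightarrow> Ck_on k S f"
  by (simp add: smooth_on_def)

lemma smooth_on_differentiable:
  assumes "smooth_on S f" "x \<in> S"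
  shows "(f has_derivative fderiv f x) (at x)"
  using Ck_on_differentiable[OF smooth_on_Ck[OF assms(1)] assms(2)] .

text \<open>Tangent vectors are represented in preferred charts, so every statement about a given chart
involves the derivative of a change of charts at a point. The conversions \<^const>\<open>to_chart\<close> and
\<^const>\<open>from_chart\<close> are the two instances with the preferred chart on one side, and the chain rule
makes all of them compatible.\<close>

definition transition_deriv ::
  "('m, 'e::real_normed_vector) chart \<Rightarrow> ('m, 'e) chart \<Rightarrow> 'm \<Rightarrow> 'e \<Rightarrow> 'e" where
  "transition_deriv c d p = fderiv (snd d \<circ> chart_inv c) (snd c p)"

lemma to_chart_trans: "to_chart A c p = transition_deriv (chart_at A p) c p"
  by (simp add: to_chart_def transition_deriv_def)

lemma from_chart_trans: "from_chart A c p = transition_deriv c (chart_at A p) p"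
  by (simp add: from_chart_def transition_deriv_def)

locale atlas =
  fixes A :: "('m::topological_space, 'e::real_normed_vector) chart set"
  assumes smooth_atlas: "smooth_atlas A"
begin

lemma chart:
  assumes "c \<in> A"
  shows chart_open: "open (fst c)" and chart_image_open: "open (snd c ` fst c)"
    and chart_cont: "continuous_on (fst c) (snd c)"
    and chart_inv_cont: "continuous_on (snd c ` fst c) (chart_inv c)"
    and chart_inv_left: "\<And>p. p \<in> fst c \<Longrightarrow> chart_inv c (snd c p) = p"
    and chart_inv_right: "\<And>x. x \<in> snd c ` fst c \<Longrightarrow> snd c (chart_inv c x) = x"
    and chart_inv_in: "\<And>x. x \<in> snd c ` fst c \<Longrightarrow> chart_inv c x \<in> fst c"
  using smooth_atlas assms unfolding smooth_atlas_def is_chart_def homeomorphism_def by auto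

lemma chart_at: "chart_at A p \<in> A" "p \<in> fst (chart_at A p)"
proof -
  have "\<exists>c. c \<in> A \<and> p \<in> fst c" using smooth_atlas unfolding smooth_atlas_def by blast
  from someI_ex[OF this] show "chart_at A p \<in> A" "p \<in> fst (chart_at A p)"
    unfolding chart_at_def by auto
qed

lemma chart_image_Int:
  assumes "c \<in> A"
  shows "snd c ` (fst c \<inter> U) = snd c ` fst c \<inter> chart_inv c -` U"
  using chart_inv_left[OF assms] by force

lemma chart_image_Int_open:
  assumes "c \<in> A" "open U"
  shows "open (snd c ` (fst c \<inter> U))"
  unfolding chart_image_Int[OF assms(1)]
  using continuous_open_preimage[OF chart_inv_cont chart_image_open] assms by blast

lemma transition:
  assumes "c \<in> A" "d \<in> A" "p \<in> fst c" "p \<in> fst d"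
  shows "((\<lambda>x. snd d (chart_inv c x)) has_derivative transition_deriv c d p) (at (snd c p))"
proof -
  have "smooth_on (snd c ` (fst c \<inter> fst d)) (snd d \<circ> chart_inv c)"
    using smooth_atlas assms unfolding smooth_atlas_def by blast
  from smooth_on_differentiable[OF this, of "snd c p"] show ?thesis
    using assms by (simp add: transition_deriv_def o_def)
qed

lemma transition_deriv_linear:
  assumes "c \<in> A" "d \<in> A" "p \<in> fst c" "p \<in> fst d"
  shows "linear (transition_deriv c d p)"
  using transition[OF assms] has_derivative_linear by blast

lemma change_chart:
  assumes c: "c \<in> A" "d \<in> A" and U: "open U" "w \<in> U" "F ` U \<subseteq> fst c" "F w \<in> fst d"
    and D: "((\<lambda>y. snd c (F y)) has_derivative D) (at w)"
  shows "((\<lambda>y. snd d (F y)) has_derivative (\<lambda>v. transition_deriv c d (F w) (D v))) (at w)"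
proof -
  have "((\<lambda>x. snd d (chart_inv c x)) has_derivative transition_deriv c d (F w)) (at (snd c (F w)))"
    using transition[OF c, of "F w"] U by auto
  from has_derivative_compose[OF D this] show ?thesis
    by (rule has_derivative_transform_within_open[OF _ U(1,2)])
      (use U chart_inv_left[OF c(1)] in auto)
qed

lemma transition_deriv_trans:
  assumes "c \<in> A" "d \<in> A" "f \<in> A" "p \<in> fst c" "p \<in> fst d" "p \<in> fst f"
  shows "transition_deriv d f p (transition_deriv c d p v) = transition_deriv c f p v"
proof -
  let ?U = "snd c ` (fst c \<inter> fst d)"
  have "((\<lambda>y. snd f (chart_inv c y)) has_derivative (\<lambda>v. transition_deriv d f (chart_inv c (snd c p)) (transition_deriv c d p v))) (at (snd c p))"
    by (rule change_chart[OF assms(2,3) chart_image_Int_open[of c "fst d"]])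
      (use assms chart_inv_left[OF assms(1)] transition[OF assms(1,2,4,5)] chart_open[OF assms(2)] in auto)
  then have "((\<lambda>y. snd f (chart_inv c y)) has_derivative (\<lambda>v. transition_deriv d f p (transition_deriv c d p v))) (at (snd c p))"
    using assms chart_inv_left by simp
  from frechet_derivative_eq[OF this] show ?thesis
    by (simp add: transition_deriv_def o_def)
qed

lemma transition_deriv_self:
  assumes "c \<in> A" "p \<in> fst c"
  shows "transition_deriv c c p v = v"
proof -
  have "((\<lambda>y. snd c (chart_inv c y)) has_derivative (\<lambda>v. v)) (at (snd c p))"
    by (rule has_derivative_transform_within_open[OF has_derivative_ident chart_image_open[OF assms(1)]])
      (use assms chart_inv_right in auto)
  from frechet_derivative_eq[OF this] show ?thesis by (simp add: transition_deriv_def o_def)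
qed

lemma transition_deriv_inverse:
  assumes "c \<in> A" "d \<in> A" "p \<in> fst c" "p \<in> fst d"
  shows "transition_deriv d c p (transition_deriv c d p v) = v"
  using transition_deriv_trans[of c d c p v] transition_deriv_self[of c p v] assms by simp

text \<open>The local expression that \<^const>\<open>ext_deriv\<close> differentiates, for an arbitrary chart.\<close>

definition coeff :: "('m \<Rightarrow> 'e \<Rightarrow> real) \<Rightarrow> ('m, 'e) chart \<Rightarrow> 'e \<Rightarrow> 'e \<Rightarrow> real" where
  "coeff \<alpha> c x w = \<alpha> (chart_inv c x) (from_chart A c (chart_inv c x) w)"

lemma coeff_linear:
  assumes "one_form_on A UNIV \<alpha>" "c \<in> A" "x \<in> snd c ` fst c"
  shows "linear (coeff \<alpha> c x)"
proof -
  have "linear (\<alpha> (chart_inv c x))" using assms by (simp add: one_form_on_def)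
  moreover have "linear (from_chart A c (chart_inv c x))"
    unfolding from_chart_trans using assms chart_inv_in chart_at by (intro transition_deriv_linear) auto
  ultimately show ?thesis
    using linear_compose by (fastforce simp: coeff_def[abs_def] o_def)
qed

lemma coeff_smooth:
  assumes "one_form_on A UNIV \<alpha>" "c \<in> A"
  shows "smooth_on (snd c ` fst c) (\<lambda>x. coeff \<alpha> c x w)"
  using assms unfolding one_form_on_def coeff_def by auto

lemma coeff_derivative:
  assumes "one_form_on A UNIV \<alpha>" "c \<in> A" "x \<in> snd c ` fst c"
  shows "((\<lambda>x. coeff \<alpha> c x w) has_derivative fderiv (\<lambda>x. coeff \<alpha> c x w) x) (at x)"
  using smooth_on_differentiable[OF coeff_smooth] assms by blast

lemma coeff_at:
  "coeff \<alpha> (chart_at A p) (snd (chart_at A p) p) w = \<alpha> p w"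
  using chart_at[of p] by (simp add: coeff_def chart_inv_left from_chart_trans transition_deriv_self)

lemma ext_deriv_coeff:
  "ext_deriv A \<alpha> p u v =
    fderiv (\<lambda>x. coeff \<alpha> (chart_at A p) x v) (snd (chart_at A p) p) u -
    fderiv (\<lambda>x. coeff \<alpha> (chart_at A p) x u) (snd (chart_at A p) p) v"
  by (simp add: ext_deriv_def coeff_def Let_def)

lemma ext_deriv_antisym: "ext_deriv A \<alpha> p u v = - ext_deriv A \<alpha> p v u"
  by (simp add: ext_deriv_coeff)

lemma ext_deriv_linear:
  assumes \<alpha>: "one_form_on A UNIV \<alpha>"
  shows "linear (ext_deriv A \<alpha> p u)" "linear (\<lambda>u. ext_deriv A \<alpha> p u v)"
proof -
  let ?c = "chart_at A p" and ?x = "snd (chart_at A p) p"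
  let ?D = "\<lambda>w. fderiv (\<lambda>x. coeff \<alpha> ?c x w) ?x"
  note c = chart_at[of p]
  have x: "?x \<in> snd ?c ` fst ?c" using c by simp
  note D = coeff_derivative[OF \<alpha> c(1) x]
  note op = chart_image_open[OF c(1)]
  have "?D (v + w) u = ?D v u + ?D w u" for u v w
  proof (rule frechet_derivative_eq)
    show "((\<lambda>x. coeff \<alpha> ?c x (v + w)) has_derivative (\<lambda>u. ?D v u + ?D w u)) (at ?x)"
      by (rule has_derivative_transform_within_open[OF has_derivative_add[OF D D] op x])
        (simp add: linear_add[OF coeff_linear[OF \<alpha> c(1)]])
  qed
  moreover have "?D (k *\<^sub>R v) u = k * ?D v u" for k u v
  proof (rule frechet_derivative_eq)
    show "((\<lambda>x. coeff \<alpha> ?c x (k *\<^sub>R v)) has_derivative (\<lambda>u. k * ?D v u)) (at ?x)"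
      by (rule has_derivative_transform_within_open[OF has_derivative_mult_right[OF D] op x])
        (simp add: linear_scale[OF coeff_linear[OF \<alpha> c(1)]])
  qed
  moreover have "linear (?D w)" for w using D has_derivative_linear by blast
  ultimately have lin: "linear (ext_deriv A \<alpha> p u)" for u
    by (simp add: ext_deriv_coeff[abs_def] linear_iff algebra_simps)
  then show "linear (ext_deriv A \<alpha> p u)" .
  have "linear (\<lambda>u. - ext_deriv A \<alpha> p v u)" using lin[of v] by (rule linear_compose_neg)
  then show "linear (\<lambda>u. ext_deriv A \<alpha> p u v)"
    by (simp only: ext_deriv_antisym[of \<alpha> p _ v])
qed

text \<open>The field is a contact field for some form \<open>\<eta>'\<close> with the same kernels as \<open>\<eta>\<close>. Near \<open>p\<close> the two differ
  by a factor \<open>g\<close>, the quotient of their values on one vector, and the Hamiltonians differ by the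
  same factor. On vectors in the kernel the terms with the derivative of \<open>g\<close> cancel from the contact
  equation for \<open>\<eta>'\<close>, which leaves the one for \<open>\<eta>\<close>. In the direction of the Reeb field of \<open>\<eta>\<close> both sides
  vanish, the right-hand side by the assumption on the Hamiltonian.\<close>

lemma contact_equation:
  assumes \<eta>: "contact_form A n \<H> \<eta>" and X: "hamiltonian_contact_field A n \<H> X"
    and \<xi>: "reeb_field A \<eta> \<xi>"
    and H\<xi>: "differential A (hamiltonian_function \<eta> X) p (\<xi> p) = 0"
  shows "(\<lambda>x. hamiltonian_function \<eta> X (chart_inv (chart_at A p) x)) differentiable (at (snd (chart_at A p) p))"
    and "ext_deriv A \<eta> p (X p) v = - differential A (hamiltonian_function \<eta> X) p v"
proof -
  let ?c = "chart_at A p" and ?x = "snd (chart_at A p) p"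
  note c = chart_at[of p]
  have x: "?x \<in> snd ?c ` fst ?c" using c by simp
  note op = chart_image_open[OF c(1)]
  obtain \<eta>' H' where \<eta>': "contact_form A n \<H> \<eta>'" and H': "smooth_function A H'" and
    X': "contact_field A \<eta>' H' X"
    using X unfolding hamiltonian_contact_field_def by blast
  obtain \<xi>' where \<xi>': "\<And>p v. ext_deriv A \<eta>' p (X p) v = - differential A H' p v + differential A H' p (\<xi>' p) * \<eta>' p v"
    and H'X: "\<And>p. \<eta>' p (X p) = H' p"
    using X' unfolding contact_field_def by blast
  have form: "one_form_on A UNIV \<eta>" "one_form_on A UNIV \<eta>'"
    using \<eta> \<eta>' by (auto simp: contact_form_def)
  have lin: "linear (\<eta> q)" "linear (\<eta>' q)" for q
    using form by (auto simp: one_form_on_def)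
  have ker: "\<eta>' q v = 0 \<longleftrightarrow> \<eta> q v = 0" for q v
    using \<eta> \<eta>' unfolding contact_form_def by (metis (mono_tags, lifting) mem_Collect_eq)
  have ratio: "\<eta>' q v = \<eta>' q u / \<eta> q u * \<eta> q v" if "\<eta> q u \<noteq> 0" for q u v
  proof -
    have "\<eta> q (v - (\<eta> q v / \<eta> q u) *\<^sub>R u) = 0"
      using that lin(1)[of q] by (simp add: linear_diff linear_scale)
    then have "\<eta>' q (v - (\<eta> q v / \<eta> q u) *\<^sub>R u) = 0" using ker by blast
    then show ?thesis using lin(2)[of q] by (simp add: linear_diff linear_scale)
  qed
  let ?\<alpha> = "coeff \<eta> ?c" and ?\<beta> = "coeff \<eta>' ?c" and ?w = "\<xi> p"
  define H where "H = hamiltonian_function \<eta> X"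
  let ?H = "\<lambda>y. H (chart_inv ?c y)" and ?H' = "\<lambda>y. H' (chart_inv ?c y)"
  have \<xi>p: "\<eta> p (\<xi> p) = 1" "\<And>v. ext_deriv A \<eta> p (\<xi> p) v = 0"
    using \<xi> by (auto simp: reeb_field_def)
  note D\<alpha> = coeff_derivative[OF form(1) c(1) x] and D\<beta> = coeff_derivative[OF form(2) c(1) x]
  have \<alpha>x: "?\<alpha> ?x v = \<eta> p v" and \<beta>x: "?\<beta> ?x v = \<eta>' p v" for v by (rule coeff_at)+
  define U where "U = {y \<in> snd ?c ` fst ?c. ?\<alpha> y ?w \<noteq> 0}"
  have "continuous_on (snd ?c ` fst ?c) (\<lambda>y. ?\<alpha> y ?w)"
    using Ck_on_continuous[OF smooth_on_Ck[OF coeff_smooth[OF form(1) c(1)]]] .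
  then have "open (snd ?c ` fst ?c \<inter> (\<lambda>y. ?\<alpha> y ?w) -` (- {0}))"
    by (intro continuous_open_preimage op) auto
  moreover have "U = snd ?c ` fst ?c \<inter> (\<lambda>y. ?\<alpha> y ?w) -` (- {0})" by (auto simp: U_def)
  ultimately have U: "open U" by simp
  have xU: "?x \<in> U" using x \<alpha>x \<xi>p by (simp add: U_def)
  define g where "g y = ?\<beta> y ?w / ?\<alpha> y ?w" for y
  have "((\<lambda>y. ?\<beta> y ?w / ?\<alpha> y ?w) has_derivative
      (\<lambda>h. - ?\<beta> ?x ?w * (inverse (?\<alpha> ?x ?w) * fderiv (\<lambda>y. ?\<alpha> y ?w) ?x h * inverse (?\<alpha> ?x ?w))
        + fderiv (\<lambda>y. ?\<beta> y ?w) ?x h / ?\<alpha> ?x ?w)) (at ?x)"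
    by (rule has_derivative_divide[OF D\<beta> D\<alpha>]) (simp add: \<alpha>x \<xi>p)
  then have "g differentiable (at ?x)" unfolding g_def[abs_def] differentiable_def by blast
  then obtain Dg where Dg: "(g has_derivative Dg) (at ?x)" unfolding differentiable_def by blast
  have g0: "g ?x \<noteq> 0" using ker[of p ?w] \<xi>p by (simp add: g_def \<alpha>x \<beta>x)
  have \<beta>g: "?\<beta> y v = g y * ?\<alpha> y v" if "y \<in> U" for y v
    using ratio[of "chart_inv ?c y" "from_chart A ?c (chart_inv ?c y) ?w"] that
    unfolding U_def g_def coeff_def by blast
  have H'g: "?H' y = g y * ?H y" if "y \<in> U" for y
  proof -
    let ?q = "chart_inv ?c y"
    have "?H' y = \<eta>' ?q (X ?q)" using H'X by simp
    also have "\<dots> = \<eta>' ?q (from_chart A ?c ?q ?w) / \<eta> ?q (from_chart A ?c ?q ?w) * \<eta> ?q (X ?q)"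
      using that by (intro ratio) (simp add: U_def coeff_def)
    finally show ?thesis by (simp add: g_def coeff_def H_def hamiltonian_function_def)
  qed
  have "smooth_on (snd ?c ` fst ?c) (H' \<circ> chart_inv ?c)"
    using H' c unfolding smooth_function_def by blast
  from smooth_on_differentiable[OF this x]
  have DH': "(?H' has_derivative differential A H' p) (at ?x)"
    by (simp add: differential_def o_def)
  define U' where "U' = {y \<in> U. g y \<noteq> 0}"
  have "continuous_on U g"
  proof -
    have "continuous_on U (\<lambda>y. ?\<alpha> y ?w)" "continuous_on U (\<lambda>y. ?\<beta> y ?w)"
      using Ck_on_continuous[OF smooth_on_Ck[OF coeff_smooth[OF form(1) c(1)]]]
        Ck_on_continuous[OF smooth_on_Ck[OF coeff_smooth[OF form(2) c(1)]]]
      by (auto simp: U_def intro: continuous_on_subset)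
    then show ?thesis unfolding g_def[abs_def] by (intro continuous_on_divide) (auto simp: U_def)
  qed
  then have "open (U \<inter> g -` (- {0}))" by (intro continuous_open_preimage U) auto
  moreover have "U' = U \<inter> g -` (- {0})" by (auto simp: U'_def)
  ultimately have U': "open U'" by simp
  have xU': "?x \<in> U'" using xU g0 by (simp add: U'_def)
  have "(\<lambda>y. ?H' y / g y) differentiable (at ?x)"
    using has_derivative_divide[OF DH' Dg g0] unfolding differentiable_def by blast
  then obtain D where "((\<lambda>y. ?H' y / g y) has_derivative D) (at ?x)"
    unfolding differentiable_def by blast
  then have "(?H has_derivative D) (at ?x)"
    by (rule has_derivative_transform_within_open[OF _ U' xU']) (simp add: U'_def H'g)
  then show diff: "(\<lambda>x. hamiltonian_function \<eta> X (chart_inv ?c x)) differentiable (at ?x)"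
    unfolding differentiable_def H_def by blast
  then have DH: "(?H has_derivative differential A H p) (at ?x)"
    by (simp add: differential_def o_def H_def frechet_derivative_works)
  have DH'g: "differential A H' p v = g ?x * differential A H p v + Dg v * H p" for v
  proof -
    have "(?H' has_derivative (\<lambda>v. g ?x * differential A H p v + Dg v * ?H ?x)) (at ?x)"
      by (rule has_derivative_transform_within_open[OF has_derivative_mult[OF Dg DH] U xU]) (simp add: H'g)
    from has_derivative_unique[OF DH' this] show ?thesis
      using chart_inv_left[OF c] by simp
  qed
  have D\<beta>g: "fderiv (\<lambda>y. ?\<beta> y v) ?x u =
      g ?x * fderiv (\<lambda>y. ?\<alpha> y v) ?x u + Dg u * \<eta> p v" for u v
  proof (rule frechet_derivative_eq)
    show "((\<lambda>y. ?\<beta> y v) has_derivative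
      (\<lambda>u. g ?x * fderiv (\<lambda>y. ?\<alpha> y v) ?x u + Dg u * \<eta> p v)) (at ?x)"
      using has_derivative_transform_within_open[OF has_derivative_mult[OF Dg D\<alpha>[of v]] U xU, of "\<lambda>y. ?\<beta> y v"]
      by (simp add: \<beta>g \<alpha>x)
  qed
  have ext': "ext_deriv A \<eta>' p u v = g ?x * ext_deriv A \<eta> p u v + Dg u * \<eta> p v - Dg v * \<eta> p u" for u v
    unfolding ext_deriv_coeff D\<beta>g by (simp add: algebra_simps)
  have HX: "\<eta> p (X p) = H p" by (simp add: H_def hamiltonian_function_def)
  have on_ker: "ext_deriv A \<eta> p (X p) v = - differential A H p v" if v: "\<eta> p v = 0" for v
  proof -
    have "\<eta>' p v = 0" using v ker by blast
    then have "g ?x * ext_deriv A \<eta> p (X p) v - Dg v * H p = - (g ?x * differential A H p v + Dg v * H p)"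
      using ext'[of "X p" v] \<xi>'[of p v] DH'g[of v] v HX by simp
    then have "g ?x * (ext_deriv A \<eta> p (X p) v + differential A H p v) = 0"
      by (simp add: algebra_simps)
    then show ?thesis using g0 by simp
  qed
  define v' where "v' = v - \<eta> p v *\<^sub>R \<xi> p"
  have v: "v = v' + \<eta> p v *\<^sub>R \<xi> p" by (simp add: v'_def)
  have "\<eta> p v' = 0" using lin(1)[of p] \<xi>p by (simp add: v'_def linear_diff linear_scale)
  note 1 = on_ker[OF this]
  have "ext_deriv A \<eta> p (X p) v = ext_deriv A \<eta> p (X p) v' + \<eta> p v * ext_deriv A \<eta> p (X p) (\<xi> p)"
    using linear_add[OF ext_deriv_linear(1)[OF form(1)], of p "X p" v' "\<eta> p v *\<^sub>R \<xi> p"]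
      linear_scale[OF ext_deriv_linear(1)[OF form(1)], of p "X p" "\<eta> p v" "\<xi> p"] unfolding v[symmetric] by simp
  also have "ext_deriv A \<eta> p (X p) (\<xi> p) = 0"
    using ext_deriv_antisym[of \<eta> p "X p" "\<xi> p"] \<xi>p by simp
  finally have 2: "ext_deriv A \<eta> p (X p) v = - differential A H p v'" using 1 by simp
  have "differential A H p v = differential A H p v' + \<eta> p v * differential A H p (\<xi> p)"
    using linear_add[OF has_derivative_linear[OF DH], of v' "\<eta> p v *\<^sub>R \<xi> p"]
      linear_scale[OF has_derivative_linear[OF DH], of "\<eta> p v" "\<xi> p"] unfolding v[symmetric] by simp
  then have "differential A H p v = differential A H p v'" using H\<xi> by (simp add: H_def)
  then show "ext_deriv A \<eta> p (X p) v = - differential A (hamiltonian_function \<eta> X) p v"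
    using 2 by (simp add: H_def)
qed

end

lemma contact_form_nondegenerate:
  fixes A :: "('m::topological_space, 'e::finite_dim_normed) chart set"
  assumes "smooth_atlas A" "contact_form A n \<H> \<eta>" "model_dim TYPE('e) = 2 * n + 1"
    and u: "\<And>v. ext_deriv A \<eta> p u v = 0" "\<eta> p u = 0"
  shows "u = 0"
proof -
  interpret atlas A by standard fact
  have form: "one_form_on A UNIV \<eta>" and nd: "contact_nondegenerate A n UNIV \<eta>"
    using assms(2) by (auto simp: contact_form_def)
  obtain v where v: "wedge (2 * n) 1 (wedge_power n (\<lambda>v. ext_deriv A \<eta> p (v 0) (v 1))) (\<lambda>v. \<eta> p (v 0)) v \<noteq> 0"
    using nd unfolding contact_nondegenerate_def by blast
  show ?thesis
  proof (rule contact_volume_nondegenerate[OF assms(3) ext_deriv_linear[OF form] _ v])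
    show "linear (\<eta> p)" using form by (simp add: one_form_on_def)
    show "ext_deriv A \<eta> p x u = 0" for x using ext_deriv_antisym[of \<eta> p x u] u(1) by simp
  qed (use u in auto)
qed

section \<open>A complete solution in coordinates\<close>

text \<open>The coordinates \<open>z\<close> of a pair \<open>(x, l)\<close> in the charts \<open>b\<close> and \<open>c\<close> become local coordinates of \<open>M\<close> through
the complete solution. The map \<open>sol\<close> takes coordinates to points of \<open>M\<close>; \<open>dom_in d\<close> is the set of
coordinates of points in the chart \<open>d\<close>, and \<open>\<psi> d\<close> is the map in that chart.\<close>

locale complete_solution_charts =
  MA: atlas A + NB: atlas B + LC: atlas C
  for A :: "('m::t2_space, 'e::finite_dim_normed) chart set"
    and B :: "('n::t2_space, 'f::finite_dim_normed) chart set"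
    and C :: "('l::t2_space, 'g::finite_dim_normed) chart set" +
  fixes X :: "'m \<Rightarrow> 'e" and \<pi> :: "'m \<Rightarrow> 'n" and \<Sigma> :: "'n \<times> 'l \<Rightarrow> 'm"
    and b :: "('n, 'f) chart" and c :: "('l, 'g) chart"
  assumes complete: "complete_solution A B C \<pi> X \<Sigma>"
    and b: "b \<in> B" and c: "c \<in> C" and pos: "0 < model_dim TYPE('e)"
begin

abbreviation split :: "'e model \<Rightarrow> 'f \<times> 'g" where "split \<equiv> split_model"
abbreviation join :: "'f \<times> 'g \<Rightarrow> 'e model" where "join \<equiv> join_model"
definition P :: "'e model \<Rightarrow> 'e model" where
  "P v = join (fst (split v), 0)"

lemma P_fibre_part: "P = fibre_part TYPE('f) TYPE('g)"
  by (simp add: P_def fibre_part_def fun_eq_iff)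

lemma dims: "model_dim TYPE('g) + model_dim TYPE('f) = model_dim TYPE('e)"
  using complete by (simp add: complete_solution_def)

lemmas split_bl = split_bounded_linear[OF pos dims]
lemmas join_bl = join_bounded_linear[OF pos dims]
lemmas split_join' = split_join[OF pos dims]
lemmas join_split' = join_split[OF pos dims]

definition point :: "'e model \<Rightarrow> 'n \<times> 'l" where
  "point v = (chart_inv b (fst (split v)), chart_inv c (snd (split v)))"

definition coord_dom :: "'e model set" where
  "coord_dom = split -` ((snd b ` fst b) \<times> (snd c ` fst c))"

definition sol :: "'e model \<Rightarrow> 'm" where
  "sol v = \<Sigma> (point v)"

definition dom_in :: "('m, 'e) chart \<Rightarrow> 'e model set" where
  "dom_in d = {v \<in> coord_dom. sol v \<in> fst d}"

lemma split_continuous: "continuous_on U split"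
  using split_bl linear_continuous_on by blast

lemma coord_dom_open: "open coord_dom"
  unfolding coord_dom_def
  by (intro open_vimage split_continuous open_Times NB.chart_image_open[OF b] LC.chart_image_open[OF c])

lemma point_continuous: "continuous_on coord_dom point"
  unfolding point_def
  by (intro continuous_on_Pair continuous_on_compose2[OF NB.chart_inv_cont[OF b]]
      continuous_on_compose2[OF LC.chart_inv_cont[OF c]] continuous_on_fst continuous_on_snd split_continuous)
    (auto simp: coord_dom_def mem_Times_iff)

lemma point_in: "v \<in> coord_dom \<Longrightarrow> point v \<in> fst b \<times> fst c"
  by (auto simp: point_def coord_dom_def mem_Times_iff NB.chart_inv_in[OF b] LC.chart_inv_in[OF c])

definition pc :: "('n \<times> 'l, 'f \<times> 'g) chart" where
  "pc = (fst b \<times> fst c, \<lambda>(x, y). (snd b x, snd c y))"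

lemma pc: "pc \<in> product_atlas B C"
  unfolding product_atlas_def pc_def using b c by blast

lemma pc_point:
  assumes "v \<in> coord_dom"
  shows "snd pc (point v) = split v" "chart_inv pc (split v) = point v"
proof -
  show 1: "snd pc (point v) = split v"
    using assms by (auto simp: pc_def point_def coord_dom_def mem_Times_iff NB.chart_inv_right[OF b]
        LC.chart_inv_right[OF c] split: prod.splits)
  have "inj_on (snd pc) (fst pc)"
    unfolding pc_def inj_on_def
    using NB.chart_inv_left[OF b] LC.chart_inv_left[OF c] by auto metis+
  then show "chart_inv pc (split v) = point v"
    unfolding chart_inv_def using 1 point_in[OF assms]
    by (intro inv_into_f_eq) (auto simp: pc_def)
qed

lemma local_inverse:
  assumes z: "z \<in> coord_dom"
  obtains U where "open U" "point z \<in> U" "inj_on \<Sigma> U" "open (\<Sigma> ` U)"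
    "smooth_map_on (product_atlas B C) U A \<Sigma>"
    "smooth_map_on A (\<Sigma> ` U) (product_atlas B C) (inv_into U \<Sigma>)"
  using complete unfolding complete_solution_def local_diffeomorphism_def by metis

lemma point_vimage_open: "open U \<Longrightarrow> open (coord_dom \<inter> point -` U)"
  by (rule continuous_open_preimage[OF point_continuous coord_dom_open])

lemma sol_continuous: "continuous_on coord_dom sol"
proof -
  have "isCont \<Sigma> (point z)" if z: "z \<in> coord_dom" for z
  proof -
    obtain U where "open U" "point z \<in> U" "smooth_map_on (product_atlas B C) U A \<Sigma>"
      by (rule local_inverse[OF z]) blast
    then show ?thesis
      unfolding smooth_map_on_def using continuous_on_eq_continuous_at by blast
  qed
  then have "continuous_on (point ` coord_dom) \<Sigma>"
    by (auto intro: continuous_at_imp_continuous_on)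
  from continuous_on_compose[OF point_continuous this] show ?thesis
    by (simp add: sol_def[abs_def] o_def)
qed

lemma dom_in_open: "d \<in> A \<Longrightarrow> open (dom_in d)"
  using continuous_open_preimage[OF sol_continuous coord_dom_open MA.chart_open[of d]]
  by (simp add: dom_in_def Int_def)

lemma sol_injective_near:
  assumes "z \<in> coord_dom"
  shows "\<exists>T. open T \<and> z \<in> T \<and> T \<subseteq> coord_dom \<and> inj_on sol T"
proof -
  obtain U where U: "open U" "point z \<in> U" "inj_on \<Sigma> U" by (rule local_inverse[OF assms]) blast
  have "inj_on sol (coord_dom \<inter> point -` U)"
  proof (rule inj_onI)
    fix v w assume vw: "v \<in> coord_dom \<inter> point -` U" "w \<in> coord_dom \<inter> point -` U" "sol v = sol w"
    then have "point v = point w" using U(3) by (auto simp: sol_def inj_on_def)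
    then have "split v = split w" using pc_point(1)[of v] pc_point(1)[of w] vw by simp
    then show "v = w" using join_split' by metis
  qed
  then show ?thesis using point_vimage_open[OF U(1)] U(2) assms by blast
qed

definition \<psi> :: "('m, 'e) chart \<Rightarrow> 'e model \<Rightarrow> 'e" where
  "\<psi> d v = snd d (sol v)"

lemma \<psi>_Ck:
  assumes d: "d \<in> A"
  shows "Ck_on k (dom_in d) (\<psi> d)"
proof (rule Ck_on_local[OF dom_in_open[OF d]])
  fix z assume z: "z \<in> dom_in d"
  then have "z \<in> coord_dom" by (simp add: dom_in_def)
  then obtain U where U: "open U" "point z \<in> U" "smooth_map_on (product_atlas B C) U A \<Sigma>"
    by (rule local_inverse) blast
  let ?T = "coord_dom \<inter> point -` U"
  let ?f = "snd d \<circ> \<Sigma> \<circ> chart_inv pc"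
  have T: "open ?T" "z \<in> ?T" using point_vimage_open[OF U(1)] U(2) \<open>z \<in> coord_dom\<close> by auto
  have "Ck_on k (snd pc ` (fst pc \<inter> U \<inter> \<Sigma> -` fst d)) ?f"
    using U(3) pc d unfolding smooth_map_on_def smooth_on_def by blast
  then have "Ck_on k (?T \<inter> dom_in d) (\<lambda>v. ?f (split v))"
  proof (rule Ck_on_linear_right[OF split_bl])
    show "split ` (?T \<inter> dom_in d) \<subseteq> snd pc ` (fst pc \<inter> U \<inter> \<Sigma> -` fst d)"
    proof
      fix y assume "y \<in> split ` (?T \<inter> dom_in d)"
      then obtain v where v: "v \<in> ?T" "v \<in> dom_in d" "y = split v" by blast
      then have "point v \<in> fst pc \<inter> U \<inter> \<Sigma> -` fst d"
        using point_in[of v] by (auto simp: dom_in_def sol_def pc_def)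
      then show "y \<in> snd pc ` (fst pc \<inter> U \<inter> \<Sigma> -` fst d)"
        using v pc_point(1)[of v] by (metis IntD1 image_eqI)
    qed
  qed
  then have "Ck_on k (?T \<inter> dom_in d) (\<psi> d)"
    by (rule Ck_on_cong[OF open_Int[OF T(1) dom_in_open[OF d]]]) (simp add: \<psi>_def sol_def pc_point)
  then show "\<exists>T. open T \<and> z \<in> T \<and> Ck_on k (T \<inter> dom_in d) (\<psi> d)" using T by blast
qed

definition dchart :: "('m, 'e) chart \<Rightarrow> 'e model \<Rightarrow> 'e model \<Rightarrow> 'e" where
  "dchart d z = fderiv (\<psi> d) z"

lemma \<psi>_derivative: "d \<in> A \<Longrightarrow> z \<in> dom_in d \<Longrightarrow> (\<psi> d has_derivative dchart d z) (at z)"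
  unfolding dchart_def by (rule Ck_on_differentiable[OF \<psi>_Ck[of _ "Suc 0"]])

text \<open>The smooth local inverse of the complete solution provides a left inverse of the derivative.\<close>

lemma dchart_injective:
  assumes d: "d \<in> A" and z: "z \<in> dom_in d"
  shows "inj (dchart d z)"
proof -
  have "z \<in> coord_dom" using z by (simp add: dom_in_def)
  then obtain U where U: "open U" "point z \<in> U" "inj_on \<Sigma> U" "open (\<Sigma> ` U)"
    "smooth_map_on A (\<Sigma> ` U) (product_atlas B C) (inv_into U \<Sigma>)" by (rule local_inverse) blast
  let ?T = "(coord_dom \<inter> point -` U) \<inter> dom_in d"
  let ?\<tau> = "snd pc \<circ> inv_into U \<Sigma> \<circ> chart_inv d"
  let ?W = "snd d ` (fst d \<inter> \<Sigma> ` U \<inter> inv_into U \<Sigma> -` fst pc)"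
  have T: "open ?T" "z \<in> ?T" using point_vimage_open[OF U(1)] U(2) \<open>z \<in> coord_dom\<close> z dom_in_open[OF d] by auto
  have inv: "inv_into U \<Sigma> (sol v) = point v" if "v \<in> ?T" for v
    using U(3) that by (simp add: sol_def)
  have "smooth_on ?W ?\<tau>"
    using U(5) pc d unfolding smooth_map_on_def by blast
  moreover have "\<psi> d z \<in> ?W"
  proof -
    have "sol z \<in> fst d \<inter> \<Sigma> ` U \<inter> inv_into U \<Sigma> -` fst pc"
      using z U(2) inv[OF T(2)] point_in[OF \<open>z \<in> coord_dom\<close>] by (auto simp: dom_in_def sol_def pc_def)
    then show ?thesis unfolding \<psi>_def by blast
  qed
  ultimately have \<tau>: "(?\<tau> has_derivative fderiv ?\<tau> (\<psi> d z)) (at (\<psi> d z))"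
    by (rule smooth_on_differentiable)
  have "(split has_derivative (\<lambda>v. fderiv ?\<tau> (\<psi> d z) (dchart d z v))) (at z)"
  proof (rule has_derivative_transform_within_open[OF has_derivative_compose[OF \<psi>_derivative[OF d z] \<tau>] T])
    fix v assume v: "v \<in> ?T"
    then have "sol v \<in> fst d" by (simp add: dom_in_def)
    then show "?\<tau> (\<psi> d v) = split v"
      using inv[OF v] v by (simp add: \<psi>_def MA.chart_inv_left[OF d] pc_point)
  qed
  with bounded_linear_imp_has_derivative[OF split_bl]
  have "split = (\<lambda>v. fderiv ?\<tau> (\<psi> d z) (dchart d z v))"
    by (rule has_derivative_unique)
  then have "join (fderiv ?\<tau> (\<psi> d z) (dchart d z v)) = v" for v
    using join_split' by metis
  then show ?thesis by (metis injI)
qed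

text \<open>The derivative of \<open>sol\<close> with values in the tangent space, that is, in the preferred chart. That
chart varies with the point, but every derivative is taken in one chart.\<close>

definition dsol :: "'e model \<Rightarrow> 'e model \<Rightarrow> 'e" where
  "dsol z = dchart (chart_at A (sol z)) z"

lemma dom_in_chart_at: "z \<in> coord_dom \<Longrightarrow> z \<in> dom_in (chart_at A (sol z))"
  by (simp add: dom_in_def MA.chart_at)

lemma dsol_derivative: "z \<in> coord_dom \<Longrightarrow> (\<psi> (chart_at A (sol z)) has_derivative dsol z) (at z)"
  unfolding dsol_def by (intro \<psi>_derivative MA.chart_at dom_in_chart_at)

lemma dsol_linear: "z \<in> coord_dom \<Longrightarrow> linear (dsol z)"
  using dsol_derivative has_derivative_linear by blast

lemma dsol_change:
  assumes d: "d \<in> A" and z: "z \<in> dom_in d"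
  shows "transition_deriv d (chart_at A (sol z)) (sol z) (dchart d z v) = dsol z v"
proof -
  have "((\<lambda>y. snd (chart_at A (sol z)) (sol y)) has_derivative (\<lambda>v. transition_deriv d (chart_at A (sol z)) (sol z) (dchart d z v))) (at z)"
    by (rule MA.change_chart[OF d MA.chart_at(1) dom_in_open[OF d] z])
      (use \<psi>_derivative[OF d z] MA.chart_at in \<open>auto simp: dom_in_def \<psi>_def[abs_def]\<close>)
  from frechet_derivative_eq[OF this] show ?thesis
    by (simp add: dsol_def dchart_def \<psi>_def[abs_def])
qed

lemma to_model_inj: "inj (to_model :: 'e \<Rightarrow> _)"
  using of_to_model[OF pos] by (metis injI)

lemma dsol_surj:
  assumes "z \<in> coord_dom"
  shows "surj (dsol z)"
proof -
  have "inj (dsol z)" unfolding dsol_def by (rule dchart_injective[OF MA.chart_at(1) dom_in_chart_at[OF assms]])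
  then have "inj (\<lambda>v. to_model (dsol z v))"
    using to_model_inj by (simp add: inj_def)
  moreover have "linear (\<lambda>v. to_model (dsol z v))"
    using linear_compose[OF dsol_linear[OF assms] bounded_linear.linear[OF to_model_bounded_linear[OF pos]]]
    by (simp add: o_def)
  ultimately have "surj (\<lambda>v. to_model (dsol z v))"
    by (metis linear_injective_imp_surjective)
  then have "\<exists>v. to_model (dsol z v) = to_model w" for w by (metis surjD)
  then show ?thesis using to_model_inj by (metis injD surjI)
qed

lemma solution:
  "smooth_map B A (\<lambda>x. \<Sigma> (x, l))" "\<pi> (\<Sigma> (x, l)) = x"
  "tangent_map B A (\<lambda>x. \<Sigma> (x, l)) x (tangent_map A B \<pi> (\<Sigma> (x, l)) (X (\<Sigma> (x, l)))) = X (\<Sigma> (x, l))"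
proof -
  have H: "HJE_solution A B \<pi> X (\<lambda>x. \<Sigma> (x, l))" using complete by (simp add: complete_solution_def)
  then show "smooth_map B A (\<lambda>x. \<Sigma> (x, l))" and pi: "\<pi> (\<Sigma> (x, l)) = x"
    unfolding HJE_solution_def smooth_section_def by auto
  have "tangent_map B A (\<lambda>x. \<Sigma> (x, l)) (\<pi> (\<Sigma> (x, l))) (tangent_map A B \<pi> (\<Sigma> (x, l)) (X (\<Sigma> (x, l)))) = X (\<Sigma> (x, l))"
    using H unfolding HJE_solution_def by blast
  then show "tangent_map B A (\<lambda>x. \<Sigma> (x, l)) x (tangent_map A B \<pi> (\<Sigma> (x, l)) (X (\<Sigma> (x, l)))) = X (\<Sigma> (x, l))"
    using pi by simp
qed

text \<open>The restriction of \<open>sol\<close> to a fibre is a section \<open>\<Sigma> (\<cdot>, l)\<close> in the chart \<open>b\<close>, whereas the tangent map of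
the section refers to the preferred chart of \<open>N\<close>; the two differ by a change of charts.\<close>

lemma dsol_fibre:
  assumes z: "z \<in> coord_dom" and xl: "point z = (x, l)"
  shows "dsol z (join (u, 0)) = tangent_map B A (\<lambda>y. \<Sigma> (y, l)) x (transition_deriv b (chart_at B x) x u)"
proof -
  let ?d = "chart_at A (sol z)" and ?cB = "chart_at B x" and ?\<sigma> = "\<lambda>y. \<Sigma> (y, l)"
  let ?y0 = "fst (split z)" and ?w0 = "snd (split z)"
  have Sz: "sol z = ?\<sigma> x" by (simp add: sol_def xl)
  have x: "x = chart_inv b ?y0" "l = chart_inv c ?w0" using xl by (auto simp: point_def)
  have y0: "?y0 \<in> snd b ` fst b" using z by (auto simp: coord_dom_def mem_Times_iff)
  have xb: "x \<in> fst b" "snd b x = ?y0"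
    using x(1) NB.chart_inv_in[OF b y0] NB.chart_inv_right[OF b y0] by auto
  note cB = NB.chart_at[of x]
  have j: "join (?y0, ?w0) = z" using join_split'[of z] by simp
  have "((\<lambda>y. join (y, ?w0)) has_derivative (\<lambda>u. join (u, 0))) (at ?y0)"
    by (rule has_derivative_eq_rhs[OF bounded_linear.has_derivative[OF join_bl
        has_derivative_Pair[OF has_derivative_ident has_derivative_const]]]) simp
  moreover have "(\<psi> ?d has_derivative dsol z) (at (join (?y0, ?w0)))"
    unfolding j by (rule dsol_derivative[OF z])
  ultimately have "((\<lambda>y. \<psi> ?d (join (y, ?w0))) has_derivative (\<lambda>u. dsol z (join (u, 0)))) (at ?y0)"
    by (rule has_derivative_compose)
  moreover have "\<psi> ?d (join (y, ?w0)) = snd ?d (?\<sigma> (chart_inv b y))" for y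
    by (simp add: \<psi>_def sol_def point_def split_join' x(2))
  ultimately have 1: "((\<lambda>y. snd ?d (?\<sigma> (chart_inv b y))) has_derivative (\<lambda>u. dsol z (join (u, 0)))) (at ?y0)"
    by simp
  have "smooth_on (snd ?cB ` (fst ?cB \<inter> UNIV \<inter> ?\<sigma> -` fst ?d)) (snd ?d \<circ> ?\<sigma> \<circ> chart_inv ?cB)"
    using solution(1) cB MA.chart_at unfolding smooth_map_on_def by blast
  from smooth_on_differentiable[OF this, of "snd ?cB x"]
  have "((snd ?d \<circ> ?\<sigma> \<circ> chart_inv ?cB) has_derivative tangent_map B A ?\<sigma> x) (at (snd ?cB x))"
    using cB MA.chart_at(2)[of "sol z"] by (simp add: tangent_map_def Sz)
  then have "((snd ?d \<circ> ?\<sigma> \<circ> chart_inv ?cB) has_derivative tangent_map B A ?\<sigma> x) (at (snd ?cB (chart_inv b ?y0)))"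
    by (simp add: x(1)[symmetric])
  moreover have "((\<lambda>y. snd ?cB (chart_inv b y)) has_derivative transition_deriv b ?cB x) (at ?y0)"
    using NB.transition[OF b cB(1) xb(1) cB(2)] by (simp add: xb(2))
  ultimately have "((\<lambda>y. (snd ?d \<circ> ?\<sigma> \<circ> chart_inv ?cB) (snd ?cB (chart_inv b y))) has_derivative
      (\<lambda>u. tangent_map B A ?\<sigma> x (transition_deriv b ?cB x u))) (at ?y0)"
    using has_derivative_compose by blast
  then have 2: "((\<lambda>y. snd ?d (?\<sigma> (chart_inv b y))) has_derivative
      (\<lambda>u. tangent_map B A ?\<sigma> x (transition_deriv b ?cB x u))) (at ?y0)"
  proof (rule has_derivative_transform_within_open[OF _ NB.chart_image_Int_open[OF b NB.chart_open[OF cB(1)]]])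
    show "?y0 \<in> snd b ` (fst b \<inter> fst ?cB)" using xb cB by (metis IntI image_eqI)
    fix y assume "y \<in> snd b ` (fst b \<inter> fst ?cB)"
    then have "chart_inv b y \<in> fst ?cB" using NB.chart_inv_left[OF b] by auto
    then show "(snd ?d \<circ> ?\<sigma> \<circ> chart_inv ?cB) (snd ?cB (chart_inv b y)) = snd ?d (?\<sigma> (chart_inv b y))"
      by (simp add: NB.chart_inv_left[OF cB(1)])
  qed
  from has_derivative_unique[OF 1 2] show ?thesis by metis
qed

text \<open>The Hamilton-Jacobi equation says that the field is in the image of the tangent map of the
section through the point.\<close>

lemma dsol_surj_X:
  assumes z: "z \<in> coord_dom"
  shows "\<exists>Y. P Y = Y \<and> dsol z Y = X (sol z)"
proof -
  obtain x l where xl: "point z = (x, l)" by fastforce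
  let ?w = "tangent_map A B \<pi> (\<Sigma> (x, l)) (X (\<Sigma> (x, l)))"
  let ?u = "transition_deriv (chart_at B x) b x ?w"
  have "x \<in> fst b" using point_in[OF z] xl by simp
  then have "transition_deriv b (chart_at B x) x ?u = ?w"
    using NB.transition_deriv_inverse[OF NB.chart_at(1) b NB.chart_at(2)] by blast
  then have "dsol z (join (?u, 0)) = X (sol z)"
    using dsol_fibre[OF z xl] solution(3) by (simp add: sol_def xl)
  moreover have "P (join (?u, 0)) = join (?u, 0)" by (simp add: P_def split_join')
  ultimately show ?thesis by blast
qed

definition Y :: "'e model \<Rightarrow> 'e model" where
  "Y z = (SOME Y. P Y = Y \<and> dsol z Y = X (sol z))"

lemma Y: "z \<in> coord_dom \<Longrightarrow> P (Y z) = Y z" "z \<in> coord_dom \<Longrightarrow> dsol z (Y z) = X (sol z)"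
  using someI_ex[OF dsol_surj_X] unfolding Y_def by blast+

end

text \<open>The pullback \<open>\<theta>\<close> of the contact form, the Hamiltonian \<open>h\<close> and the field \<open>Y\<close> in the coordinates of the
complete solution satisfy the assumptions of \<^locale>\<open>isotropic_contact_form\<close>. Both \<open>\<theta>\<close> and \<open>h\<close> are
defined intrinsically; their expressions in a chart \<open>d\<close> serve two purposes: in the preferred
chart at a point they relate derivatives to \<^const>\<open>ext_deriv\<close> and \<^const>\<open>differential\<close>, and in the given
chart \<open>a\<close> they show that \<open>\<theta>\<close> and \<open>h\<close> are made of known functions.\<close>

locale contact_solution = complete_solution_charts A B C X \<pi> \<Sigma> b c
  for A :: "('m::t2_space, 'e::finite_dim_normed) chart set"
    and B :: "('n::t2_space, 'f::finite_dim_normed) chart set"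
    and C :: "('l::t2_space, 'g::finite_dim_normed) chart set"
    and X :: "'m \<Rightarrow> 'e" and \<pi> :: "'m \<Rightarrow> 'n" and \<Sigma> :: "'n \<times> 'l \<Rightarrow> 'm"
    and b :: "('n, 'f) chart" and c :: "('l, 'g) chart" +
  fixes n :: nat and \<H> :: "'m \<Rightarrow> 'e set" and \<eta> :: "'m \<Rightarrow> 'e \<Rightarrow> real" and \<xi> :: "'m \<Rightarrow> 'e"
  assumes dim: "model_dim TYPE('e) = 2 * n + 1"
    and \<eta>: "contact_form A n \<H> \<eta>" and X: "hamiltonian_contact_field A n \<H> X"
    and \<xi>: "reeb_field A \<eta> \<xi>"
    and H\<xi>: "\<And>p. differential A (hamiltonian_function \<eta> X) p (\<xi> p) = 0"
    and isotropic_solution: "pseudo_isotropic A B \<eta> \<Sigma>"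
begin

abbreviation e :: "nat \<Rightarrow> 'e model" where "e \<equiv> model_basis"

lemmas e = basis_enum_model[OF pos]
lemmas DIM = DIM_model[OF pos]

lemma form: "one_form_on A UNIV \<eta>" using \<eta> by (simp add: contact_form_def)

lemma X_field: "vector_field A X"
  using X unfolding hamiltonian_contact_field_def contact_field_def by blast

definition chart_range :: "('m, 'e) chart \<Rightarrow> 'e model set" where
  "chart_range d = of_model -` (snd d ` fst d)"

definition \<alpha> :: "('m, 'e) chart \<Rightarrow> 'e model \<Rightarrow> 'e model \<Rightarrow> real" where
  "\<alpha> d x w = MA.coeff \<eta> d (of_model x) (of_model w)"

definition \<phi> :: "('m, 'e) chart \<Rightarrow> 'e model \<Rightarrow> 'e model" where
  "\<phi> d z = to_model (\<psi> d z)"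

definition \<theta> :: "'e model \<Rightarrow> 'e model \<Rightarrow> real" where
  "\<theta> z w = \<eta> (sol z) (dsol z w)"

definition h :: "'e model \<Rightarrow> real" where
  "h z = \<eta> (sol z) (X (sol z))"

lemma chart_range_open: "d \<in> A \<Longrightarrow> open (chart_range d)"
  unfolding chart_range_def
  by (intro open_vimage MA.chart_image_open linear_continuous_on[OF of_model_bounded_linear])

lemma chart_range_image: "chart_range d = to_model ` snd d ` fst d"
proof
  show "chart_range d \<subseteq> to_model ` snd d ` fst d"
    unfolding chart_range_def using to_of_model[OF pos] by (metis image_eqI subsetI vimageE)
  show "to_model ` snd d ` fst d \<subseteq> chart_range d"
    unfolding chart_range_def using of_to_model[OF pos] by auto
qed

lemma \<phi>_in: "z \<in> dom_in d \<Longrightarrow> \<phi> d z \<in> chart_range d"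
  unfolding chart_range_image \<phi>_def \<psi>_def by (auto simp: dom_in_def)

lemma of_model_\<phi>: "of_model (\<phi> d z) = snd d (sol z)"
  using of_to_model[OF pos] by (simp add: \<phi>_def \<psi>_def)

lemma \<phi>_Ck: "d \<in> A \<Longrightarrow> Ck_on k (dom_in d) (\<phi> d)"
  unfolding \<phi>_def by (intro Ck_on_linear_left[OF to_model_bounded_linear[OF pos]] \<psi>_Ck)

lemma \<phi>_derivative: "d \<in> A \<Longrightarrow> z \<in> dom_in d \<Longrightarrow> (\<phi> d has_derivative (\<lambda>v. to_model (dchart d z v))) (at z)"
  unfolding \<phi>_def[abs_def]
  by (intro bounded_linear.has_derivative[OF to_model_bounded_linear[OF pos]] \<psi>_derivative)

lemma \<phi>_frechet: "d \<in> A \<Longrightarrow> z \<in> dom_in d \<Longrightarrow> fderiv (\<phi> d) z v = to_model (dchart d z v)"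
  by (rule frechet_derivative_eq[OF \<phi>_derivative])

lemma \<alpha>_linear:
  assumes "d \<in> A" "x \<in> chart_range d"
  shows "linear (\<alpha> d x)"
proof -
  have "linear (MA.coeff \<eta> d (of_model x))"
    by (rule MA.coeff_linear[OF form assms(1)]) (use assms in \<open>simp add: chart_range_def\<close>)
  from linear_compose[OF bounded_linear.linear[OF of_model_bounded_linear] this] show ?thesis
    by (simp add: \<alpha>_def[abs_def] o_def)
qed

lemma \<alpha>_Ck: "d \<in> A \<Longrightarrow> Ck_on k (chart_range d) (\<lambda>x. \<alpha> d x w)"
  unfolding \<alpha>_def
  by (rule Ck_on_linear_right[OF of_model_bounded_linear smooth_on_Ck[OF MA.coeff_smooth[OF form]]])
    (auto simp: chart_range_def)

lemma \<theta>_coordinates: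
  assumes d: "d \<in> A" and z: "z \<in> dom_in d"
  shows "\<theta> z w = \<alpha> d (\<phi> d z) (to_model (dchart d z w))"
proof -
  have "sol z \<in> fst d" using z by (simp add: dom_in_def)
  then show ?thesis
    using dsol_change[OF d z, of w] of_to_model[OF pos]
    by (simp add: \<alpha>_def of_model_\<phi> MA.coeff_def MA.chart_inv_left[OF d] from_chart_trans \<theta>_def)
qed

lemma \<theta>_sum:
  assumes d: "d \<in> A" and z: "z \<in> dom_in d"
  shows "\<theta> z w = (\<Sum>u\<in>Basis. (fderiv (\<phi> d) z w \<bullet> u) * \<alpha> d (\<phi> d z) u)"
  unfolding \<theta>_coordinates[OF assms] \<phi>_frechet[OF assms]
  by (rule linear_as_basis_sum[OF \<alpha>_linear[OF d \<phi>_in[OF z]]])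

lemma \<theta>_linear:
  assumes "z \<in> coord_dom"
  shows "linear (\<theta> z)"
proof -
  have "linear (\<eta> (sol z))" using form by (simp add: one_form_on_def)
  from linear_compose[OF dsol_linear[OF assms] this] show ?thesis
    by (simp add: \<theta>_def[abs_def] o_def)
qed

lemma \<theta>_Ck:
  assumes d: "d \<in> A"
  shows "Ck_on k (dom_in d) (\<lambda>z. \<theta> z w)"
proof -
  have "Ck_on k (dom_in d) (\<lambda>z. fderiv (\<phi> d) z w)"
    using \<phi>_Ck[OF d, of "Suc k"] Ck_on_Suc_frechet[OF dom_in_open[OF d]] by blast
  then have "Ck_on k (dom_in d) (\<lambda>z. \<Sum>u\<in>Basis. (fderiv (\<phi> d) z w \<bullet> u) * \<alpha> d (\<phi> d z) u)"
    by (intro Ck_on_sum Ck_on_mult Ck_on_linear_left[OF bounded_linear_inner_left]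
        Ck_on_compose[OF \<phi>_Ck[OF d] \<alpha>_Ck[OF d]])
      (use \<phi>_in[of _ d] in auto)
  then show ?thesis
    by (rule Ck_on_cong[OF dom_in_open[OF d]]) (simp add: \<theta>_sum[OF d])
qed

text \<open>Naturality of the exterior derivative for \<open>sol\<close>, read in the preferred chart at the point.\<close>

lemma form_d_\<theta>:
  assumes z: "z \<in> coord_dom"
  shows "form_d \<theta> z u v = ext_deriv A \<eta> (sol z) (dsol z u) (dsol z v)"
proof -
  let ?d = "chart_at A (sol z)"
  have d: "?d \<in> A" and zd: "z \<in> dom_in ?d" using MA.chart_at dom_in_chart_at[OF z] by auto
  have diff: "(\<lambda>x. \<alpha> ?d x w) differentiable (at x)" if "x \<in> chart_range ?d" for x w
    using Ck_on_differentiable[OF \<alpha>_Ck[OF d, of "Suc 0"] that] unfolding differentiable_def by blast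
  have "form_d \<theta> z u v = form_d (\<alpha> ?d) (\<phi> ?d z) (fderiv (\<phi> ?d) z u) (fderiv (\<phi> ?d) z v)"
    by (rule form_d_pullback[OF dom_in_open[OF d] zd \<phi>_Ck[OF d] chart_range_open[OF d]])
      (use \<phi>_in[of _ ?d] \<alpha>_linear[OF d] diff \<theta>_coordinates[OF d] \<phi>_frechet[OF d] in auto)
  also have "\<dots> = form_d (\<alpha> ?d) (to_model (snd ?d (sol z))) (to_model (dsol z u)) (to_model (dsol z v))"
    by (simp add: \<phi>_frechet[OF d zd] dsol_def \<phi>_def \<psi>_def)
  also have "\<dots> = ext_deriv A \<eta> (sol z) (dsol z u) (dsol z v)"
  proof -
    let ?x = "snd ?d (sol z)"
    have "fderiv (\<lambda>x. \<alpha> ?d x (to_model w)) (to_model ?x) (to_model w') =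
      fderiv (\<lambda>x. MA.coeff \<eta> ?d x w) ?x w'" for w w'
    proof -
      have "?x \<in> snd ?d ` fst ?d" using MA.chart_at by blast
      from MA.coeff_derivative[OF form d this, of w]
      have "((\<lambda>x. MA.coeff \<eta> ?d x w) has_derivative fderiv (\<lambda>x. MA.coeff \<eta> ?d x w) ?x) (at (of_model (to_model ?x)))"
        by (simp add: of_to_model[OF pos])
      from has_derivative_compose[OF bounded_linear_imp_has_derivative[OF of_model_bounded_linear] this]
      have "((\<lambda>x. \<alpha> ?d x (to_model w)) has_derivative
        (\<lambda>v. fderiv (\<lambda>x. MA.coeff \<eta> ?d x w) ?x (of_model v))) (at (to_model ?x))"
        by (simp add: \<alpha>_def of_to_model[OF pos])
      from frechet_derivative_eq[OF this] show ?thesis by (simp add: of_to_model[OF pos])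
    qed
    then show ?thesis by (simp add: form_d_def MA.ext_deriv_coeff)
  qed
  finally show ?thesis .
qed

definition field :: "('m, 'e) chart \<Rightarrow> 'e model \<Rightarrow> 'e model" where
  "field d x = to_model (to_chart A d (chart_inv d (of_model x)) (X (chart_inv d (of_model x))))"

lemma field_Ck:
  assumes "d \<in> A"
  shows "Ck_on k (chart_range d) (field d)"
proof -
  have "smooth_on (snd d ` fst d) (\<lambda>x. to_chart A d (chart_inv d x) (X (chart_inv d x)))"
    using X_field assms unfolding vector_field_def by blast
  from Ck_on_linear_left[OF to_model_bounded_linear[OF pos] smooth_on_Ck[OF this]]
  show ?thesis
    unfolding field_def[abs_def]
    by (rule Ck_on_linear_right[OF of_model_bounded_linear]) (auto simp: chart_range_def)
qed

lemma h_sum: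
  assumes d: "d \<in> A" and z: "z \<in> dom_in d"
  shows "h z = (\<Sum>u\<in>Basis. (field d (\<phi> d z) \<bullet> u) * \<alpha> d (\<phi> d z) u)"
proof -
  have Sd: "sol z \<in> fst d" using z by (simp add: dom_in_def)
  have "h z = \<alpha> d (\<phi> d z) (field d (\<phi> d z))"
    using MA.transition_deriv_inverse[OF MA.chart_at(1) d MA.chart_at(2) Sd] of_to_model[OF pos]
    by (simp add: \<alpha>_def field_def of_model_\<phi> MA.coeff_def MA.chart_inv_left[OF d Sd] from_chart_trans
        to_chart_trans h_def)
  then show ?thesis
    using linear_as_basis_sum[OF \<alpha>_linear[OF d \<phi>_in[OF z]]] by metis
qed

lemma h_Ck:
  assumes d: "d \<in> A"
  shows "Ck_on k (dom_in d) h"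
proof -
  have "Ck_on k (dom_in d) (\<lambda>z. \<Sum>u\<in>Basis. (field d (\<phi> d z) \<bullet> u) * \<alpha> d (\<phi> d z) u)"
    by (intro Ck_on_sum Ck_on_mult Ck_on_linear_left[OF bounded_linear_inner_left]
        Ck_on_compose[OF \<phi>_Ck[OF d] \<alpha>_Ck[OF d]] Ck_on_compose[OF \<phi>_Ck[OF d] field_Ck[OF d]])
      (use \<phi>_in[of _ d] in auto)
  then show ?thesis
    by (rule Ck_on_cong[OF dom_in_open[OF d]]) (simp add: h_sum[OF d])
qed

lemma h_frechet:
  assumes z: "z \<in> coord_dom"
  shows "fderiv h z v = differential A (hamiltonian_function \<eta> X) (sol z) (dsol z v)"
proof (rule frechet_derivative_eq)
  let ?d = "chart_at A (sol z)" and ?H = "hamiltonian_function \<eta> X"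
  have d: "?d \<in> A" and zd: "z \<in> dom_in ?d" using MA.chart_at dom_in_chart_at[OF z] by auto
  have "((\<lambda>x. ?H (chart_inv ?d x)) has_derivative differential A ?H (sol z)) (at (\<psi> ?d z))"
    using MA.contact_equation(1)[OF \<eta> X \<xi> H\<xi>, of "sol z"]
    by (simp add: frechet_derivative_works differential_def \<psi>_def o_def)
  from has_derivative_compose[OF dsol_derivative[OF z] this]
  show "(h has_derivative (\<lambda>v. differential A ?H (sol z) (dsol z v))) (at z)"
    by (rule has_derivative_transform_within_open[OF _ dom_in_open[OF d] zd])
      (simp add: \<psi>_def MA.chart_inv_left[OF d] dom_in_def hamiltonian_function_def h_def)
qed

lemma isotropic_contact_form_coordinates:
  assumes a: "a \<in> A" and r: "0 < r" "ball z0 r \<subseteq> dom_in a"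
  shows "isotropic_contact_form P \<theta> z0 r h Y"
proof (intro isotropic_contact_form.intro isotropic_form.intro isotropic_contact_form_axioms.intro)
  have coord_dom: "z \<in> coord_dom" if "z \<in> ball z0 r" for z using r(2) that by (auto simp: dom_in_def)
  show "linear P" unfolding P_fibre_part by (rule fibre_part_linear[OF pos dims])
  show "P (P v) = P v" for v unfolding P_fibre_part by (rule fibre_part_idem[OF pos dims])
  show "norm (P v) \<le> norm v" for v unfolding P_fibre_part by (rule fibre_part_norm[OF pos dims])
  show "0 < r" by fact
  show "linear (\<theta> z)" if "z \<in> ball z0 r" for z using \<theta>_linear[OF coord_dom[OF that]] .
  show "Ck_on 2 (ball z0 r) (\<lambda>z. \<theta> z w)" for w by (rule Ck_on_subset[OF \<theta>_Ck[OF a] r(2)])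
  show "Ck_on 2 (ball z0 r) h" by (rule Ck_on_subset[OF h_Ck[OF a] r(2)])
  fix z assume "z \<in> ball z0 r"
  note z = coord_dom[OF this]
  show "form_d \<theta> z (P u) (P v) = 0" for u v
  proof -
    obtain x l where xl: "point z = (x, l)" by fastforce
    have "ext_deriv A \<eta> (sol z) (dsol z (join (u', 0))) (dsol z (join (v', 0))) = 0" for u' v'
      unfolding dsol_fibre[OF z xl] using isotropic_solution
      unfolding pseudo_isotropic_def sol_def xl by blast
    then show ?thesis unfolding form_d_\<theta>[OF z] P_def .
  qed
  show "P (Y z) = Y z" by (rule Y(1)[OF z])
  show "form_d \<theta> z (Y z) v = - fderiv h z v" for v
    unfolding form_d_\<theta>[OF z] h_frechet[OF z] Y(2)[OF z]
    by (rule MA.contact_equation(2)[OF \<eta> X \<xi> H\<xi>])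
  show "\<theta> z (Y z) = h z" by (simp add: \<theta>_def h_def Y(2)[OF z])
  show "u = 0" if u: "\<And>v. form_d \<theta> z u v = 0" "\<theta> z u = 0" for u
  proof -
    have "dsol z u = 0"
    proof (rule contact_form_nondegenerate[OF MA.smooth_atlas \<eta> dim])
      show "ext_deriv A \<eta> (sol z) (dsol z u) v = 0" for v
        using u(1) dsol_surj[OF z] unfolding form_d_\<theta>[OF z] by (metis surjD)
      show "\<eta> (sol z) (dsol z u) = 0" using u(2) by (simp add: \<theta>_def)
    qed
    moreover have "inj (dsol z)" unfolding dsol_def by (rule dchart_injective[OF MA.chart_at(1) dom_in_chart_at[OF z]])
    ultimately show ?thesis using linear_injective_0[OF dsol_linear[OF z]] by blast
  qed
qed

section \<open>The flow in the known charts\<close>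

context
  fixes a :: "('m, 'e) chart"
  assumes a: "a \<in> A"
begin

abbreviation "data \<equiv> known_data A a b c X \<eta> \<pi> \<Sigma>"

lemma coords_image: "coords a ` fst a = tup e ` chart_range a"
  unfolding chart_range_image image_image coords_def tup_to_model[OF pos] ..

lemma coords_inv_tup: "coords_inv a (tup e x) = chart_inv a (of_model x)"
  by (simp add: coords_inv_def of_model_def)

lemma \<phi>_component:
  assumes "i < model_dim TYPE('e)"
  shows "\<phi> a z \<bullet> e i = coords a (sol z) i"
proof -
  have "coords a (sol z) = tup e (\<phi> a z)" by (simp add: coords_def \<phi>_def \<psi>_def tup_to_model[OF pos])
  then show ?thesis using assms by (simp add: tup_nth DIM del: DIM_cart)
qed

lemma quad_field:
  assumes i: "i < model_dim TYPE('e)"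
  shows "quad data e (chart_range a) (\<lambda>x. field a x \<bullet> e i)"
proof (rule quad_from_quadratures[OF e _ chart_range_open[OF a] order_refl])
  show "quadratures data DIM('e model) (tup e ` chart_range a)
      (\<lambda>x. components (to_chart A a (coords_inv a x) (X (coords_inv a x))) i)"
    unfolding DIM coords_image[symmetric]
    by (rule quadratures.known) (use i in \<open>auto simp: known_data_def Let_def\<close>)
  show "field a x \<bullet> e i = components (to_chart A a (coords_inv a (tup e x)) (X (coords_inv a (tup e x)))) i" for x
    unfolding coords_inv_tup field_def tup_to_model[OF pos, symmetric] using i by (simp add: tup_nth DIM del: DIM_cart)
qed

lemma quad_\<alpha>:
  assumes i: "i < model_dim TYPE('e)"
  shows "quad data e (chart_range a) (\<lambda>x. \<alpha> a x (e i))"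
proof (rule quad_from_quadratures[OF e _ chart_range_open[OF a] order_refl])
  show "quadratures data DIM('e model) (tup e ` chart_range a)
      (\<lambda>x. \<eta> (coords_inv a x) (from_chart A a (coords_inv a x) (frame i)))"
    unfolding DIM coords_image[symmetric]
    by (rule quadratures.known) (use i in \<open>auto simp: known_data_def Let_def\<close>)
  show "\<alpha> a x (e i) = \<eta> (coords_inv a (tup e x)) (from_chart A a (coords_inv a (tup e x)) (frame i))" for x
    by (simp add: coords_inv_tup \<alpha>_def MA.coeff_def of_model_basis[OF i])
qed

text \<open>The known expression of the complete solution is a function on \<open>\<real>\<^sup>d\<close> with the first coordinates in
the chart \<open>b\<close> and the others in \<open>c\<close>, which is what \<^const>\<open>split_model\<close> was made for.\<close>

lemma quad_\<phi>:
  assumes i: "i < model_dim TYPE('e)"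
  shows "quad data e (dom_in a) (\<lambda>z. \<phi> a z \<bullet> e i)"
proof (rule quad_from_quadratures[OF e _ dom_in_open[OF a] order_refl])
  let ?dN = "model_dim TYPE('f)" and ?dL = "model_dim TYPE('g)"
  let ?S = "\<lambda>z. \<Sigma> (coords_inv b (tuple ?dN z), coords_inv c (tuple ?dL (\<lambda>i. z (?dN + i))))"
  have d: "?dN + ?dL = model_dim TYPE('e)" using dims by simp
  have sol_eq: "?S (tup e v) = sol v" for v
    by (simp add: sol_def point_def split_model_def coords_inv_def)
  have mem: "tuple k z \<in> components ` T \<longleftrightarrow> from_components (tuple k z) \<in> T"
    if "k = model_dim TYPE('x)" for k z and T :: "'x::finite_dim_normed set"
  proof
    assume "tuple k z \<in> components ` T"
    then show "from_components (tuple k z) \<in> T" by auto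
  next
    assume *: "from_components (tuple k z) \<in> T"
    have "components (from_components (tuple k z) :: 'x) = tuple k z"
      using that by (auto simp: tuple_def)
    with * show "tuple k z \<in> components ` T" by (metis image_eqI)
  qed
  have cb: "coords b ` fst b = components ` snd b ` fst b" "coords c ` fst c = components ` snd c ` fst c"
    by (simp_all add: coords_def image_image)
  have "tup e ` dom_in a = {z \<in> topspace (Euclidean_space (?dN + ?dL)).
      tuple ?dN z \<in> coords b ` fst b \<and> tuple ?dL (\<lambda>i. z (?dN + i)) \<in> coords c ` fst c \<and> ?S z \<in> fst a}"
    (is "_ = ?R")
  proof -
    have "untup e x \<in> dom_in a \<longleftrightarrow> tuple ?dN x \<in> coords b ` fst b \<and>
        tuple ?dL (\<lambda>i. x (?dN + i)) \<in> coords c ` fst c \<and> ?S x \<in> fst a"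
      if x: "x \<in> topspace (Euclidean_space DIM('e model))" for x
    proof -
      define v where "v = untup e x"
      have xv: "x = tup e v" using tup_untup_id[OF e x] by (simp add: v_def)
      show ?thesis
        unfolding v_def[symmetric] xv sol_eq cb mem[OF refl]
        by (simp add: untup_tup[OF e] dom_in_def coord_dom_def mem_Times_iff split_model_def)
    qed
    then show ?thesis unfolding tup_image[OF e] d DIM by blast
  qed
  then show "quadratures data DIM('e model) (tup e ` dom_in a) (\<lambda>z. coords a (?S z) i)"
    unfolding DIM d[symmetric]
    by (intro quadratures.known) (use i in \<open>auto simp: known_data_def Let_def\<close>)
  show "\<phi> a z \<bullet> e i = coords a (?S (tup e z)) i" for z
    unfolding sol_eq by (rule \<phi>_component[OF i])
qed

lemma quad_\<theta>:
  assumes j: "j < model_dim TYPE('e)"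
  shows "quad data e (dom_in a) (\<lambda>z. \<theta> z (e j))"
proof -
  have "quad data e (dom_in a) (\<lambda>z. fderiv (\<phi> a) z (e j) \<bullet> e i)" if i: "i < model_dim TYPE('e)" for i
  proof (rule quad_derivative[OF e _ quad_\<phi>[OF i], of j "\<lambda>z v. fderiv (\<phi> a) z v \<bullet> e i"])
    show "j < DIM('e model)" using j DIM by simp
    show "((\<lambda>z. \<phi> a z \<bullet> e i) has_derivative (\<lambda>v. fderiv (\<phi> a) z v \<bullet> e i)) (at z)" if "z \<in> dom_in a" for z
      by (rule has_derivative_inner_left[OF Ck_on_differentiable[OF \<phi>_Ck[OF a, of "Suc 0"] that]])
  qed
  then have "quad data e (dom_in a) (\<lambda>z. \<Sum>i<DIM('e model).
      (fderiv (\<phi> a) z (e j) \<bullet> e i) * \<alpha> a (\<phi> a z) (e i))"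
    unfolding DIM using \<phi>_in[of _ a]
    by (intro quad_sum[OF e dom_in_open[OF a]] quad_mult quad_compose[OF e e quad_\<alpha> dom_in_open[OF a]])
      (auto simp: DIM intro: quad_\<phi> simp del: DIM_cart)
  then show ?thesis
  proof (rule quad_restrict[OF e _ dom_in_open[OF a] order_refl])
    show "\<theta> z (e j) = (\<Sum>i<DIM('e model).
      (fderiv (\<phi> a) z (e j) \<bullet> e i) * \<alpha> a (\<phi> a z) (e i))" if "z \<in> dom_in a" for z
      unfolding \<theta>_sum[OF a that] by (rule basis_enum_sum[OF e, symmetric])
  qed
qed

lemma quad_h: "quad data e (dom_in a) h"
proof -
  have "quad data e (dom_in a) (\<lambda>z. \<Sum>i<DIM('e model).
      (field a (\<phi> a z) \<bullet> e i) * \<alpha> a (\<phi> a z) (e i))"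
    unfolding DIM using \<phi>_in[of _ a]
    by (intro quad_sum[OF e dom_in_open[OF a]] quad_mult quad_compose[OF e e quad_\<alpha> dom_in_open[OF a]]
        quad_compose[OF e e quad_field dom_in_open[OF a]])
      (auto simp: DIM intro: quad_\<phi> simp del: DIM_cart)
  then show ?thesis
  proof (rule quad_restrict[OF e _ dom_in_open[OF a] order_refl])
    show "h z = (\<Sum>i<DIM('e model).
      (field a (\<phi> a z) \<bullet> e i) * \<alpha> a (\<phi> a z) (e i))" if "z \<in> dom_in a" for z
      unfolding h_sum[OF a that] by (rule basis_enum_sum[OF e, symmetric])
  qed
qed

text \<open>Near \<open>z0\<close> the map \<open>\<phi> a\<close> from the coordinates of the complete solution to the chart \<open>a\<close> is invertible
by solving known equations. Its inverse \<open>\<zeta>\<close>, the local flow \<open>\<gamma>\<close> and \<open>\<phi> a\<close> compose to the flow in the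
chart \<open>a\<close> as a function of the initial point and of time.\<close>

lemma flow:
  assumes z0: "z0 \<in> dom_in a"
  shows "flow_by_quadratures data A a X (sol z0)"
proof -
  have "z0 \<in> coord_dom" using z0 by (simp add: dom_in_def)
  from sol_injective_near[OF this] obtain T where T: "open T" "z0 \<in> T" "inj_on sol T" by blast
  obtain r where r: "0 < r" "ball z0 r \<subseteq> dom_in a \<inter> T"
    using open_contains_ball[of "dom_in a \<inter> T"] dom_in_open[OF a] T z0 by blast
  interpret I: isotropic_contact_form P \<theta> z0 r h Y
    by (rule isotropic_contact_form_coordinates[OF a r(1)]) (use r in blast)
  have q\<theta>: "quad data e (ball z0 r) (\<lambda>z. \<theta> z (e i))" if "i < DIM('e model)" for i
    by (rule quad_restrict[OF e quad_\<theta> open_ball]) (use that r DIM in auto)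
  have qh: "quad data e (ball z0 r) h"
    by (rule quad_restrict[OF e quad_h open_ball]) (use r in auto)
  obtain Q \<epsilon> \<gamma> where Q: "open Q" "z0 \<in> Q" "Q \<subseteq> ball z0 r" and \<epsilon>: "0 < \<epsilon>"
    and \<gamma>: "continuous_on (Q \<times> {-\<epsilon><..<\<epsilon>}) \<gamma>" "\<gamma> ` (Q \<times> {-\<epsilon><..<\<epsilon>}) \<subseteq> ball z0 r"
      "\<And>z. z \<in> Q \<Longrightarrow> \<gamma> (z, 0) = z"
      "\<And>z t. z \<in> Q \<Longrightarrow> t \<in> {-\<epsilon><..<\<epsilon>} \<Longrightarrow> ((\<lambda>t. \<gamma> (z, t)) has_vector_derivative Y (\<gamma> (z, t))) (at t)"
    and q\<gamma>: "\<And>i. i < DIM('e model) \<Longrightarrow> quad data (ext_enum e) (Q \<times> {-\<epsilon><..<\<epsilon>}) (\<lambda>p. \<gamma> p \<bullet> e i)"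
    by (rule I.local_flow[OF e q\<theta> qh]) blast+
  let ?I = "{-\<epsilon><..<\<epsilon>}" and ?d = "model_dim TYPE('e)"
  have QZ: "Q \<subseteq> dom_in a" "Q \<subseteq> T" using Q r by auto
  have \<gamma>coord_dom: "\<gamma> (z, t) \<in> dom_in a" if "z \<in> Q" "t \<in> ?I" for z t using \<gamma>(2) that r by blast
  have inj: "inj_on (\<phi> a) Q"
  proof (rule inj_onI)
    fix z w assume zw: "z \<in> Q" "w \<in> Q" "\<phi> a z = \<phi> a w"
    then have "snd a (sol z) = snd a (sol w)" using of_model_\<phi> by metis
    moreover have "sol z \<in> fst a" "sol w \<in> fst a" using zw QZ by (auto simp: dom_in_def)
    ultimately have "sol z = sol w" using MA.chart_inv_left[OF a] by metis
    then show "z = w" using T(3) zw QZ by (auto simp: inj_on_def)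
  qed
  have cont: "continuous_on Q (\<phi> a)"
    using Ck_on_continuous[OF \<phi>_Ck[OF a]] QZ continuous_on_subset by blast
  have op: "open (\<phi> a ` Q)" by (rule invariance_of_domain[OF cont Q(1) inj])
  define \<zeta> where "\<zeta> = inv_into Q (\<phi> a)"
  have \<zeta>: "\<zeta> (\<phi> a z) = z" if "z \<in> Q" for z using inj that by (simp add: \<zeta>_def)
  have \<zeta>': "\<zeta> y \<in> Q" "\<phi> a (\<zeta> y) = y" if "y \<in> \<phi> a ` Q" for y
    using that by (auto simp: \<zeta>_def inv_into_into f_inv_into_f)
  have \<zeta>_cont: "continuous_on (\<phi> a ` Q) \<zeta>"
    by (rule continuous_on_inverse_open[OF Q(1) cont order_refl]) (use \<zeta> in auto)
  define V where "V = {p \<in> fst a. to_model (snd a p) \<in> \<phi> a ` Q}"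
  define \<Phi> where "\<Phi> p t = sol (\<gamma> (\<zeta> (to_model (snd a p)), t))" for p t
  have "continuous_on (fst a) (\<lambda>p. to_model (snd a p))"
    by (rule bounded_linear.continuous_on[OF to_model_bounded_linear[OF pos] MA.chart_cont[OF a]])
  from continuous_open_preimage[OF this MA.chart_open[OF a] op]
  have V_open: "open V" by (simp add: V_def Int_def vimage_def)
  have sol_\<zeta>: "sol (\<zeta> (to_model (snd a p))) = p" if p: "p \<in> V" for p
  proof -
    let ?z = "\<zeta> (to_model (snd a p))"
    have z: "?z \<in> Q" "\<phi> a ?z = to_model (snd a p)" using p \<zeta>' by (auto simp: V_def)
    then have "snd a (sol ?z) = snd a p"
      using of_model_\<phi>[of a ?z] of_to_model[OF pos, of "snd a p"] by simp
    moreover have "sol ?z \<in> fst a" "p \<in> fst a" using z QZ p by (auto simp: dom_in_def V_def)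
    ultimately show ?thesis using MA.chart_inv_left[OF a] by metis
  qed
  have "sol z0 \<in> V"
    using Q(2) z0 by (auto simp: V_def dom_in_def \<phi>_def \<psi>_def)
  moreover have "V \<subseteq> fst a" by (auto simp: V_def)
  moreover have "\<Phi> p 0 = p \<and> integral_curve A X ?I (\<Phi> p) \<and> (\<forall>t\<in>?I. \<Phi> p t \<in> fst a)" if p: "p \<in> V" for p
  proof -
    define z where "z = \<zeta> (to_model (snd a p))"
    have z: "z \<in> Q" unfolding z_def using p \<zeta>' by (auto simp: V_def)
    have \<Phi>: "\<Phi> p t = sol (\<gamma> (z, t))" for t by (simp add: \<Phi>_def z_def)
    have 0: "\<Phi> p 0 = p" using \<Phi> \<gamma>(3)[OF z] sol_\<zeta>[OF p] by (simp add: z_def)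
    have dom: "\<gamma> (z, t) \<in> coord_dom" if "t \<in> ?I" for t using \<gamma>coord_dom[OF z that] by (simp add: dom_in_def)
    have "continuous_on ?I (\<lambda>t. sol (\<gamma> (z, t)))"
      by (rule continuous_on_compose2[OF sol_continuous continuous_on_compose2[OF \<gamma>(1)]])
        (use z dom in \<open>auto intro!: continuous_intros\<close>)
    moreover have "((\<lambda>s. snd (chart_at A (\<Phi> p t)) (\<Phi> p s)) has_vector_derivative X (\<Phi> p t)) (at t)"
      if t: "t \<in> ?I" for t
    proof -
      let ?y = "\<gamma> (z, t)"
      have "((\<lambda>s. \<gamma> (z, s)) has_derivative (\<lambda>s. s *\<^sub>R Y ?y)) (at t)"
        using \<gamma>(4)[OF z t] by (simp add: has_vector_derivative_def)
      from has_derivative_compose[OF this dsol_derivative[OF dom[OF t]]]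
      have "((\<lambda>s. \<psi> (chart_at A (sol ?y)) (\<gamma> (z, s))) has_derivative (\<lambda>s. dsol ?y (s *\<^sub>R Y ?y))) (at t)" .
      then show ?thesis
        using linear_scale[OF dsol_linear[OF dom[OF t]]] Y(2)[OF dom[OF t]]
        by (simp add: has_vector_derivative_def \<psi>_def \<Phi>)
    qed
    ultimately have "integral_curve A X ?I (\<Phi> p)"
      unfolding integral_curve_def by (simp add: \<Phi>)
    with 0 show ?thesis using \<gamma>coord_dom[OF z] by (simp add: \<Phi> dom_in_def)
  qed
  moreover have "quadratures data (Suc ?d) {(coords a p)(?d := t) | p t. p \<in> V \<and> t \<in> ?I}
      (\<lambda>x. coords a (\<Phi> (coords_inv a (x(?d := 0))) (x ?d)) i)" if i: "i < ?d" for i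
  proof -
    let ?ee = "ext_enum e" and ?U = "\<phi> a ` Q"
    note ee = basis_enum_ext[OF e]
    have opU: "open (?U \<times> ?I)" using op by (intro open_Times) auto
    have q\<zeta>: "quad data e ?U (\<lambda>y. \<zeta> y \<bullet> e j)" if j: "j < DIM('e model)" for j
    proof (rule quad_solve[OF e e Q(1) op _ _ _ inj _ \<zeta>_cont _ _ j, where f' = "\<lambda>z v. to_model (dchart a z v)" and g = "\<lambda>y. y"])
      show "quad data e Q (\<lambda>z. \<phi> a z \<bullet> e j)" if "j < DIM('e model)" for j
        by (rule quad_restrict[OF e quad_\<phi> Q(1) QZ(1)]) (use that DIM in auto)
      show "(\<phi> a has_derivative (\<lambda>v. to_model (dchart a z v))) (at z)" if "z \<in> Q" for z
        by (rule \<phi>_derivative[OF a]) (use that QZ in auto)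
      show "inj (\<lambda>v. to_model (dchart a z v))" if "z \<in> Q" for z
        using inj_compose[OF to_model_inj dchart_injective[OF a, of z]] that QZ by (auto simp: o_def)
      show "quad data e ?U (\<lambda>y. y \<bullet> e j)" if "j < DIM('e model)" for j
        by (rule quad_inner[OF e op that])
    qed (use \<zeta>' in auto)
    have qw: "quad data ?ee (?U \<times> ?I) (\<lambda>p. (\<zeta> (fst p), snd p) \<bullet> ?ee j)" for j
      by (intro quad_Pair quad_snd[OF e opU] quad_compose[OF ee e q\<zeta> opU] quad_fst[OF e opU]) auto
    have q: "quad data ?ee (?U \<times> ?I) (\<lambda>p. \<gamma> (\<zeta> (fst p), snd p) \<bullet> e j)" if "j < DIM('e model)" for j
      by (rule quad_compose[OF ee ee q\<gamma>[OF that] opU qw]) (use \<zeta>' in auto)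
    have "quad data ?ee (?U \<times> ?I) (\<lambda>p. \<phi> a (\<gamma> (\<zeta> (fst p), snd p)) \<bullet> e i)"
      by (rule quad_compose[OF ee e quad_\<phi>[OF i] opU q]) (use \<zeta>' \<gamma>coord_dom in auto)
    then have "quadratures data DIM('e model \<times> real) (tup ?ee ` (?U \<times> ?I))
      (\<lambda>x. coords a (\<Phi> (coords_inv a (x(?d := 0))) (x ?d)) i)"
    proof (rule quad_to_quadratures[OF ee _ opU])
      fix p assume "p \<in> ?U \<times> ?I"
      then obtain y t where p: "p = (y, t)" and y: "y \<in> ?U" and t: "t \<in> ?I" by blast
      have t': "tup ?ee (y, t) ?d = t" by (simp add: tup_ext DIM del: DIM_cart)
      have x: "tup ?ee p = (tup e y)(?d := t)" by (simp add: p tup_ext DIM del: DIM_cart)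
      have "tup e y ?d = 0" by (simp add: tup_def tuple_def DIM del: DIM_cart)
      then have "((tup e y)(?d := t))(?d := 0) = tup e y" by (metis fun_upd_triv fun_upd_upd)
      then have 1: "coords_inv a ((tup ?ee p)(?d := 0)) = chart_inv a (of_model y)"
        by (simp add: x coords_inv_tup)
      have "y \<in> chart_range a" using y \<phi>_in[of _ a] QZ by blast
      then have "snd a (chart_inv a (of_model y)) = of_model y"
        using MA.chart_inv_right[OF a] by (simp add: chart_range_def)
      then have "\<Phi> (chart_inv a (of_model y)) t = sol (\<gamma> (\<zeta> y, t))"
        by (simp add: \<Phi>_def to_of_model[OF pos])
      then show "coords a (\<Phi> (coords_inv a ((tup ?ee p)(?d := 0))) (tup ?ee p ?d)) i =
          \<phi> a (\<gamma> (\<zeta> (fst p), snd p)) \<bullet> e i"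
        unfolding 1 by (simp add: \<phi>_component[OF i] p t' del: DIM_cart)
    qed
    moreover have "tup ?ee ` (?U \<times> ?I) = {(coords a p)(?d := t) | p t. p \<in> V \<and> t \<in> ?I}"
    proof -
      have tp: "tup ?ee (to_model (snd a p), t) = (coords a p)(?d := t)" for p t
        by (simp add: tup_ext DIM tup_to_model[OF pos] coords_def del: DIM_cart)
      show ?thesis
      proof (intro subset_antisym subsetI)
        fix x assume "x \<in> tup ?ee ` (?U \<times> ?I)"
        then obtain z t where z: "z \<in> Q" and t: "t \<in> ?I" and x: "x = tup ?ee (\<phi> a z, t)" by blast
        have "sol z \<in> V" using z QZ by (auto simp: V_def dom_in_def \<phi>_def \<psi>_def)
        moreover have "x = (coords a (sol z))(?d := t)" using tp[of "sol z" t] x by (simp add: \<phi>_def \<psi>_def)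
        ultimately show "x \<in> {(coords a p)(?d := t) | p t. p \<in> V \<and> t \<in> ?I}" using t by blast
      next
        fix x assume "x \<in> {(coords a p)(?d := t) | p t. p \<in> V \<and> t \<in> ?I}"
        then obtain p t where p: "p \<in> V" and t: "t \<in> ?I" and x: "x = (coords a p)(?d := t)" by blast
        have "to_model (snd a p) \<in> ?U" using p by (simp add: V_def)
        then show "x \<in> tup ?ee ` (?U \<times> ?I)" using tp[of p t] x t by (metis SigmaI image_eqI)
      qed
    qed
    ultimately show ?thesis by (simp add: DIM del: DIM_cart)
  qed
  ultimately show ?thesis
    unfolding flow_by_quadratures_def Let_def using V_open \<epsilon> by blast
qed

end

end

theorem theorem6:
  fixes A :: "('m::{t2_space, second_countable_topology}, 'e::finite_dim_normed) chart set"
    and B :: "('n::{t2_space, second_countable_topology}, 'f::finite_dim_normed) chart set"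
    and C :: "('l::{t2_space, second_countable_topology}, 'g::finite_dim_normed) chart set"
    and n :: nat
    and \<H> :: "'m \<Rightarrow> 'e set"
    and X \<xi> :: "'m \<Rightarrow> 'e"
    and \<eta> :: "'m \<Rightarrow> 'e \<Rightarrow> real"
    and \<pi> :: "'m \<Rightarrow> 'n"
    and \<Sigma> :: "'n \<times> 'l \<Rightarrow> 'm"
  assumes "smooth_atlas A" and "smooth_atlas B" and "smooth_atlas C"
    and "contact_structure A n \<H>"
    and "hamiltonian_contact_field A n \<H> X"
    and "fibration A B \<pi>"
    and "contact_form A n \<H> \<eta>"
    and "reeb_field A \<eta> \<xi>"
    and "\<forall>p. differential A (hamiltonian_function \<eta> X) p (\<xi> p) = 0"
    and "complete_solution A B C \<pi> X \<Sigma>"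
    and "pseudo_isotropic A B \<eta> \<Sigma>"
  shows "integrable_by_quadratures A B C X \<eta> \<pi> \<Sigma>"
  unfolding integrable_by_quadratures_def
proof (intro allI ballI impI)
  fix x l a b c
  assume a: "a \<in> A" and b: "b \<in> B" and c: "c \<in> C"
    and mem: "\<Sigma> (x, l) \<in> fst a" "x \<in> fst b" "l \<in> fst c"
  have dim: "model_dim TYPE('e) = 2 * n + 1"
    using assms(4) by (simp add: contact_structure_def)
  interpret contact_solution A B C X \<pi> \<Sigma> b c n \<H> \<eta> \<xi>
    by unfold_locales (use assms b c dim in auto)
  let ?z = "join (snd b x, snd c l)"
  have p: "point ?z = (x, l)"
    using mem NB.chart_inv_left[OF b] LC.chart_inv_left[OF c] by (simp add: point_def split_join')
  have "?z \<in> dom_in a"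
    using mem p by (simp add: dom_in_def coord_dom_def sol_def split_join')
  from flow[OF a this] show "flow_by_quadratures (known_data A a b c X \<eta> \<pi> \<Sigma>) A a X (\<Sigma> (x, l))"
    by (simp add: sol_def p)
qed

end
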